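(* Let $\mathbf u(t,x)=\begin{pmatrix}\hat u\\ u_3\end{pmatrix}$ be a flow of curves in the upper light cone satisfying $$\mathbf{u}_t=\begin{pmatrix}A^{-1}-\hat u\,\xi^T&\hat u\\ -u_3\,\xi^T&u_3\end{pmatrix}\begin{pmatrix}r_1\\ r_2\\ r_3\end{pmatrix},\qquad(\ast)$$ with $r_1,r_2,r_3$ functions of the differential invariants of the curve and their $x$-derivatives. Assume $r_3=-r_1'$, so that the evolution preserves arc-length, and assume that the initial condition satisfies $\|u'\|_J=1$. Let $m=\Pi(u)=\hat u/u_3$ be the projectivization of $u$. Then $m$ satisfies $$m_t=\begin{pmatrix}m_1'&-m_2'\\ m_2'&m_1'\end{pmatrix}\begin{pmatrix}s_1\\ s_2\end{pmatrix}\qquad(\ast\ast)$$ with $s_i=r_i$, $i=1,2$. Conversely, a flow $m(t,x)$ in the sphere (with $m'\ne0$) satisfying $(\ast\ast)$ lifts uniquely to a flow $u(t,x)$ in the upper light cone, with $\Pi(u)=m$, parametrized by arc-length ($\|u'\|_J=1$), and this lifting takes the $m$ evolution $(\ast\ast)$ to the evolution $(\ast)$ with $r_1=s_1$, $r_2=s_2$, $r_3=-s_1'$.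
   Context: Set $$J=\begin{pmatrix}0&0&0&-1\\ 0&1&0&0\\ 0&0&1&0\\ -1&0&0&0\end{pmatrix},$$ $\langle u,v\rangle_J=u^TJv$, $\|u\|_J^2=\langle u,u\rangle_J$ on $\mathbb{R}^4$ with coordinates $(u_0,u_1,u_2,u_3)$; the light cone is $C_L=\{u:\langle u,u\rangle_J=0\}$. On the upper cone with $u_3>0$ one has $u_0=\|\hat u\|^2/(2u_3)$, $\hat u=(u_1,u_2)^T$, and $\mathbf u=(u_1,u_2,u_3)^T$ are local coordinates. Prime denotes $d/dx$. A curve is parametrized by (Lorentzian) arc-length if $\|u'\|_J=1$. The 2-Möbius sphere $M$ is the projectivization of the cone, with local coordinates $m=(m_1,m_2)^T\in\mathbb{R}^2$ and projectivization $\Pi(u_0,u_1,u_2,u_3)=(u_1/u_3,u_2/u_3)^T$. For a curve in the upper cone with $u_3>0$, $\|u'\|_J\ne0$, $$A=\frac{1}{u_3\|u'\|_J}\begin{pmatrix}u_3u_1'-u_1u_3'&u_3u_2'-u_2u_3'\\ u_2u_3'-u_3u_2'&u_3u_1'-u_1u_3'\end{pmatrix},\quad \xi_1=-\frac{u_3'}{u_3\|u'\|_J},\quad \xi_2=-\frac{1}{u_3\|u'\|_J^3}\det\begin{pmatrix}u_1&u_2&u_3\\ u_1'&u_2'&u_3'\\ u_1''&u_2''&u_3''\end{pmatrix},$$ and $\xi=(\xi_1,\xi_2)^T$. Differential invariants in the cone are functions of $u$ and its derivatives invariant under the linear action of $O(3,1)=\{\Theta:\Theta^TJ\Theta=J\}$;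 on the sphere, $O(3,1)$ acts by conformal transformations $\Theta\cdot m=\Pi(\Theta\Lambda(m))$, $\Lambda(m)=(\frac12\|m\|^2,m_1,m_2,1)^T$, and $s_1,s_2$ are functions of the differential invariants of $m$ under this action and their $x$-derivatives. The equalities $s_i=r_i$ are equalities of functions of $(t,x)$ along the flows. *)

theory Defs
  imports "HOL-Analysis.Analysis"
begin

text \<open>Coordinates on \<open>real^4\<close> are \<open>u $ 0, u $ 1, u $ 2, u $ 3\<close>: the elements of the index type \<open>4\<close>
  are the residues 0, 1, 2, 3. (The library function \<open>vector\<close> fills the indices 1, 2, 3, 4 = 0 and is therefore used in dimensions 2 and 3 only.)\<close>

definition J :: "real^4^4" where
  "J = (\<chi> i j. if (i = 0 \<and> j = 3) \<or> (i = 3 \<and> j = 0) then - 1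
               else if (i = 1 \<and> j = 1) \<or> (i = 2 \<and> j = 2) then 1 else 0)"

definition innerJ :: "real^4 \<Rightarrow> real^4 \<Rightarrow> real" where
  "innerJ u v = u \<bullet> (J *v v)"

text \<open>Tangent vectors of the cone satisfy \<open>innerJ v v \<ge> 0\<close>, so the square root is genuine there.\<close>

definition normJ :: "real^4 \<Rightarrow> real" where
  "normJ v = sqrt (innerJ v v)"

definition O31 :: "(real^4^4) set" where
  "O31 = {\<Theta>. transpose \<Theta> ** J ** \<Theta> = J}"

definition light_cone :: "(real^4) set" where
  "light_cone = {v. innerJ v v = 0}"

definition upper_cone :: "(real^4) set" where
  "upper_cone = {v \<in> light_cone. v $ 3 > 0}"

definition hat :: "real^4 \<Rightarrow> real^2" where
  "hat v = vector [v $ 1, v $ 2]"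

definition local_coords :: "real^4 \<Rightarrow> real^3" where
  "local_coords v = vector [v $ 1, v $ 2, v $ 3]"

definition Proj :: "real^4 \<Rightarrow> real^2" where
  "Proj v = vector [v $ 1 / v $ 3, v $ 2 / v $ 3]"

definition Lift0 :: "real^2 \<Rightarrow> real^4" where
  "Lift0 m = (\<chi> i. if i = 0 then (norm m)\<^sup>2 / 2 else if i = 1 then m $ 1
                   else if i = 2 then m $ 2 else 1)"

text \<open>In the chart \<open>real^2\<close> the conformal action is only partially defined: \<open>sphere_act \<Theta> m\<close> is
  meaningful when \<open>(\<Theta> *v Lift0 m) $ 3 \<noteq> 0\<close>.\<close>

definition sphere_act :: "real^4^4 \<Rightarrow> real^2 \<Rightarrow> real^2" where
  "sphere_act \<Theta> m = Proj (\<Theta> *v Lift0 m)"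

text \<open>\<open>Ck_on k d D f\<close>: \<open>f\<close> is of class \<open>C^k\<close> on \<open>D\<close> as a function of the \<open>d\<close> real variables
  \<open>y 0, \<dots>, y (d - 1)\<close> (continuous partial derivatives up to order \<open>k\<close>). Partial derivatives are taken
  within \<open>D\<close>, hence one-sided at an endpoint of a time interval.\<close>

primrec Ck_on :: "nat \<Rightarrow> nat \<Rightarrow> (nat \<Rightarrow> real) set \<Rightarrow> ((nat \<Rightarrow> real) \<Rightarrow> 'a::real_normed_vector) \<Rightarrow> bool"
  where
    "Ck_on 0 d D f \<longleftrightarrow> continuous_on D f"
  | "Ck_on (Suc k) d D f \<longleftrightarrow> continuous_on D f \<and>
       (\<exists>g. \<forall>i<d. (\<forall>y\<in>D. ((\<lambda>h. f (y(i := h))) has_vector_derivative g i y)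
                             (at (y i) within {h. y(i := h) \<in> D}))
                 \<and> Ck_on k d D (g i))"

definition smooth_vars :: "nat \<Rightarrow> (nat \<Rightarrow> real) set \<Rightarrow> ((nat \<Rightarrow> real) \<Rightarrow> 'a::real_normed_vector) \<Rightarrow> bool"
  where "smooth_vars d D f \<longleftrightarrow> (\<forall>k. Ck_on k d D f)"

definition smooth_flow :: "real set \<Rightarrow> real set \<Rightarrow> (real \<Rightarrow> real \<Rightarrow> 'a::real_normed_vector) \<Rightarrow> bool" where
  "smooth_flow T X c \<longleftrightarrow> smooth_vars 2 {y. y 0 \<in> T \<and> y 1 \<in> X} (\<lambda>y. c (y 0) (y 1))"

definition xderiv :: "(real \<Rightarrow> 'a::real_normed_vector) \<Rightarrow> real \<Rightarrow> 'a" where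
  "xderiv c x = vector_derivative c (at x)"

definition smooth_curve :: "real set \<Rightarrow> (real \<Rightarrow> 'a::real_normed_vector) \<Rightarrow> bool" where
  "smooth_curve X c \<longleftrightarrow> (\<forall>k. \<forall>x\<in>X. (xderiv ^^ k) c differentiable (at x))"

definition jet :: "nat \<Rightarrow> (real \<Rightarrow> 'a::real_normed_vector) \<Rightarrow> real \<Rightarrow> 'a list" where
  "jet n c x = map (\<lambda>k. (xderiv ^^ k) c x) [0..<Suc n]"

text \<open>A function \<open>F\<close> of \<open>u, u', \<dots>, u^(n)\<close> that is invariant on (germs of) regular curves of the cone,
  parametrized arbitrarily.\<close>

definition cone_invariant :: "nat \<Rightarrow> ((real^4) list \<Rightarrow> real) \<Rightarrow> bool" where
  "cone_invariant n F \<longleftrightarrow>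
     (\<forall>\<Theta>\<in>O31. \<forall>Y c. open Y \<and> smooth_curve Y c \<and>
        (\<forall>x\<in>Y. c x \<in> light_cone \<and> normJ (xderiv c x) \<noteq> 0) \<longrightarrow>
        (\<forall>x\<in>Y. F (jet n (\<lambda>y. \<Theta> *v c y) x) = F (jet n c x)))"

definition sphere_invariant :: "nat \<Rightarrow> ((real^2) list \<Rightarrow> real) \<Rightarrow> bool" where
  "sphere_invariant n F \<longleftrightarrow>
     (\<forall>\<Theta>\<in>O31. \<forall>Y c. open Y \<and> smooth_curve Y c \<and>
        (\<forall>x\<in>Y. xderiv c x \<noteq> 0 \<and> (\<Theta> *v Lift0 (c x)) $ 3 \<noteq> 0) \<longrightarrow>
        (\<forall>x\<in>Y. F (jet n (\<lambda>y. sphere_act \<Theta> (c y)) x) = F (jet n c x)))"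

text \<open>\<open>r\<close> is, along the flow \<open>c\<close>, a smooth function \<open>f\<close> of finitely many quantities, the \<open>i\<close>-th one
  being the \<open>p i\<close>-th \<open>x\<close>-derivative of a differential invariant \<open>I i\<close> of order \<open>n i\<close>. The function \<open>f\<close>
  and the invariants do not depend on \<open>t\<close> and \<open>x\<close>. Unused slots of the argument of \<open>f\<close> are 0.\<close>

definition function_of_invariants ::
  "(nat \<Rightarrow> ('a list \<Rightarrow> real) \<Rightarrow> bool) \<Rightarrow> real set \<Rightarrow> real set \<Rightarrow>
   (real \<Rightarrow> real \<Rightarrow> 'a::real_normed_vector) \<Rightarrow> (real \<Rightarrow> real \<Rightarrow> real) \<Rightarrow> bool" where
  "function_of_invariants Inv T X c r \<longleftrightarrow>
     (\<exists>d n p I D f.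
        (\<forall>i<d. Inv (n i) (I i) \<and> (\<forall>t\<in>T. smooth_curve X (\<lambda>x. I i (jet (n i) (c t) x)))) \<and>
        open D \<and> smooth_vars d D f \<and>
        (\<forall>t\<in>T. \<forall>x\<in>X.
           let y = (\<lambda>i. if i < d then (xderiv ^^ p i) (\<lambda>z. I i (jet (n i) (c t) z)) x else 0)
           in y \<in> D \<and> r t x = f y))"

definition A_mat :: "(real \<Rightarrow> real^4) \<Rightarrow> real \<Rightarrow> real^2^2" where
  "A_mat c x = (let u = c x; v = xderiv c x;
                    a = u $ 3 * v $ 1 - u $ 1 * v $ 3; b = u $ 3 * v $ 2 - u $ 2 * v $ 3
                in (1 / (u $ 3 * normJ v)) *\<^sub>R vector [vector [a, b], vector [- b, a]])"

definition xi :: "(real \<Rightarrow> real^4) \<Rightarrow> real \<Rightarrow> real^2" where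
  "xi c x = (let u = c x; v = xderiv c x; w = xderiv (xderiv c) x
             in vector [- (v $ 3 / (u $ 3 * normJ v)),
                        - (1 / (u $ 3 * normJ v ^ 3)) *
                          det (vector [local_coords u, local_coords v, local_coords w] :: real^3^3)])"

text \<open>The 3 by 3 matrix with blocks \<open>A^(-1) - hat u \<xi>^T\<close>, \<open>hat u\<close>, \<open>- u_3 \<xi>^T\<close>, \<open>u_3\<close>.\<close>

definition cone_mat :: "(real \<Rightarrow> real^4) \<Rightarrow> real \<Rightarrow> real^3^3" where
  "cone_mat c x =
     (let B = matrix_inv (A_mat c x) - (\<chi> i j. hat (c x) $ i * xi c x $ j); u3 = c x $ 3
      in vector [vector [B $ 1 $ 1, B $ 1 $ 2, hat (c x) $ 1],
                 vector [B $ 2 $ 1, B $ 2 $ 2, hat (c x) $ 2],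
                 vector [- u3 * xi c x $ 1, - u3 * xi c x $ 2, u3]])"

definition sphere_mat :: "(real \<Rightarrow> real^2) \<Rightarrow> real \<Rightarrow> real^2^2" where
  "sphere_mat c x = (let v = xderiv c x in vector [vector [v $ 1, - v $ 2], vector [v $ 2, v $ 1]])"

definition cone_evolution ::
  "real set \<Rightarrow> real set \<Rightarrow> (real \<Rightarrow> real \<Rightarrow> real^4) \<Rightarrow>
   (real \<Rightarrow> real \<Rightarrow> real) \<Rightarrow> (real \<Rightarrow> real \<Rightarrow> real) \<Rightarrow> (real \<Rightarrow> real \<Rightarrow> real) \<Rightarrow> bool" where
  "cone_evolution T X u r1 r2 r3 \<longleftrightarrow>
     function_of_invariants cone_invariant T X u r1 \<and>
     function_of_invariants cone_invariant T X u r2 \<and>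
     function_of_invariants cone_invariant T X u r3 \<and>
     (\<forall>t\<in>T. \<forall>x\<in>X. ((\<lambda>\<tau>. local_coords (u \<tau> x)) has_vector_derivative
                       cone_mat (u t) x *v vector [r1 t x, r2 t x, r3 t x]) (at t within T))"

definition sphere_evolution ::
  "real set \<Rightarrow> real set \<Rightarrow> (real \<Rightarrow> real \<Rightarrow> real^2) \<Rightarrow>
   (real \<Rightarrow> real \<Rightarrow> real) \<Rightarrow> (real \<Rightarrow> real \<Rightarrow> real) \<Rightarrow> bool" where
  "sphere_evolution T X m s1 s2 \<longleftrightarrow>
     function_of_invariants sphere_invariant T X m s1 \<and>
     function_of_invariants sphere_invariant T X m s2 \<and>
     (\<forall>t\<in>T. \<forall>x\<in>X. ((\<lambda>\<tau>. m \<tau> x) has_vector_derivative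
                       sphere_mat (m t) x *v vector [s1 t x, s2 t x]) (at t within T))"

definition cone_flow :: "real set \<Rightarrow> real set \<Rightarrow> (real \<Rightarrow> real \<Rightarrow> real^4) \<Rightarrow> bool" where
  "cone_flow T X u \<longleftrightarrow> smooth_flow T X u \<and>
     (\<forall>t\<in>T. \<forall>x\<in>X. u t x \<in> upper_cone \<and> normJ (xderiv (u t) x) \<noteq> 0)"

definition sphere_flow :: "real set \<Rightarrow> real set \<Rightarrow> (real \<Rightarrow> real \<Rightarrow> real^2) \<Rightarrow> bool" where
  "sphere_flow T X m \<longleftrightarrow> smooth_flow T X m \<and> (\<forall>t\<in>T. \<forall>x\<in>X. xderiv (m t) x \<noteq> 0)"

definition arclength_lift ::
  "real set \<Rightarrow> real set \<Rightarrow> (real \<Rightarrow> real \<Rightarrow> real^2) \<Rightarrow> (real \<Rightarrow> real \<Rightarrow> real^4) \<Rightarrow> bool" where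
  "arclength_lift T X m u \<longleftrightarrow> cone_flow T X u \<and>
     (\<forall>t\<in>T. \<forall>x\<in>X. Proj (u t x) = m t x \<and> normJ (xderiv (u t) x) = 1)"

end

theory Submission
  imports Defs
begin

text \<open>A curve in the upper cone is \<open>u = p \<cdot> Lift0 m\<close> with \<open>m\<close> its projection and \<open>p = u\<^sub>3 > 0\<close>. Since
  \<open>Lift0 m\<close> is null, the Lorentzian speed is \<open>e = p |m'|\<close>. So a regular curve in the sphere has exactly one
  lift of unit speed, \<open>|m'|\<^sup>-\<^sup>1 Lift0 m\<close>, which gives existence and uniqueness of the lift.

  In the coordinates \<open>(m, p)\<close> the matrix in the cone evolution splits (\<open>cone_mat_projected\<close>). Identify
  the plane with the complex numbers; then the evolution says \<open>m\<^sub>t = m' (r\<^sub>1 + i r\<^sub>2) / e\<close>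
  together with an equation for \<open>p\<^sub>t\<close>. For \<open>e = 1\<close> the first equation is the sphere
  evolution with \<open>s\<^sub>i = r\<^sub>i\<close>. Differentiating \<open>e\<^sup>2 = p\<^sup>2 |m'|\<^sup>2\<close> in \<open>t\<close>
  and exchanging the two partial derivatives of \<open>m\<close> yields one identity between \<open>e\<^sub>t\<close> and
  \<open>p\<^sub>t\<close> (\<open>speed_evolution\<close>), in which the curvature terms with \<open>r\<^sub>2\<close> cancel. It is used twice. If
  \<open>p\<^sub>t\<close> has the prescribed value and \<open>r\<^sub>3 = - r\<^sub>1'\<close>, it reads \<open>e\<^sub>t = r\<^sub>1' (1 - e)\<close>, a linear
  equation for \<open>e - 1\<close> in \<open>t\<close>, whence unit speed is preserved. If \<open>u\<close> is the unit speed lift of a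
  solution of the sphere evolution, then \<open>e\<^sub>t = 0\<close>, and the identity says that \<open>p\<^sub>t\<close> has the
  prescribed value.

  It remains to see that functions of differential invariants correspond to each other. An invariant of curves in the
  cone becomes one of curves in the sphere by evaluating it on the unit speed lift
  (\<open>cone_invariant_to_sphere\<close>), an invariant of curves in the sphere becomes one in the cone by evaluating
  it on the projection (\<open>sphere_invariant_to_cone\<close>), and \<open>- s\<^sub>1'\<close> is a function of invariants
  by the chain rule (\<open>function_of_invariants_uminus_xderiv\<close>).\<close>

section \<open>Smooth curves and their jets\<close>

lemma xderiv_has_derivative:
  "f differentiable (at x) \<Longrightarrow> (f has_vector_derivative xderiv f x) (at x)"
  by (simp add: xderiv_def vector_derivative_works[symmetric])

lemma xderivI: "(f has_vector_derivative d) (at x) \<Longrightarrow> xderiv f x = d"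
  by (simp add: xderiv_def vector_derivative_at)

lemma has_derivative_cong_open:
  assumes "open Y" "x \<in> Y" "\<And>y. y \<in> Y \<Longrightarrow> f y = g y"
  shows "(f has_vector_derivative d) (at x) \<longleftrightarrow> (g has_vector_derivative d) (at x)"
proof
  show "(g has_vector_derivative d) (at x)" if "(f has_vector_derivative d) (at x)"
    by (rule has_vector_derivative_transform_within_open[OF that assms])
  show "(f has_vector_derivative d) (at x)" if "(g has_vector_derivative d) (at x)"
    by (rule has_vector_derivative_transform_within_open[OF that assms(1,2)]) (simp add: assms(3))
qed

lemma xderiv_cong:
  assumes "open Y" "x \<in> Y" "\<And>y. y \<in> Y \<Longrightarrow> f y = g y"
  shows "xderiv f x = xderiv g x"
  unfolding xderiv_def vector_derivative_def
  by (rule arg_cong[where f = Eps]) (rule ext, rule has_derivative_cong_open[OF assms])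

lemma differentiable_cong:
  fixes f :: "real \<Rightarrow> 'a::real_normed_vector"
  assumes "open Y" "x \<in> Y" "\<And>y. y \<in> Y \<Longrightarrow> f y = g y"
  shows "f differentiable (at x) \<longleftrightarrow> g differentiable (at x)"
proof -
  have "f differentiable (at x) \<longleftrightarrow> (f has_vector_derivative xderiv g x) (at x)"
    using xderiv_cong[OF assms] by (simp add: vector_derivative_works xderiv_def)
  then show ?thesis
    by (simp add: vector_derivative_works xderiv_def has_derivative_cong_open[OF assms])
qed

lemma xderiv_iter_cong:
  assumes "open Y" "x \<in> Y" "\<And>y. y \<in> Y \<Longrightarrow> f y = g y"
  shows "(xderiv ^^ k) f x = (xderiv ^^ k) g x"
  using assms(2)
proof (induction k arbitrary: x)
  case 0
  show ?case unfolding funpow_0 by (rule assms(3)[OF 0])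
next
  case (Suc k)
  show ?case unfolding funpow.simps o_apply by (rule xderiv_cong[OF assms(1) Suc.prems Suc.IH])
qed

lemma jet_cong:
  assumes "open Y" "x \<in> Y" "\<And>y. y \<in> Y \<Longrightarrow> f y = g y"
  shows "jet n f x = jet n g x"
  unfolding jet_def by (rule map_cong[OF refl]) (rule xderiv_iter_cong[OF assms])

lemma smooth_curve_cong:
  assumes "open Y" "\<And>y. y \<in> Y \<Longrightarrow> f y = g y"
  shows "smooth_curve Y f \<longleftrightarrow> smooth_curve Y g"
  unfolding smooth_curve_def
  by (intro all_cong1 ball_cong refl differentiable_cong[OF assms(1)])
    (simp_all add: xderiv_iter_cong[OF assms(1) _ assms(2)])

lemma smooth_curve_subset: "smooth_curve Y f \<Longrightarrow> Z \<subseteq> Y \<Longrightarrow> smooth_curve Z f"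
  by (auto simp: smooth_curve_def)

lemma xderiv_iter_Suc: "(xderiv ^^ Suc k) f = (xderiv ^^ k) (xderiv f)"
  by (simp only: funpow_Suc_right o_apply)

lemma jet_0: "jet 0 f x = [f x]"
  by (simp add: jet_def)

lemma jet_Suc: "jet (Suc n) f x = f x # jet n (xderiv f) x"
  unfolding jet_def map_upt_Suc xderiv_iter_Suc by simp

lemma jet_eq_iff:
  "jet n f x = jet n g y \<longleftrightarrow> (\<forall>k\<le>n. (xderiv ^^ k) f x = (xderiv ^^ k) g y)"
  unfolding jet_def by (auto simp del: upt_Suc simp: less_Suc_eq_le)

lemma jet_eq_mono: "jet n f x = jet n g y \<Longrightarrow> k \<le> n \<Longrightarrow> jet k f x = jet k g y"
  by (auto simp: jet_eq_iff)

lemma jet_eq_0: "jet n f x = jet n g y \<Longrightarrow> f x = g y"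
  by (cases n) (auto simp: jet_0 jet_Suc)

text \<open>Smoothness is split into finite orders of differentiability because passing to the derivative lowers
  the order by one, so that product and chain rules can be iterated by induction.\<close>

definition diff_order :: "nat \<Rightarrow> real set \<Rightarrow> (real \<Rightarrow> 'a::real_normed_vector) \<Rightarrow> bool" where
  "diff_order n Y f \<longleftrightarrow> (\<forall>k<n. \<forall>x\<in>Y. (xderiv ^^ k) f differentiable (at x))"

lemma smooth_curve_iff_diff_order: "smooth_curve Y f \<longleftrightarrow> (\<forall>n. diff_order n Y f)"
  by (auto simp: smooth_curve_def diff_order_def)

lemma diff_order_0 [simp]: "diff_order 0 Y f"
  by (simp add: diff_order_def)

lemma diff_order_Suc:
  "diff_order (Suc n) Y f \<longleftrightarrow> (\<forall>x\<in>Y. f differentiable (at x)) \<and> diff_order n Y (xderiv f)"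
  unfolding diff_order_def All_less_Suc2 xderiv_iter_Suc by simp

lemma diff_order_SucD: "diff_order (Suc n) Y f \<Longrightarrow> diff_order n Y f"
  by (auto simp: diff_order_def)

lemma smooth_curve_differentiable: "smooth_curve Y f \<Longrightarrow> x \<in> Y \<Longrightarrow> f differentiable (at x)"
  unfolding smooth_curve_def by (metis funpow_0)

lemma smooth_curve_has_derivative:
  "smooth_curve Y f \<Longrightarrow> x \<in> Y \<Longrightarrow> (f has_vector_derivative xderiv f x) (at x)"
  by (simp add: smooth_curve_differentiable xderiv_has_derivative)

lemma smooth_curve_xderiv: "smooth_curve Y f \<Longrightarrow> smooth_curve Y (xderiv f)"
  unfolding smooth_curve_iff_diff_order using diff_order_Suc by blast

lemma smooth_curve_continuous: "smooth_curve Y f \<Longrightarrow> continuous_on Y f"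
  by (meson continuous_at_imp_continuous_on differentiable_imp_continuous_within
      smooth_curve_differentiable)

lemma diff_order_cong:
  assumes "open Y" "\<And>y. y \<in> Y \<Longrightarrow> f y = g y"
  shows "diff_order n Y f \<longleftrightarrow> diff_order n Y g"
  unfolding diff_order_def
  by (intro all_cong1 imp_cong ball_cong refl differentiable_cong[OF assms(1)])
    (simp_all add: xderiv_iter_cong[OF assms(1) _ assms(2)])

lemma diff_order_SucI:
  assumes "open Y" "\<And>x. x \<in> Y \<Longrightarrow> (f has_vector_derivative f' x) (at x)" "diff_order n Y f'"
  shows "diff_order (Suc n) Y f"
  unfolding diff_order_Suc
proof
  show "\<forall>x\<in>Y. f differentiable at x"
    using assms(2) differentiableI_vector by blast
  show "diff_order n Y (xderiv f)"
    using diff_order_cong[OF assms(1), of "xderiv f" f'] assms(2,3) xderivI by blast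
qed

text \<open>The counterpart for jets: a formula for the derivative reduces the order of a jet by one.\<close>

lemma jet_Suc_eqI:
  assumes "open Y" "x \<in> Y" "\<And>y. y \<in> Y \<Longrightarrow> (f has_vector_derivative f' y) (at y)"
    and "open Z" "z \<in> Z" "\<And>y. y \<in> Z \<Longrightarrow> (g has_vector_derivative g' y) (at y)"
    and "f x = g z" "jet n f' x = jet n g' z"
  shows "jet (Suc n) f x = jet (Suc n) g z"
proof -
  have "jet n (xderiv f) x = jet n f' x"
    by (rule jet_cong[OF assms(1,2)]) (simp add: xderivI assms(3))
  moreover have "jet n (xderiv g) z = jet n g' z"
    by (rule jet_cong[OF assms(4,5)]) (simp add: xderivI assms(6))
  ultimately show ?thesis using assms by (simp add: jet_Suc)
qed

lemma xderiv_iter_linear: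
  assumes "bounded_linear L" "open Y" "smooth_curve Y f" "x \<in> Y"
  shows "(xderiv ^^ k) (\<lambda>y. L (f y)) x = L ((xderiv ^^ k) f x)"
  using assms(4)
proof (induction k arbitrary: x)
  case 0
  then show ?case by simp
next
  case (Suc k)
  have "((xderiv ^^ k) f has_vector_derivative (xderiv ^^ Suc k) f x) (at x)"
    using assms(3) Suc.prems by (simp add: smooth_curve_def xderiv_has_derivative)
  then have "((\<lambda>y. L ((xderiv ^^ k) f y)) has_vector_derivative L ((xderiv ^^ Suc k) f x)) (at x)"
    by (rule bounded_linear.has_vector_derivative[OF assms(1)])
  then have "xderiv (\<lambda>y. L ((xderiv ^^ k) f y)) x = L ((xderiv ^^ Suc k) f x)"
    by (rule xderivI)
  moreover have "xderiv ((xderiv ^^ k) (\<lambda>y. L (f y))) x = xderiv (\<lambda>y. L ((xderiv ^^ k) f y)) x"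
    by (rule xderiv_cong[OF assms(2) Suc.prems Suc.IH])
  ultimately show ?case by simp
qed

lemma smooth_curve_linear:
  assumes "bounded_linear L" "open Y" "smooth_curve Y f"
  shows "smooth_curve Y (\<lambda>y. L (f y))"
  unfolding smooth_curve_def
proof (intro allI ballI)
  fix k x assume x: "x \<in> Y"
  have "((xderiv ^^ k) f has_vector_derivative (xderiv ^^ Suc k) f x) (at x)"
    using assms(3) x by (simp add: smooth_curve_def xderiv_has_derivative)
  then have "((\<lambda>y. L ((xderiv ^^ k) f y)) has_vector_derivative L ((xderiv ^^ Suc k) f x)) (at x)"
    by (rule bounded_linear.has_vector_derivative[OF assms(1)])
  then have "(\<lambda>y. L ((xderiv ^^ k) f y)) differentiable (at x)"
    using differentiableI_vector by blast
  then show "(xderiv ^^ k) (\<lambda>y. L (f y)) differentiable (at x)"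
    using differentiable_cong[OF assms(2) x, of "(xderiv ^^ k) (\<lambda>y. L (f y))"
        "\<lambda>y. L ((xderiv ^^ k) f y)"] xderiv_iter_linear[OF assms] by blast
qed

lemma xderiv_nth:
  fixes f :: "real \<Rightarrow> real^'n"
  assumes "smooth_curve Y f" "x \<in> Y"
  shows "xderiv (\<lambda>y. f y $ i) x = xderiv f x $ i"
  by (rule xderivI)
     (rule bounded_linear.has_vector_derivative[OF bounded_linear_vec_nth
        smooth_curve_has_derivative[OF assms]])

lemma smooth_curve_nth:
  fixes f :: "real \<Rightarrow> real^'n"
  shows "open Y \<Longrightarrow> smooth_curve Y f \<Longrightarrow> smooth_curve Y (\<lambda>y. f y $ i)"
  by (rule smooth_curve_linear[OF bounded_linear_vec_nth])

lemma jet_linear: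
  assumes "bounded_linear L" "open Y" "smooth_curve Y f" "x \<in> Y" "open Z" "smooth_curve Z g" "z \<in> Z"
    and "jet n f x = jet n g z"
  shows "jet n (\<lambda>y. L (f y)) x = jet n (\<lambda>y. L (g y)) z"
  using assms(8) unfolding jet_eq_iff xderiv_iter_linear[OF assms(1,2,3,4)]
    xderiv_iter_linear[OF assms(1,5,6,7)] by simp

lemmas jet_nth = jet_linear[OF bounded_linear_vec_nth]

lemma jet_vecI:
  fixes f g :: "real \<Rightarrow> real^'n"
  assumes "open Y" "smooth_curve Y f" "x \<in> Y" "open Z" "smooth_curve Z g" "z \<in> Z"
    and "\<And>i. jet n (\<lambda>y. f y $ i) x = jet n (\<lambda>y. g y $ i) z"
  shows "jet n f x = jet n g z"
  using assms(7) xderiv_iter_linear[OF bounded_linear_vec_nth assms(1,2,3)]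
    xderiv_iter_linear[OF bounded_linear_vec_nth assms(4,5,6)]
  by (simp add: jet_eq_iff vec_eq_iff)

lemma smooth_curve_const: "smooth_curve Y (\<lambda>y. c)"
proof -
  have "diff_order n Y (\<lambda>y. c)" for n and c :: 'a
  proof (induction n arbitrary: c)
    case (Suc n)
    have "xderiv (\<lambda>y. c) = (\<lambda>y::real. 0)"
      by (rule ext, rule xderivI) simp
    then show ?case using Suc by (simp add: diff_order_Suc)
  qed simp
  then show ?thesis by (simp add: smooth_curve_iff_diff_order)
qed

lemma jet_const: "jet n (\<lambda>y. c) x = jet n (\<lambda>y. c) z"
proof (induction n arbitrary: c)
  case (Suc n)
  have "xderiv (\<lambda>y. c) = (\<lambda>y::real. 0)"
    by (rule ext, rule xderivI) simp
  then show ?case using Suc by (simp add: jet_Suc)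
qed (simp add: jet_0)

lemma diff_order_add:
  "open Y \<Longrightarrow> diff_order n Y f \<Longrightarrow> diff_order n Y g \<Longrightarrow> diff_order n Y (\<lambda>y. f y + g y)"
proof (induction n arbitrary: f g)
  case (Suc n)
  show ?case
  proof (rule diff_order_SucI[OF Suc.prems(1)])
    show "diff_order n Y (\<lambda>y. xderiv f y + xderiv g y)"
      using Suc by (simp add: diff_order_Suc)
    show "((\<lambda>y. f y + g y) has_vector_derivative xderiv f x + xderiv g x) (at x)" if "x \<in> Y" for x
      using that Suc.prems(2,3) diff_order_Suc
      by (intro has_vector_derivative_add xderiv_has_derivative) blast+
  qed
qed simp

lemma smooth_curve_add:
  "open Y \<Longrightarrow> smooth_curve Y f \<Longrightarrow> smooth_curve Y g \<Longrightarrow> smooth_curve Y (\<lambda>y. f y + g y)"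
  by (simp add: smooth_curve_iff_diff_order diff_order_add)

lemma jet_add:
  assumes "open Y" "x \<in> Y" "open Z" "z \<in> Z"
  shows "smooth_curve Y f1 \<Longrightarrow> smooth_curve Y g1 \<Longrightarrow> smooth_curve Z f2 \<Longrightarrow> smooth_curve Z g2 \<Longrightarrow>
    jet n f1 x = jet n f2 z \<Longrightarrow> jet n g1 x = jet n g2 z \<Longrightarrow>
    jet n (\<lambda>y. f1 y + g1 y) x = jet n (\<lambda>y. f2 y + g2 y) z"
proof (induction n arbitrary: f1 g1 f2 g2)
  case (Suc n)
  show ?case
  proof (rule jet_Suc_eqI[OF assms(1,2) _ assms(3,4)])
    show "jet n (\<lambda>y. xderiv f1 y + xderiv g1 y) x = jet n (\<lambda>y. xderiv f2 y + xderiv g2 y) z"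
      using Suc by (simp add: jet_Suc smooth_curve_xderiv)
    show "f1 x + g1 x = f2 z + g2 z" using Suc.prems by (simp add: jet_Suc)
  qed (auto intro!: has_vector_derivative_add smooth_curve_has_derivative Suc.prems)
qed (simp add: jet_0)

lemma has_vector_derivative_times:
  fixes f g :: "real \<Rightarrow> real"
  assumes "(f has_vector_derivative f') (at x within S)" "(g has_vector_derivative g') (at x within S)"
  shows "((\<lambda>y. f y * g y) has_vector_derivative f' * g x + f x * g') (at x within S)"
  using has_vector_derivative_mult[OF assms] by (simp add: algebra_simps)

lemma has_vector_derivative_powr:
  fixes f :: "real \<Rightarrow> real"
  assumes "(f has_vector_derivative f') (at x within S)" "f x > 0"
  shows "((\<lambda>y. f y powr a) has_vector_derivative f' * (a * f x powr (a - 1))) (at x within S)"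
proof -
  have "((\<lambda>y. f y powr a) has_real_derivative a * f x powr (a - 1) * f') (at x within S)"
    using DERIV_chain2[of "\<lambda>z. z powr a" _ f x, OF has_real_derivative_powr[OF assms(2)]] assms(1)
    by (simp add: has_real_derivative_iff_has_vector_derivative)
  then show ?thesis
    by (simp add: has_real_derivative_iff_has_vector_derivative mult_ac)
qed

lemma diff_order_mult:
  fixes f g :: "real \<Rightarrow> real"
  shows "open Y \<Longrightarrow> diff_order n Y f \<Longrightarrow> diff_order n Y g \<Longrightarrow> diff_order n Y (\<lambda>y. f y * g y)"
proof (induction n arbitrary: f g)
  case (Suc n)
  note sd = Suc.prems(2,3)[THEN diff_order_SucD]
  show ?case
  proof (rule diff_order_SucI[OF Suc.prems(1)])
    show "diff_order n Y (\<lambda>y. xderiv f y * g y + f y * xderiv g y)"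
      using Suc sd by (intro diff_order_add) (simp_all add: diff_order_Suc)
    show "((\<lambda>y. f y * g y) has_vector_derivative xderiv f x * g x + f x * xderiv g x) (at x)"
      if "x \<in> Y" for x
      using that Suc.prems(2,3) diff_order_Suc
      by (intro has_vector_derivative_times xderiv_has_derivative) blast+
  qed
qed simp

lemma smooth_curve_mult:
  fixes f g :: "real \<Rightarrow> real"
  shows "open Y \<Longrightarrow> smooth_curve Y f \<Longrightarrow> smooth_curve Y g \<Longrightarrow> smooth_curve Y (\<lambda>y. f y * g y)"
  by (simp add: smooth_curve_iff_diff_order diff_order_mult)

lemma jet_mult:
  fixes f1 :: "real \<Rightarrow> real"
  assumes "open Y" "x \<in> Y" "open Z" "z \<in> Z"
  shows "smooth_curve Y f1 \<Longrightarrow> smooth_curve Y g1 \<Longrightarrow> smooth_curve Z f2 \<Longrightarrow> smooth_curve Z g2 \<Longrightarrow>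
    jet n f1 x = jet n f2 z \<Longrightarrow> jet n g1 x = jet n g2 z \<Longrightarrow>
    jet n (\<lambda>y. f1 y * g1 y) x = jet n (\<lambda>y. f2 y * g2 y) z"
proof (induction n arbitrary: f1 g1 f2 g2)
  case (Suc n)
  have eqs: "jet n f1 x = jet n f2 z" "jet n g1 x = jet n g2 z"
    using Suc.prems(5,6) by (meson jet_eq_mono le_SucI order_refl)+
  have eqs': "jet n (xderiv f1) x = jet n (xderiv f2) z" "jet n (xderiv g1) x = jet n (xderiv g2) z"
    using Suc.prems by (simp_all add: jet_Suc)
  note sm = Suc.prems(1-4) Suc.prems(1-4)[THEN smooth_curve_xderiv]
  show ?case
  proof (rule jet_Suc_eqI[OF assms(1,2) _ assms(3,4)])
    show "jet n (\<lambda>y. xderiv f1 y * g1 y + f1 y * xderiv g1 y) x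
        = jet n (\<lambda>y. xderiv f2 y * g2 y + f2 y * xderiv g2 y) z"
      by (intro jet_add[OF assms] smooth_curve_mult Suc.IH eqs eqs' sm assms)
    show "f1 x * g1 x = f2 z * g2 z" using Suc.prems by (simp add: jet_Suc)
  qed (auto intro!: has_vector_derivative_times smooth_curve_has_derivative Suc.prems)
qed (simp add: jet_0)

text \<open>Powers with an arbitrary real exponent form a family that is stable under differentiation,
  which is why they are treated at once; reciprocals and the normalizing factor
  \<open>1 / norm m'\<close> are then special cases.\<close>

lemma diff_order_powr:
  fixes f :: "real \<Rightarrow> real"
  assumes "\<And>y. y \<in> Y \<Longrightarrow> f y > 0"
  shows "open Y \<Longrightarrow> diff_order n Y f \<Longrightarrow> diff_order n Y (\<lambda>y. f y powr a)"
proof (induction n arbitrary: a)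
  case (Suc n)
  have c: "diff_order n Y (\<lambda>y. c)" for c :: real
    using smooth_curve_const smooth_curve_iff_diff_order by blast
  have "diff_order n Y (\<lambda>y. xderiv f y * (a * f y powr (a - 1)))"
    by (intro diff_order_mult c Suc.IH Suc.prems(1) diff_order_SucD[OF Suc.prems(2)])
      (use Suc.prems in \<open>simp add: diff_order_Suc\<close>)
  then show ?case
    by (rule diff_order_SucI[OF Suc.prems(1), rotated])
      (use Suc.prems in \<open>auto intro!: has_vector_derivative_powr assms xderiv_has_derivative
        simp: diff_order_Suc\<close>)
qed simp

lemma smooth_curve_powr:
  fixes f :: "real \<Rightarrow> real"
  shows "open Y \<Longrightarrow> smooth_curve Y f \<Longrightarrow> (\<And>y. y \<in> Y \<Longrightarrow> f y > 0) \<Longrightarrow>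
    smooth_curve Y (\<lambda>y. f y powr a)"
  by (simp add: smooth_curve_iff_diff_order diff_order_powr)

lemma jet_powr:
  fixes f1 :: "real \<Rightarrow> real"
  assumes "open Y" "x \<in> Y" "open Z" "z \<in> Z"
    and f1: "smooth_curve Y f1" "\<And>y. y \<in> Y \<Longrightarrow> f1 y > 0"
    and f2: "smooth_curve Z f2" "\<And>y. y \<in> Z \<Longrightarrow> f2 y > 0"
  shows "jet n f1 x = jet n f2 z \<Longrightarrow> jet n (\<lambda>y. f1 y powr a) x = jet n (\<lambda>y. f2 y powr a) z"
proof (induction n arbitrary: a)
  case (Suc n)
  have eq: "jet n f1 x = jet n f2 z" using Suc.prems by (meson jet_eq_mono le_SucI order_refl)
  have eq': "jet n (xderiv f1) x = jet n (xderiv f2) z" using Suc.prems by (simp add: jet_Suc)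
  show ?case
  proof (rule jet_Suc_eqI[OF assms(1,2) _ assms(3,4)])
    show "jet n (\<lambda>y. xderiv f1 y * (a * f1 y powr (a - 1))) x
        = jet n (\<lambda>y. xderiv f2 y * (a * f2 y powr (a - 1))) z"
      by (intro jet_mult[OF assms(1-4)] smooth_curve_mult smooth_curve_powr smooth_curve_const
          smooth_curve_xderiv jet_const Suc.IH eq eq' assms)
    show "f1 x powr a = f2 z powr a" using Suc.prems by (simp add: jet_Suc)
  qed (auto intro!: has_vector_derivative_powr smooth_curve_has_derivative f1 f2)
qed (simp add: jet_0)

text \<open>The denominator may be negative, so it is its square that is raised to the power \<open>- 1\<close>.\<close>

lemma divide_eq_powr: "(a::real) / b = a * (b * (b * b) powr (-1))"
  by (cases "b = 0") (auto simp: powr_minus divide_simps)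

lemma square_pos: "a \<noteq> 0 \<Longrightarrow> 0 < a * (a::real)"
  by (metis not_square_less_zero mult_eq_0_iff linorder_neqE)

lemma smooth_curve_divide:
  fixes f g :: "real \<Rightarrow> real"
  assumes "open Y" "smooth_curve Y f" "smooth_curve Y g" "\<And>y. y \<in> Y \<Longrightarrow> g y \<noteq> 0"
  shows "smooth_curve Y (\<lambda>y. f y / g y)"
  unfolding divide_eq_powr
  by (intro smooth_curve_mult smooth_curve_powr assms(1-3) square_pos assms(4))

lemma jet_divide:
  fixes f1 :: "real \<Rightarrow> real"
  assumes "open Y" "x \<in> Y" "open Z" "z \<in> Z"
    and "smooth_curve Y f1" "smooth_curve Y g1" "\<And>y. y \<in> Y \<Longrightarrow> g1 y \<noteq> 0"
    and "smooth_curve Z f2" "smooth_curve Z g2" "\<And>y. y \<in> Z \<Longrightarrow> g2 y \<noteq> 0"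
    and "jet n f1 x = jet n f2 z" "jet n g1 x = jet n g2 z"
  shows "jet n (\<lambda>y. f1 y / g1 y) x = jet n (\<lambda>y. f2 y / g2 y) z"
  unfolding divide_eq_powr
  by (intro jet_mult[OF assms(1-4)] jet_powr[OF assms(1-4)] smooth_curve_mult smooth_curve_powr
      square_pos assms)

text \<open>Smoothness of a vector valued function can be checked on its components, since the function
  is the sum of its components times the unit vectors.\<close>

lemma smooth_curve_vecI:
  fixes f :: "real \<Rightarrow> real^'n"
  assumes Y: "open Y" and f: "\<And>i. smooth_curve Y (\<lambda>y. f y $ i)"
  shows "smooth_curve Y f"
proof -
  have "smooth_curve Y (\<lambda>y. \<Sum>i\<in>I. f y $ i *\<^sub>R axis i 1 :: real^'n)" if "finite I" for I :: "'n set"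
    using that
  proof (induction I)
    case empty
    then show ?case by (simp add: smooth_curve_const)
  next
    case (insert i I)
    have "smooth_curve Y (\<lambda>y. f y $ i *\<^sub>R axis i 1 :: real^'n)"
      by (rule smooth_curve_linear[OF bounded_linear_scaleR_left Y f])
    from smooth_curve_add[OF Y this insert.IH] show ?case
      by (simp only: sum.insert[OF insert.hyps])
  qed
  from this[OF finite[of UNIV]] show ?thesis
    using basis_expansion[of "f _"] by (simp add: scalar_mult_eq_scaleR)
qed

section \<open>Smooth functions of several variables\<close>

lemma Ck_on_continuous: "Ck_on k d D f \<Longrightarrow> continuous_on D f"
  by (cases k) auto

text \<open>The clause on derivatives in the definition of \<open>Ck_on\<close>.\<close>

definition has_partials ::
  "nat \<Rightarrow> (nat \<Rightarrow> real) set \<Rightarrow> ((nat \<Rightarrow> real) \<Rightarrow> 'a::real_normed_vector) \<Rightarrow> (nat \<Rightarrow> (nat \<Rightarrow> real) \<Rightarrow> 'a) \<Rightarrow> bool"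
  where "has_partials d D f g \<longleftrightarrow> (\<forall>i<d. \<forall>y\<in>D.
    ((\<lambda>h. f (y(i := h))) has_vector_derivative g i y) (at (y i) within {h. y(i := h) \<in> D}))"

lemma has_partialsD:
  "has_partials d D f g \<Longrightarrow> i < d \<Longrightarrow> y \<in> D \<Longrightarrow>
    ((\<lambda>h. f (y(i := h))) has_vector_derivative g i y) (at (y i) within {h. y(i := h) \<in> D})"
  by (simp add: has_partials_def)

lemma Ck_on_Suc_iff:
  "Ck_on (Suc k) d D f \<longleftrightarrow>
    continuous_on D f \<and> (\<exists>g. has_partials d D f g \<and> (\<forall>i<d. Ck_on k d D (g i)))"
  by (auto simp: has_partials_def)

lemma Ck_on_SucI:
  assumes "continuous_on D f"
    and "\<And>i y. i < d \<Longrightarrow> y \<in> D \<Longrightarrow> ((\<lambda>h. f (y(i := h))) has_vector_derivative g i y)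
                             (at (y i) within {h. y(i := h) \<in> D})"
    and "\<And>i. i < d \<Longrightarrow> Ck_on k d D (g i)"
  shows "Ck_on (Suc k) d D f"
  using assms by auto

lemma Ck_on_SucD: "Ck_on (Suc k) d D f \<Longrightarrow> Ck_on k d D f"
proof (induction k arbitrary: f)
  case 0
  then show ?case by simp
next
  case (Suc k)
  obtain g where "has_partials d D f g" and gk: "\<forall>i<d. Ck_on (Suc k) d D (g i)"
    using Suc.prems unfolding Ck_on_Suc_iff by blast
  note g = has_partialsD[OF this(1)] and gk = gk[rule_format]
  show ?case
    by (rule Ck_on_SucI[OF Ck_on_continuous[OF Suc.prems] g Suc.IH[OF gk]])
qed

lemma Ck_on_cong:
  assumes eq: "\<And>y. y \<in> D \<Longrightarrow> f y = g y" and "Ck_on k d D f"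
  shows "Ck_on k d D g"
proof (cases k)
  case 0
  then show ?thesis using assms continuous_on_cong[of D D f g] by simp
next
  case (Suc l)
  obtain f' where "has_partials d D f f'" and fk: "\<forall>i<d. Ck_on l d D (f' i)"
    using assms(2) unfolding Suc Ck_on_Suc_iff by blast
  note f' = has_partialsD[OF this(1)] and fk = fk[rule_format]
  have "continuous_on D g"
    using Ck_on_continuous[OF assms(2)] continuous_on_cong[of D D f g] eq by simp
  moreover have "((\<lambda>h. g (y(i := h))) has_vector_derivative f' i y)
      (at (y i) within {h. y(i := h) \<in> D})" if "i < d" "y \<in> D" for i y
    by (rule has_vector_derivative_transform[OF _ _ f'[OF that]]) (use that in \<open>auto simp: eq\<close>)
  ultimately show ?thesis
    unfolding Suc using fk by (rule Ck_on_SucI)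
qed

lemma Ck_on_const: "Ck_on k d D (\<lambda>y. c)"
proof (induction k arbitrary: c)
  case (Suc k)
  show ?case by (rule Ck_on_SucI[where g = "\<lambda>i y. 0"]) (use Suc in auto)
qed auto

lemma Ck_on_coordinate: "Ck_on k d D (\<lambda>y. y j)"
proof (cases k)
  case 0
  have "continuous_on D (\<lambda>y. y j)"
    by (intro continuous_on_product_coordinates continuous_on_subset[OF _ subset_UNIV])
  then show ?thesis using 0 by simp
next
  case (Suc l)
  have "continuous_on D (\<lambda>y. y j)"
    by (intro continuous_on_product_coordinates continuous_on_subset[OF _ subset_UNIV])
  then show ?thesis
    unfolding Suc
    by (rule Ck_on_SucI[where g = "\<lambda>i y. if i = j then 1 else 0"]) (auto simp: Ck_on_const)
qed

lemma Ck_on_linear: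
  assumes L: "bounded_linear L"
  shows "Ck_on k d D f \<Longrightarrow> Ck_on k d D (\<lambda>y. L (f y))"
proof (induction k arbitrary: f)
  case 0
  then show ?case using bounded_linear.continuous_on[OF L] by simp
next
  case (Suc k)
  obtain g where "has_partials d D f g" and gk: "\<forall>i<d. Ck_on k d D (g i)"
    using Suc.prems unfolding Ck_on_Suc_iff by blast
  note g = has_partialsD[OF this(1)] and gk = gk[rule_format]
  show ?case
    by (rule Ck_on_SucI[where g = "\<lambda>i y. L (g i y)"])
      (intro bounded_linear.continuous_on[OF L] Ck_on_continuous[OF Suc.prems] Suc.IH gk
          bounded_linear.has_vector_derivative[OF L] g; assumption)+
qed

lemma Ck_on_add: "Ck_on k d D f \<Longrightarrow> Ck_on k d D g \<Longrightarrow> Ck_on k d D (\<lambda>y. f y + g y)"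
proof (induction k arbitrary: f g)
  case 0
  then show ?case by (simp add: continuous_on_add)
next
  case (Suc k)
  obtain f' where "has_partials d D f f'" and fk: "\<forall>i<d. Ck_on k d D (f' i)"
    using Suc.prems(1) unfolding Ck_on_Suc_iff by blast
  note f = has_partialsD[OF this(1)] and fk = fk[rule_format]
  obtain g' where "has_partials d D g g'" and gk: "\<forall>i<d. Ck_on k d D (g' i)"
    using Suc.prems(2) unfolding Ck_on_Suc_iff by blast
  note g = has_partialsD[OF this(1)] and gk = gk[rule_format]
  show ?case
    by (rule Ck_on_SucI[where g = "\<lambda>i y. f' i y + g' i y"])
      (intro continuous_on_add Ck_on_continuous[OF Suc.prems(1)] Ck_on_continuous[OF Suc.prems(2)]
        has_vector_derivative_add f g Suc.IH fk gk; assumption)+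
qed

lemma Ck_on_mult:
  fixes f g :: "(nat \<Rightarrow> real) \<Rightarrow> real"
  shows "Ck_on k d D f \<Longrightarrow> Ck_on k d D g \<Longrightarrow> Ck_on k d D (\<lambda>y. f y * g y)"
proof (induction k arbitrary: f g)
  case 0
  then show ?case by (simp add: continuous_on_mult)
next
  case (Suc k)
  obtain f' where "has_partials d D f f'" and fk: "\<forall>i<d. Ck_on k d D (f' i)"
    using Suc.prems(1) unfolding Ck_on_Suc_iff by blast
  note f = has_partialsD[OF this(1)] and fk = fk[rule_format]
  obtain g' where "has_partials d D g g'" and gk: "\<forall>i<d. Ck_on k d D (g' i)"
    using Suc.prems(2) unfolding Ck_on_Suc_iff by blast
  note g = has_partialsD[OF this(1)] and gk = gk[rule_format]
  show ?case
  proof (rule Ck_on_SucI[where g = "\<lambda>i y. f' i y * g y + f y * g' i y"])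
    show "continuous_on D (\<lambda>y. f y * g y)"
      by (intro continuous_on_mult Ck_on_continuous[OF Suc.prems(1)] Ck_on_continuous[OF Suc.prems(2)])
    show "((\<lambda>h. f (y(i := h)) * g (y(i := h))) has_vector_derivative f' i y * g y + f y * g' i y)
      (at (y i) within {h. y(i := h) \<in> D})" if "i < d" "y \<in> D" for i y
      using has_vector_derivative_times[OF f[OF that] g[OF that]] by simp
    show "Ck_on k d D (\<lambda>y. f' i y * g y + f y * g' i y)" if "i < d" for i
      by (intro Ck_on_add Suc.IH fk gk that Suc.prems[THEN Ck_on_SucD])
  qed
qed

lemma Ck_on_powr:
  fixes f :: "(nat \<Rightarrow> real) \<Rightarrow> real"
  assumes pos: "\<And>y. y \<in> D \<Longrightarrow> f y > 0"
  shows "Ck_on k d D f \<Longrightarrow> Ck_on k d D (\<lambda>y. f y powr a)"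
proof (induction k arbitrary: a)
  case 0
  have "continuous_on D (\<lambda>y. f y powr a)"
    by (intro continuous_on_powr continuous_on_const Ck_on_continuous[OF 0])
      (use pos in force)
  then show ?case by simp
next
  case (Suc k)
  obtain f' where "has_partials d D f f'" and fk: "\<forall>i<d. Ck_on k d D (f' i)"
    using Suc.prems unfolding Ck_on_Suc_iff by blast
  note f = has_partialsD[OF this(1)] and fk = fk[rule_format]
  show ?case
  proof (rule Ck_on_SucI[where g = "\<lambda>i y. f' i y * (a * f y powr (a - 1))"])
    show "continuous_on D (\<lambda>y. f y powr a)"
      by (intro continuous_on_powr continuous_on_const Ck_on_continuous[OF Suc.prems])
        (use pos in force)
    show "((\<lambda>h. f (y(i := h)) powr a) has_vector_derivative f' i y * (a * f y powr (a - 1)))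
      (at (y i) within {h. y(i := h) \<in> D})" if "i < d" "y \<in> D" for i y
      using has_vector_derivative_powr[OF f[OF that]] pos[OF that(2)] by simp
    show "Ck_on k d D (\<lambda>y. f' i y * (a * f y powr (a - 1)))" if "i < d" for i
      by (intro Ck_on_mult Ck_on_const fk that Suc.IH Ck_on_SucD[OF Suc.prems])
  qed
qed

text \<open>The classes \<open>C^k\<close> provide a derivative for each \<open>k\<close> separately; where one-sided derivatives are
  unique these are all the same function, which is then smooth.\<close>

lemma smooth_vars_partial:
  assumes f: "smooth_vars d D f"
    and nontrivial: "\<And>i y. i < d \<Longrightarrow> y \<in> D \<Longrightarrow> at (y i) within {h. y(i := h) \<in> D} \<noteq> bot"
  obtains g where "has_partials d D f g" and "\<forall>i<d. smooth_vars d D (g i)"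
proof -
  have Ck: "Ck_on k d D f" for k
    using f by (simp add: smooth_vars_def)
  obtain g where g: "has_partials d D f g"
    using Ck[of "Suc 0"] unfolding Ck_on_Suc_iff by blast
  have "Ck_on k d D (g i)" if i: "i < d" for i k
  proof -
    obtain g' where g': "has_partials d D f g'" and gk: "\<forall>i<d. Ck_on k d D (g' i)"
      using Ck[of "Suc k"] unfolding Ck_on_Suc_iff by blast
    have "g' i y = g i y" if "y \<in> D" for y
      by (rule vector_derivative_unique_within[OF nontrivial[OF i that]
            has_partialsD[OF g' i that] has_partialsD[OF g i that]])
    then show ?thesis
      by (rule Ck_on_cong) (simp, rule gk[rule_format, OF i])
  qed
  then have "\<forall>i<d. smooth_vars d D (g i)"
    by (simp add: smooth_vars_def)
  with g show thesis by (rule that)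
qed

section \<open>Smooth flows\<close>

abbreviation flow_dom :: "real set \<Rightarrow> real set \<Rightarrow> (nat \<Rightarrow> real) set" where
  "flow_dom T X \<equiv> {y. y 0 \<in> T \<and> y 1 \<in> X}"

lemma smooth_flow_cong:
  assumes "\<And>t x. t \<in> T \<Longrightarrow> x \<in> X \<Longrightarrow> c t x = c' t x" "smooth_flow T X c"
  shows "smooth_flow T X c'"
  unfolding smooth_flow_def smooth_vars_def
proof
  fix k
  have "Ck_on k 2 (flow_dom T X) (\<lambda>y. c (y 0) (y 1))"
    using assms(2) by (simp add: smooth_flow_def smooth_vars_def)
  then show "Ck_on k 2 (flow_dom T X) (\<lambda>y. c' (y 0) (y 1))"
    by (rule Ck_on_cong[rotated]) (simp add: assms(1))
qed

lemma smooth_flow_const: "smooth_flow T X (\<lambda>t x. a)"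
  by (simp add: smooth_flow_def smooth_vars_def Ck_on_const)

lemma smooth_flow_linear:
  "bounded_linear L \<Longrightarrow> smooth_flow T X c \<Longrightarrow> smooth_flow T X (\<lambda>t x. L (c t x))"
  unfolding smooth_flow_def smooth_vars_def by (rule allI, rule Ck_on_linear) (assumption, erule spec)

lemma smooth_flow_add:
  "smooth_flow T X c \<Longrightarrow> smooth_flow T X c' \<Longrightarrow> smooth_flow T X (\<lambda>t x. c t x + c' t x)"
  unfolding smooth_flow_def smooth_vars_def by (rule allI, rule Ck_on_add) (erule spec)+

lemma smooth_flow_mult:
  fixes c c' :: "real \<Rightarrow> real \<Rightarrow> real"
  shows "smooth_flow T X c \<Longrightarrow> smooth_flow T X c' \<Longrightarrow> smooth_flow T X (\<lambda>t x. c t x * c' t x)"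
  unfolding smooth_flow_def smooth_vars_def by (rule allI, rule Ck_on_mult) (erule spec)+

lemma smooth_flow_powr:
  fixes c :: "real \<Rightarrow> real \<Rightarrow> real"
  assumes "smooth_flow T X c" "\<And>t x. t \<in> T \<Longrightarrow> x \<in> X \<Longrightarrow> c t x > 0"
  shows "smooth_flow T X (\<lambda>t x. c t x powr a)"
  using assms by (auto simp: smooth_flow_def smooth_vars_def intro!: Ck_on_powr)

lemma smooth_flow_divide:
  fixes c c' :: "real \<Rightarrow> real \<Rightarrow> real"
  assumes "smooth_flow T X c" "smooth_flow T X c'" "\<And>t x. t \<in> T \<Longrightarrow> x \<in> X \<Longrightarrow> c' t x \<noteq> 0"
  shows "smooth_flow T X (\<lambda>t x. c t x / c' t x)"
  unfolding divide_eq_powr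
  by (intro smooth_flow_mult smooth_flow_powr assms square_pos)

lemma smooth_flow_nth:
  fixes c :: "real \<Rightarrow> real \<Rightarrow> real^'n"
  shows "smooth_flow T X c \<Longrightarrow> smooth_flow T X (\<lambda>t x. c t x $ i)"
  by (rule smooth_flow_linear[OF bounded_linear_vec_nth])

lemma smooth_flow_vecI:
  fixes c :: "real \<Rightarrow> real \<Rightarrow> real^'n"
  assumes c: "\<And>i. smooth_flow T X (\<lambda>t x. c t x $ i)"
  shows "smooth_flow T X c"
proof -
  have "smooth_flow T X (\<lambda>t x. \<Sum>i\<in>I. c t x $ i *\<^sub>R axis i 1 :: real^'n)"
    if "finite I" for I :: "'n set"
    using that
  proof (induction I)
    case empty
    then show ?case by (simp add: smooth_flow_const)
  next
    case (insert i I)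
    have "smooth_flow T X (\<lambda>t x. c t x $ i *\<^sub>R axis i 1 :: real^'n)"
      by (rule smooth_flow_linear[OF bounded_linear_scaleR_left c])
    from smooth_flow_add[OF this insert.IH] show ?case
      by (simp only: sum.insert[OF insert.hyps])
  qed
  from this[OF finite[of UNIV]] show ?thesis
    using basis_expansion[of "c _ _"] by (simp add: scalar_mult_eq_scaleR)
qed

lemma smooth_flow_continuous:
  assumes "smooth_flow T X c"
  shows "continuous_on (T \<times> X) (\<lambda>p. c (fst p) (snd p))"
proof -
  let ?e = "\<lambda>p i. if i = (0::nat) then fst p else if i = 1 then snd p else (0::real)"
  have "continuous_on (T \<times> X) ?e"
  proof (rule continuous_on_coordinatewise_then_product)
    fix i :: nat
    consider "i = 0" | "i = 1" | "i > 1" by linarith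
    then show "continuous_on (T \<times> X) (\<lambda>p. ?e p i)"
      by cases (auto intro!: continuous_intros)
  qed
  moreover have "?e ` (T \<times> X) \<subseteq> flow_dom T X" by auto
  moreover have "continuous_on (flow_dom T X) (\<lambda>y. c (y 0) (y 1))"
    using assms Ck_on_continuous unfolding smooth_flow_def smooth_vars_def by blast
  ultimately have "continuous_on (T \<times> X) (\<lambda>p. c (?e p 0) (?e p 1))"
    using continuous_on_compose2[of "flow_dom T X" "\<lambda>y. c (y 0) (y 1)" "T \<times> X" ?e] by blast
  then show ?thesis by simp
qed

lemma smooth_flow_continuous_compose:
  assumes "smooth_flow T X c" "continuous_on S p" "continuous_on S q"
    "\<And>z. z \<in> S \<Longrightarrow> p z \<in> T" "\<And>z. z \<in> S \<Longrightarrow> q z \<in> X"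
  shows "continuous_on S (\<lambda>z. c (p z) (q z))"
proof -
  have "continuous_on S (\<lambda>z. (p z, q z))"
    by (intro continuous_on_Pair assms)
  moreover have "(\<lambda>z. (p z, q z)) ` S \<subseteq> T \<times> X"
    using assms by auto
  ultimately show ?thesis
    using continuous_on_compose2[OF smooth_flow_continuous[OF assms(1)]] by fastforce
qed

definition tderiv :: "real set \<Rightarrow> (real \<Rightarrow> real \<Rightarrow> 'a::real_normed_vector) \<Rightarrow> real \<Rightarrow> real \<Rightarrow> 'a" where
  "tderiv T c t x = vector_derivative (\<lambda>\<tau>. c \<tau> x) (at t within T)"

text \<open>Nondegeneracy of \<open>T\<close> makes derivatives within \<open>T\<close> unique, also the one-sided ones at
  an endpoint.\<close>

locale flow_domain =
  fixes T X :: "real set"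
  assumes T_interval: "is_interval T" and T_nontrivial: "\<exists>s\<in>T. \<exists>t\<in>T. s \<noteq> t"
    and X_interval: "is_interval X" and X_open: "open X"
begin

lemma at_T: "t \<in> T \<Longrightarrow> at t within T \<noteq> bot"
  unfolding trivial_limit_within
  using connected_imp_perfect[OF is_interval_connected[OF T_interval], of t] T_nontrivial by blast

lemma tderivI:
  assumes "t \<in> T" "((\<lambda>\<tau>. c \<tau> x) has_vector_derivative d) (at t within T)"
  shows "tderiv T c t x = d"
  unfolding tderiv_def by (rule vector_derivative_within[OF at_T[OF assms(1)] assms(2)])

lemma smooth_flow_partials:
  fixes c :: "real \<Rightarrow> real \<Rightarrow> 'a::real_normed_vector"
  assumes "smooth_flow T X c"
  shows smooth_flow_tderiv: "smooth_flow T X (tderiv T c)"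
    and smooth_flow_xderiv: "smooth_flow T X (\<lambda>t. xderiv (c t))"
    and smooth_flow_has_tderiv: "\<And>t x. t \<in> T \<Longrightarrow> x \<in> X \<Longrightarrow>
      ((\<lambda>\<tau>. c \<tau> x) has_vector_derivative tderiv T c t x) (at t within T)"
    and smooth_flow_has_xderiv: "\<And>t x. t \<in> T \<Longrightarrow> x \<in> X \<Longrightarrow>
      (c t has_vector_derivative xderiv (c t) x) (at x)"
proof -
  let ?D = "flow_dom T X" and ?f = "\<lambda>y. c (y 0) (y 1)"
  have slice0: "{h. y(0 := h) \<in> ?D} = T" and slice1: "{h. y(1 := h) \<in> ?D} = X" if "y \<in> ?D" for y
    using that by auto
  have "at (y i) within {h. y(i := h) \<in> ?D} \<noteq> bot" if i: "i < 2" and y: "y \<in> ?D" for i y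
  proof -
    consider "i = 0" | "i = 1" using i by linarith
    then show ?thesis
    proof cases
      case 1
      then show ?thesis using slice0[OF y] at_T y by simp
    next
      case 2
      then show ?thesis using slice1[OF y] at_within_open[OF _ X_open] y by simp
    qed
  qed
  from smooth_vars_partial[OF assms[unfolded smooth_flow_def] this]
  obtain g where "has_partials 2 ?D ?f g" and gs: "\<forall>i<2. smooth_vars 2 ?D (g i)"
    by blast
  note g = has_partialsD[OF this(1)]
  have g0: "((\<lambda>h. c h (y 1)) has_vector_derivative g 0 y) (at (y 0) within T)" if "y \<in> ?D" for y
    using g[OF _ that, of 0] slice0[OF that] by simp
  have g1: "((\<lambda>h. c (y 0) h) has_vector_derivative g 1 y) (at (y 1))" if "y \<in> ?D" for y
    using g[OF _ that, of 1] slice1[OF that] that at_within_open[OF _ X_open] by simp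
  have t: "g 0 y = tderiv T c (y 0) (y 1)" and x: "g 1 y = xderiv (c (y 0)) (y 1)" if "y \<in> ?D" for y
    using tderivI[where c = c, OF _ g0[OF that]] xderivI[OF g1[OF that]] that by auto
  have "Ck_on k 2 ?D (\<lambda>y. tderiv T c (y 0) (y 1))" "Ck_on k 2 ?D (\<lambda>y. xderiv (c (y 0)) (y 1))" for k
    by (rule Ck_on_cong[OF t], assumption, use gs in \<open>simp add: smooth_vars_def\<close>)
      (rule Ck_on_cong[OF x], assumption, use gs in \<open>simp add: smooth_vars_def\<close>)
  then show "smooth_flow T X (tderiv T c)" "smooth_flow T X (\<lambda>t. xderiv (c t))"
    by (simp_all add: smooth_flow_def smooth_vars_def)
  fix t x assume "t \<in> T" "x \<in> X"
  then have D: "(\<lambda>i. if i = 0 then t else x) \<in> ?D" by simp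
  show "((\<lambda>\<tau>. c \<tau> x) has_vector_derivative tderiv T c t x) (at t within T)"
    using g0[OF D] t[OF D] by simp
  show "(c t has_vector_derivative xderiv (c t) x) (at x)"
    using g1[OF D] x[OF D] by simp
qed

lemma smooth_flow_smooth_curve:
  assumes "smooth_flow T X c" "t \<in> T"
  shows "smooth_curve X (c t)"
proof -
  have *: "smooth_flow T X (\<lambda>t. (xderiv ^^ k) (c t))" for k
  proof (induction k)
    case 0
    then show ?case using assms by simp
  next
    case (Suc k)
    then show ?case using smooth_flow_xderiv[OF Suc] by simp
  qed
  then show ?thesis
    unfolding smooth_curve_def using smooth_flow_has_xderiv[OF *] assms(2) differentiableI_vector by blast
qed

text \<open>Integrating in \<open>t\<close> and differentiating under the integral sign shows the commutation of the
  two partial derivatives directly, also at the endpoints of \<open>T\<close>.\<close>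

lemma mixed_partials:
  fixes c :: "real \<Rightarrow> real \<Rightarrow> 'a::banach"
  assumes c: "smooth_flow T X c" and t: "t \<in> T" and x: "x \<in> X"
  shows "tderiv T (\<lambda>\<tau>. xderiv (c \<tau>)) t x = xderiv (tderiv T c t) x"
proof -
  obtain a b where ab: "a < b" "t \<in> {a..b}" "{a..b} \<subseteq> T"
  proof -
    obtain s where s: "s \<in> T" "s \<noteq> t" using T_nontrivial by metis
    have Icc: "{p..q} \<subseteq> T" if "p \<in> T" "q \<in> T" for p q
      using mem_is_interval_1_I[OF T_interval that] by auto
    show thesis
    proof (cases "s < t")
      case True
      then show thesis by (intro that[of s t] Icc s t) auto
    next
      case False
      then show thesis using s(2) by (intro that[of t s] Icc s t) auto
    qed
  qed
  let ?F = "\<lambda>\<tau>. xderiv (c \<tau>)" and ?G = "tderiv T c"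
  have G: "smooth_flow T X ?G" by (rule smooth_flow_tderiv[OF c])
  have F: "smooth_flow T X ?F" by (rule smooth_flow_xderiv[OF c])
  have contG: "continuous_on {a..b} (\<lambda>\<tau>. ?G \<tau> z)" if "z \<in> X" for z
    by (rule smooth_flow_continuous_compose[OF G]) (use that ab in \<open>auto intro: continuous_intros\<close>)
  have contGx: "continuous_on {a..b} (\<lambda>\<tau>. xderiv (?G \<tau>) x)"
    by (rule smooth_flow_continuous_compose[OF smooth_flow_xderiv[OF G]])
      (use x ab in \<open>auto intro: continuous_intros\<close>)
  have eq: "?F s x = ?F a x + integral {a..s} (\<lambda>\<tau>. xderiv (?G \<tau>) x)" if s: "s \<in> {a..b}" for s
  proof -
    have sub: "{a..s} \<subseteq> T" "{a..s} \<subseteq> {a..b}" using s ab by auto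
    have int: "c s z = c a z + integral {a..s} (\<lambda>\<tau>. ?G \<tau> z)" if "z \<in> X" for z
    proof -
      have "((\<lambda>\<tau>. ?G \<tau> z) has_integral c s z - c a z) {a..s}"
        by (rule fundamental_theorem_of_calculus)
          (use s sub that in \<open>auto intro!: has_vector_derivative_within_subset[OF smooth_flow_has_tderiv[OF c]]\<close>)
      then show ?thesis by (simp add: integral_unique)
    qed
    have "((\<lambda>z. integral (cbox a s) (\<lambda>\<tau>. ?G \<tau> z)) has_vector_derivative
        integral (cbox a s) (\<lambda>\<tau>. xderiv (?G \<tau>) x)) (at x within X)"
    proof (rule leibniz_rule_vector_derivative[where f = "\<lambda>z \<tau>. ?G \<tau> z"
          and fx = "\<lambda>z \<tau>. xderiv (?G \<tau>) z"])
      show "((\<lambda>z. ?G \<tau> z) has_vector_derivative xderiv (?G \<tau>) z) (at z within X)"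
        if "z \<in> X" "\<tau> \<in> cbox a s" for z \<tau>
        using that sub smooth_flow_has_xderiv[OF G] has_vector_derivative_at_within by fastforce
      show "(\<lambda>\<tau>. ?G \<tau> z) integrable_on cbox a s" if "z \<in> X" for z
        by (rule integrable_continuous) (use continuous_on_subset[OF contG[OF that] sub(2)] in simp)
      show "continuous_on (X \<times> cbox a s) (\<lambda>(z, \<tau>). xderiv (?G \<tau>) z)"
        unfolding case_prod_beta
        by (rule smooth_flow_continuous_compose[OF smooth_flow_xderiv[OF G]])
          (use sub in \<open>auto intro: continuous_intros\<close>)
      show "x \<in> X" by (rule x)
      show "convex X" using X_interval by (simp add: is_interval_convex)
    qed
    then have "((\<lambda>z. c a z + integral {a..s} (\<lambda>\<tau>. ?G \<tau> z)) has_vector_derivative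
        ?F a x + integral {a..s} (\<lambda>\<tau>. xderiv (?G \<tau>) x)) (at x)"
      using at_within_open[OF x X_open] ab s
      by (intro has_vector_derivative_add smooth_flow_has_xderiv[OF c _ x]) auto
    then have "(c s has_vector_derivative ?F a x + integral {a..s} (\<lambda>\<tau>. xderiv (?G \<tau>) x)) (at x)"
      by (rule has_vector_derivative_transform_within_open[OF _ X_open x]) (simp add: int)
    then show ?thesis by (rule xderivI)
  qed
  have "((\<lambda>s. ?F a x + integral {a..s} (\<lambda>\<tau>. xderiv (?G \<tau>) x)) has_vector_derivative
      0 + xderiv (?G t) x) (at t within {a..b})"
    by (intro has_vector_derivative_add integral_has_vector_derivative contGx ab(2)) auto
  then have "((\<lambda>s. ?F s x) has_vector_derivative xderiv (?G t) x) (at t within {a..b})"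
    using has_vector_derivative_transform[OF ab(2) eq] by simp
  moreover have "((\<lambda>s. ?F s x) has_vector_derivative tderiv T ?F t x) (at t within {a..b})"
    by (rule has_vector_derivative_within_subset[OF smooth_flow_has_tderiv[OF F t x] ab(3)])
  moreover have "at t within {a..b} \<noteq> bot"
    using ab(1,2) by (simp add: trivial_limit_within islimpt_Icc)
  ultimately show ?thesis
    using vector_derivative_unique_within by blast
qed

end

section \<open>The light cone\<close>

text \<open>The library enumerates the index type as 1, 2, 3, 4.\<close>

lemma four_eq_zero: "(4::4) = 0" by simp

lemma forall_coords: "(\<forall>i::4. P i) \<longleftrightarrow> P 0 \<and> P 1 \<and> P 2 \<and> P 3"
  using forall_4[of P] four_eq_zero by metis

lemma sum_coords: "(\<Sum>i\<in>(UNIV::4 set). f i) = f 0 + f 1 + f 2 + f 3"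
  unfolding sum_4 four_eq_zero by (simp add: add_ac)

lemma innerJ_coords:
  "innerJ u v = u $ 1 * v $ 1 + u $ 2 * v $ 2 - u $ 0 * v $ 3 - u $ 3 * v $ 0"
  by (simp add: innerJ_def inner_vec_def matrix_vector_mult_def J_def sum_coords)

lemma innerJ_O31:
  assumes "\<Theta> \<in> O31"
  shows "innerJ (\<Theta> *v u) (\<Theta> *v v) = innerJ u v"
proof -
  have "innerJ (\<Theta> *v u) (\<Theta> *v v) = u \<bullet> (transpose \<Theta> *v (J *v (\<Theta> *v v)))"
    unfolding innerJ_def by (metis dot_lmul_matrix inner_commute transpose_matrix_vector)
  also have "\<dots> = u \<bullet> ((transpose \<Theta> ** J ** \<Theta>) *v v)"
    by (simp add: matrix_vector_mul_assoc matrix_mul_assoc)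
  finally show ?thesis using assms by (simp add: O31_def innerJ_def)
qed

lemma O31_mult:
  assumes "\<Theta> \<in> O31" "\<Phi> \<in> O31"
  shows "\<Theta> ** \<Phi> \<in> O31"
proof -
  have "transpose (\<Theta> ** \<Phi>) ** J ** (\<Theta> ** \<Phi>) = transpose \<Phi> ** (transpose \<Theta> ** J ** \<Theta>) ** \<Phi>"
    by (simp add: matrix_transpose_mul matrix_mul_assoc)
  then show ?thesis using assms by (simp add: O31_def)
qed

lemma mat_1_O31: "mat 1 \<in> O31"
  by (simp add: O31_def transpose_mat)

lemma uminus_O31: "\<Theta> \<in> O31 \<Longrightarrow> - \<Theta> \<in> O31"
  by (simp add: O31_def transpose_def vec_eq_iff matrix_matrix_mult_def sum_negf)

lemma light_cone_O31: "\<Theta> \<in> O31 \<Longrightarrow> v \<in> light_cone \<Longrightarrow> \<Theta> *v v \<in> light_cone"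
  by (simp add: light_cone_def innerJ_O31)

lemma normJ_O31: "\<Theta> \<in> O31 \<Longrightarrow> normJ (\<Theta> *v v) = normJ v"
  by (simp add: normJ_def innerJ_O31)

lemma light_cone_iff: "v \<in> light_cone \<longleftrightarrow> 2 * (v $ 0 * v $ 3) = (v $ 1)\<^sup>2 + (v $ 2)\<^sup>2"
  by (auto simp: light_cone_def innerJ_coords power2_eq_square)

lemma Lift0_nth [simp]:
  "Lift0 m $ 0 = ((m $ 1)\<^sup>2 + (m $ 2)\<^sup>2) / 2" "Lift0 m $ 1 = m $ 1" "Lift0 m $ 2 = m $ 2"
  "Lift0 m $ 3 = 1"
  by (simp_all add: Lift0_def norm_vec_def L2_set_def sum_2)

lemma Proj_nth [simp]: "Proj v $ 1 = v $ 1 / v $ 3" "Proj v $ 2 = v $ 2 / v $ 3"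
  by (simp_all add: Proj_def)

lemma light_cone_eq_scaled_Lift0:
  assumes "v \<in> light_cone" "v $ 3 \<noteq> 0"
  shows "v = v $ 3 *\<^sub>R Lift0 (Proj v)"
proof -
  have "v $ 0 = ((v $ 1)\<^sup>2 + (v $ 2)\<^sup>2) / (2 * v $ 3)"
    using assms by (simp add: light_cone_iff field_simps)
  also have "\<dots> = v $ 3 * (((v $ 1 / v $ 3)\<^sup>2 + (v $ 2 / v $ 3)\<^sup>2) / 2)"
    using assms(2) by (simp add: power2_eq_square divide_simps)
  finally show ?thesis
    using assms(2) by (simp add: vec_eq_iff forall_coords)
qed

lemma Lift0_light_cone: "a *\<^sub>R Lift0 m \<in> light_cone"
  by (simp add: light_cone_iff field_simps power2_eq_square)

lemma Proj_scaled_Lift0: "a \<noteq> 0 \<Longrightarrow> Proj (a *\<^sub>R Lift0 m) = m"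
  by (simp add: vec_eq_iff forall_2)

lemma Proj_scaleR: "a \<noteq> 0 \<Longrightarrow> Proj (a *\<^sub>R v) = Proj v"
  by (simp add: vec_eq_iff forall_2)

lemma norm_real2: "norm (v::real^2) = sqrt ((v $ 1)\<^sup>2 + (v $ 2)\<^sup>2)"
  by (simp add: norm_vec_def L2_set_def sum_2)

section \<open>Curves in the cone and their projections\<close>

lemma smooth_curve_Proj:
  assumes "open Y" "smooth_curve Y c" "\<And>y. y \<in> Y \<Longrightarrow> c y $ 3 \<noteq> 0"
  shows "smooth_curve Y (\<lambda>y. Proj (c y))"
proof (rule smooth_curve_vecI[OF assms(1)])
  fix i :: 2
  show "smooth_curve Y (\<lambda>y. Proj (c y) $ i)"
    using exhaust_2[of i] smooth_curve_divide[OF assms(1) smooth_curve_nth[OF assms(1,2)]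
        smooth_curve_nth[OF assms(1,2)] assms(3)] by auto
qed

text \<open>Differentiating \<open>w = w\<^sub>3 \<cdot> Lift0 m\<close>: since \<open>Lift0 m\<close> is a null vector, also its derivative is
  orthogonal to it, and the component along \<open>Lift0 m\<close> does not contribute to the length of \<open>w'\<close>.\<close>

lemma cone_curve_derivative:
  assumes Y: "open Y" and c: "smooth_curve Y c"
    and cone: "\<And>y. y \<in> Y \<Longrightarrow> c y \<in> light_cone" and c3: "\<And>y. y \<in> Y \<Longrightarrow> c y $ 3 \<noteq> 0"
    and x: "x \<in> Y"
  defines "m \<equiv> \<lambda>y. Proj (c y)"
  shows "xderiv c x $ 0 = xderiv c x $ 3 * ((m x $ 1)\<^sup>2 + (m x $ 2)\<^sup>2) / 2
       + c x $ 3 * (m x $ 1 * xderiv m x $ 1 + m x $ 2 * xderiv m x $ 2)"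
    and "xderiv c x $ 1 = xderiv c x $ 3 * m x $ 1 + c x $ 3 * xderiv m x $ 1"
    and "xderiv c x $ 2 = xderiv c x $ 3 * m x $ 2 + c x $ 3 * xderiv m x $ 2"
    and "innerJ (xderiv c x) (xderiv c x) = (c x $ 3 * norm (xderiv m x))\<^sup>2"
    and "normJ (xderiv c x) = \<bar>c x $ 3\<bar> * norm (xderiv m x)"
proof -
  have m: "smooth_curve Y m" unfolding m_def by (rule smooth_curve_Proj[OF Y c c3])
  have hc: "((\<lambda>y. c y $ i) has_vector_derivative xderiv c x $ i) (at x)" for i
    by (rule bounded_linear.has_vector_derivative[OF bounded_linear_vec_nth
          smooth_curve_has_derivative[OF c x]])
  have hm: "((\<lambda>y. m y $ i) has_vector_derivative xderiv m x $ i) (at x)" for i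
    by (rule bounded_linear.has_vector_derivative[OF bounded_linear_vec_nth
          smooth_curve_has_derivative[OF m x]])
  have comp: "c y $ 0 = c y $ 3 * ((m y $ 1 * m y $ 1 + m y $ 2 * m y $ 2) * (1/2))"
    "c y $ 1 = c y $ 3 * m y $ 1" "c y $ 2 = c y $ 3 * m y $ 2" if "y \<in> Y" for y
    using arg_cong[OF light_cone_eq_scaled_Lift0[OF cone[OF that] c3[OF that]], of "\<lambda>v. v $ 0"]
      c3[OF that] by (simp_all add: m_def power2_eq_square)
  have "((\<lambda>y. c y $ 3 * m y $ i) has_vector_derivative
      xderiv c x $ 3 * m x $ i + c x $ 3 * xderiv m x $ i) (at x)" for i
    by (rule has_vector_derivative_times[OF hc hm])
  then have "((\<lambda>y. c y $ 1) has_vector_derivative xderiv c x $ 3 * m x $ 1 + c x $ 3 * xderiv m x $ 1) (at x)"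
    "((\<lambda>y. c y $ 2) has_vector_derivative xderiv c x $ 3 * m x $ 2 + c x $ 3 * xderiv m x $ 2) (at x)"
    using has_derivative_cong_open[OF Y x comp(2)] has_derivative_cong_open[OF Y x comp(3)] by auto
  then show 1: "xderiv c x $ 1 = xderiv c x $ 3 * m x $ 1 + c x $ 3 * xderiv m x $ 1"
    and 2: "xderiv c x $ 2 = xderiv c x $ 3 * m x $ 2 + c x $ 3 * xderiv m x $ 2"
    using vector_derivative_unique_at[OF hc] by blast+
  have "((\<lambda>y. c y $ 3 * ((m y $ 1 * m y $ 1 + m y $ 2 * m y $ 2) * (1/2))) has_vector_derivative
      xderiv c x $ 3 * ((m x $ 1 * m x $ 1 + m x $ 2 * m x $ 2) * (1/2))
      + c x $ 3 * ((xderiv m x $ 1 * m x $ 1 + m x $ 1 * xderiv m x $ 1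
        + (xderiv m x $ 2 * m x $ 2 + m x $ 2 * xderiv m x $ 2)) * (1/2)
        + (m x $ 1 * m x $ 1 + m x $ 2 * m x $ 2) * 0)) (at x)"
    by (intro has_vector_derivative_times has_vector_derivative_add hc hm has_vector_derivative_const)
  then have "((\<lambda>y. c y $ 0) has_vector_derivative
      xderiv c x $ 3 * ((m x $ 1 * m x $ 1 + m x $ 2 * m x $ 2) * (1/2))
      + c x $ 3 * ((xderiv m x $ 1 * m x $ 1 + m x $ 1 * xderiv m x $ 1
        + (xderiv m x $ 2 * m x $ 2 + m x $ 2 * xderiv m x $ 2)) * (1/2)
        + (m x $ 1 * m x $ 1 + m x $ 2 * m x $ 2) * 0)) (at x)"
    using has_derivative_cong_open[OF Y x comp(1)] by simp
  then show 0: "xderiv c x $ 0 = xderiv c x $ 3 * ((m x $ 1)\<^sup>2 + (m x $ 2)\<^sup>2) / 2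
       + c x $ 3 * (m x $ 1 * xderiv m x $ 1 + m x $ 2 * xderiv m x $ 2)"
    using vector_derivative_unique_at[OF hc] by (fastforce simp: power2_eq_square algebra_simps)
  show 3: "innerJ (xderiv c x) (xderiv c x) = (c x $ 3 * norm (xderiv m x))\<^sup>2"
    unfolding innerJ_coords 0 1 2 norm_real2 power_mult_distrib
    by (simp add: power2_eq_square algebra_simps)
  show "normJ (xderiv c x) = \<bar>c x $ 3\<bar> * norm (xderiv m x)"
    unfolding normJ_def 3 by (simp add: abs_mult)
qed

text \<open>The lift of unit speed.\<close>

definition cone_lift :: "(real \<Rightarrow> real^2) \<Rightarrow> real \<Rightarrow> real^4" where
  "cone_lift m x = (1 / norm (xderiv m x)) *\<^sub>R Lift0 (m x)"

abbreviation speed_sq :: "(real \<Rightarrow> real^2) \<Rightarrow> real \<Rightarrow> real" where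
  "speed_sq m x \<equiv> xderiv m x $ 1 * xderiv m x $ 1 + xderiv m x $ 2 * xderiv m x $ 2"

lemma inverse_norm_eq_powr:
  "v \<noteq> 0 \<Longrightarrow> 1 / norm v = (v $ 1 * v $ 1 + v $ 2 * v $ 2) powr (-1/2)" for v :: "real^2"
  using powr_minus[of "v $ 1 * v $ 1 + v $ 2 * v $ 2" "1/2"]
    powr_half_sqrt[of "v $ 1 * v $ 1 + v $ 2 * v $ 2"]
  by (simp add: norm_real2 power2_eq_square inverse_eq_divide)

lemma speed_sq_pos: "v \<noteq> 0 \<Longrightarrow> 0 < v $ 1 * v $ 1 + v $ 2 * v $ 2" for v :: "real^2"
  using sum_squares_gt_zero_iff[of "v $ 1" "v $ 2"] by (auto simp: vec_eq_iff forall_2)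

lemma cone_lift_nth:
  assumes "xderiv m x \<noteq> 0"
  shows "cone_lift m x $ 0 = speed_sq m x powr (-1/2) * ((m x $ 1 * m x $ 1 + m x $ 2 * m x $ 2) * (1/2))"
    "cone_lift m x $ 1 = speed_sq m x powr (-1/2) * m x $ 1"
    "cone_lift m x $ 2 = speed_sq m x powr (-1/2) * m x $ 2"
    "cone_lift m x $ 3 = speed_sq m x powr (-1/2)"
  unfolding cone_lift_def inverse_norm_eq_powr[OF assms] by (simp_all add: power2_eq_square)

lemma exhaust_coords: "(i::4) = 0 \<or> i = 1 \<or> i = 2 \<or> i = 3"
  using exhaust_4[of i] four_eq_zero by auto

lemma smooth_curve_cone_lift:
  assumes Y: "open Y" and m: "smooth_curve Y m" and m': "\<And>y. y \<in> Y \<Longrightarrow> xderiv m y \<noteq> 0"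
  shows "smooth_curve Y (cone_lift m)"
proof (rule smooth_curve_vecI[OF Y])
  fix i :: 4
  note sm = smooth_curve_nth[OF Y m] smooth_curve_nth[OF Y smooth_curve_xderiv[OF m]]
  have p: "smooth_curve Y (\<lambda>y. speed_sq m y powr (-1/2))"
    by (intro smooth_curve_powr smooth_curve_add smooth_curve_mult Y sm speed_sq_pos m')
  have "smooth_curve Y (\<lambda>y. speed_sq m y powr (-1/2) * ((m y $ 1 * m y $ 1 + m y $ 2 * m y $ 2) * (1/2)))"
    "smooth_curve Y (\<lambda>y. speed_sq m y powr (-1/2) * m y $ j)" for j
    by (intro p smooth_curve_add smooth_curve_mult smooth_curve_const Y sm)+
  note q = this
  have l: "smooth_curve Y (\<lambda>y. cone_lift m y $ i)"
    if "\<And>y. y \<in> Y \<Longrightarrow> cone_lift m y $ i = g y" "smooth_curve Y g" for g i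
    by (rule smooth_curve_cong[THEN iffD2, OF Y that])
  have "smooth_curve Y (\<lambda>y. cone_lift m y $ 0)" "smooth_curve Y (\<lambda>y. cone_lift m y $ 1)"
    "smooth_curve Y (\<lambda>y. cone_lift m y $ 2)" "smooth_curve Y (\<lambda>y. cone_lift m y $ 3)"
    by (rule l[OF cone_lift_nth(1)[OF m'] q(1)] l[OF cone_lift_nth(2)[OF m'] q(2)]
        l[OF cone_lift_nth(3)[OF m'] q(2)] l[OF cone_lift_nth(4)[OF m'] p]; assumption)+
  then show "smooth_curve Y (\<lambda>y. cone_lift m y $ i)"
    using exhaust_coords[of i] by (elim disjE) simp_all
qed

text \<open>A jet of the lift is determined by the jet of \<open>m\<close> of one order more, as \<open>m'\<close> enters the lift.\<close>

lemma jet_cone_lift: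
  assumes Y: "open Y" "x \<in> Y" and m: "smooth_curve Y m" and m': "\<And>y. y \<in> Y \<Longrightarrow> xderiv m y \<noteq> 0"
    and Z: "open Z" "z \<in> Z" and k: "smooth_curve Z k" and k': "\<And>y. y \<in> Z \<Longrightarrow> xderiv k y \<noteq> 0"
    and eq: "jet (Suc n) m x = jet (Suc n) k z"
  shows "jet n (cone_lift m) x = jet n (cone_lift k) z"
proof (rule jet_vecI[OF Y(1) smooth_curve_cone_lift[OF Y(1) m m'] Y(2)
      Z(1) smooth_curve_cone_lift[OF Z(1) k k'] Z(2)])
  fix i :: 4
  note sm = smooth_curve_nth[OF Y(1) m] smooth_curve_nth[OF Y(1) smooth_curve_xderiv[OF m]]
    smooth_curve_nth[OF Z(1) k] smooth_curve_nth[OF Z(1) smooth_curve_xderiv[OF k]]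
  have eq0: "jet n m x = jet n k z" using eq by (meson jet_eq_mono le_SucI order_refl)
  have eq': "jet n (xderiv m) x = jet n (xderiv k) z" using eq by (simp add: jet_Suc)
  note j = jet_nth[OF Y(1) m Y(2) Z(1) k Z(2) eq0]
    jet_nth[OF Y(1) smooth_curve_xderiv[OF m] Y(2) Z(1) smooth_curve_xderiv[OF k] Z(2) eq']
  have p: "smooth_curve Y (\<lambda>y. speed_sq m y powr (-1/2))"
    by (intro smooth_curve_powr smooth_curve_add smooth_curve_mult Y sm speed_sq_pos m')
  have p': "smooth_curve Z (\<lambda>y. speed_sq k y powr (-1/2))"
    by (intro smooth_curve_powr smooth_curve_add smooth_curve_mult Z sm speed_sq_pos k')
  have q: "jet n (\<lambda>y. speed_sq m y powr (-1/2)) x = jet n (\<lambda>y. speed_sq k y powr (-1/2)) z"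
    by (intro jet_powr[OF Y Z] jet_add[OF Y Z] jet_mult[OF Y Z] smooth_curve_add smooth_curve_mult
        Y Z sm speed_sq_pos m' k' j)
  have "jet n (\<lambda>y. speed_sq m y powr (-1/2) * ((m y $ 1 * m y $ 1 + m y $ 2 * m y $ 2) * (1/2))) x
      = jet n (\<lambda>y. speed_sq k y powr (-1/2) * ((k y $ 1 * k y $ 1 + k y $ 2 * k y $ 2) * (1/2))) z"
    "jet n (\<lambda>y. speed_sq m y powr (-1/2) * m y $ l) x
      = jet n (\<lambda>y. speed_sq k y powr (-1/2) * k y $ l) z" for l
    by (intro p p' q jet_add[OF Y Z] jet_mult[OF Y Z] jet_const smooth_curve_add smooth_curve_mult
        smooth_curve_const Y Z sm j)+
  note r = this
  have l: "jet n (\<lambda>y. cone_lift m y $ i) x = jet n (\<lambda>y. cone_lift k y $ i) z"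
    if "\<And>y. y \<in> Y \<Longrightarrow> cone_lift m y $ i = g y" "\<And>y. y \<in> Z \<Longrightarrow> cone_lift k y $ i = h y"
      "jet n g x = jet n h z" for g h i
    using jet_cong[of Y x "\<lambda>y. cone_lift m y $ i" g n, OF Y that(1)]
      jet_cong[of Z z "\<lambda>y. cone_lift k y $ i" h n, OF Z that(2)] that(3) by simp
  have "jet n (\<lambda>y. cone_lift m y $ 0) x = jet n (\<lambda>y. cone_lift k y $ 0) z"
    by (rule l[OF cone_lift_nth(1)[OF m'] cone_lift_nth(1)[OF k'] r(1)])
  moreover have "jet n (\<lambda>y. cone_lift m y $ 1) x = jet n (\<lambda>y. cone_lift k y $ 1) z"
    by (rule l[OF cone_lift_nth(2)[OF m'] cone_lift_nth(2)[OF k'] r(2)])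
  moreover have "jet n (\<lambda>y. cone_lift m y $ 2) x = jet n (\<lambda>y. cone_lift k y $ 2) z"
    by (rule l[OF cone_lift_nth(3)[OF m'] cone_lift_nth(3)[OF k'] r(2)])
  moreover have "jet n (\<lambda>y. cone_lift m y $ 3) x = jet n (\<lambda>y. cone_lift k y $ 3) z"
    by (rule l[OF cone_lift_nth(4)[OF m'] cone_lift_nth(4)[OF k'] q])
  ultimately show "jet n (\<lambda>y. cone_lift m y $ i) x = jet n (\<lambda>y. cone_lift k y $ i) z"
    using exhaust_coords[of i] by (elim disjE) simp_all
qed

lemma jet_Proj:
  assumes Y: "open Y" "x \<in> Y" and c: "smooth_curve Y c" and c3: "\<And>y. y \<in> Y \<Longrightarrow> c y $ 3 \<noteq> 0"
    and Z: "open Z" "z \<in> Z" and k: "smooth_curve Z k" and k3: "\<And>y. y \<in> Z \<Longrightarrow> k y $ 3 \<noteq> 0"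
    and eq: "jet n c x = jet n k z"
  shows "jet n (\<lambda>y. Proj (c y)) x = jet n (\<lambda>y. Proj (k y)) z"
proof (rule jet_vecI[OF Y(1) smooth_curve_Proj[OF Y(1) c c3] Y(2)
      Z(1) smooth_curve_Proj[OF Z(1) k k3] Z(2)])
  fix i :: 2
  have "jet n (\<lambda>y. c y $ l / c y $ 3) x = jet n (\<lambda>y. k y $ l / k y $ 3) z" for l
    by (intro jet_divide[OF Y Z] smooth_curve_nth Y Z c k c3 k3 jet_nth[OF Y(1) c Y(2) Z(1) k Z(2) eq])
  then show "jet n (\<lambda>y. Proj (c y) $ i) x = jet n (\<lambda>y. Proj (k y) $ i) z"
    using exhaust_2[of i] by auto
qed

lemma cone_lift_3_pos: "xderiv m x \<noteq> 0 \<Longrightarrow> cone_lift m x $ 3 > 0"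
  by (simp add: cone_lift_def)

lemma cone_lift_light_cone: "cone_lift m x \<in> light_cone"
  by (simp add: cone_lift_def Lift0_light_cone)

lemma Proj_cone_lift: "xderiv m x \<noteq> 0 \<Longrightarrow> Proj (cone_lift m x) = m x"
  by (simp add: cone_lift_def Proj_scaled_Lift0)

lemma normJ_cone_lift:
  assumes Y: "open Y" and m: "smooth_curve Y m" and m': "\<And>y. y \<in> Y \<Longrightarrow> xderiv m y \<noteq> 0"
    and x: "x \<in> Y"
  shows "normJ (xderiv (cone_lift m) x) = 1"
proof -
  have "xderiv (\<lambda>y. Proj (cone_lift m y)) x = xderiv m x"
    by (rule xderiv_cong[OF Y x]) (simp add: Proj_cone_lift m')
  moreover have "cone_lift m y $ 3 \<noteq> 0" if "y \<in> Y" for y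
    using cone_lift_3_pos[OF m'[OF that]] by simp
  note cone_curve_derivative(5)[OF Y smooth_curve_cone_lift[OF Y m m'] cone_lift_light_cone this x]
  moreover have "cone_lift m x $ 3 = 1 / norm (xderiv m x)"
    by (simp add: cone_lift_def)
  ultimately show ?thesis
    using m'[OF x] by simp
qed

text \<open>The arc-length condition prescribes the scaling factor \<open>u\<^sub>3\<close> up to its sign.\<close>

lemma unit_speed_eq_cone_lift:
  assumes Y: "open Y" and c: "smooth_curve Y c"
    and cone: "\<And>y. y \<in> Y \<Longrightarrow> c y \<in> light_cone" and c3: "\<And>y. y \<in> Y \<Longrightarrow> c y $ 3 \<noteq> 0"
    and unit: "\<And>y. y \<in> Y \<Longrightarrow> normJ (xderiv c y) = 1" and x: "x \<in> Y"
  shows "xderiv (\<lambda>y. Proj (c y)) x \<noteq> 0"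
    and "c x = sgn (c x $ 3) *\<^sub>R cone_lift (\<lambda>y. Proj (c y)) x"
proof -
  let ?m = "\<lambda>y. Proj (c y)"
  have *: "\<bar>c x $ 3\<bar> * norm (xderiv ?m x) = 1"
    using cone_curve_derivative(5)[OF Y c cone c3 x] unit[OF x] by simp
  then show "xderiv (\<lambda>y. Proj (c y)) x \<noteq> 0" by auto
  have "c x $ 3 = sgn (c x $ 3) * (1 / norm (xderiv ?m x))"
    using * c3[OF x] \<open>xderiv ?m x \<noteq> 0\<close>
    by (cases "c x $ 3 > 0") (auto simp: field_simps sgn_if)
  then have "c x $ 3 *\<^sub>R Lift0 (?m x) = (sgn (c x $ 3) * (1 / norm (xderiv ?m x))) *\<^sub>R Lift0 (?m x)"
    by simp
  then show "c x = sgn (c x $ 3) *\<^sub>R cone_lift (\<lambda>y. Proj (c y)) x"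
    using light_cone_eq_scaled_Lift0[OF cone[OF x] c3[OF x]] by (simp add: cone_lift_def)
qed

section \<open>The evolution matrix in terms of the projected curve\<close>

lemma matrix_inv_eqI:
  fixes A B :: "real^'n^'n"
  assumes "A ** B = mat 1"
  shows "matrix_inv A = B"
proof -
  have BA: "B ** A = mat 1" using assms by (simp add: matrix_left_right_inverse)
  have "A ** matrix_inv A = mat 1 \<and> matrix_inv A ** A = mat 1"
    unfolding matrix_inv_def by (rule someI[of _ B]) (simp add: assms BA)
  then have inv: "matrix_inv A ** A = mat 1" by blast
  have "matrix_inv A = matrix_inv A ** (A ** B)" using assms by simp
  also have "\<dots> = matrix_inv A ** A ** B" by (rule matrix_mul_assoc)
  finally show ?thesis using inv by simp
qed

text \<open>With \<open>u = p \<cdot> Lift0 m\<close> the conformal frame \<open>A\<close> is a rotation, \<open>\<xi>\<close> consists, up to scaling, of the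
  logarithmic derivative of \<open>p\<close> and the curvature of the plane curve \<open>m\<close>, and the evolution matrix splits into a
  motion of \<open>m\<close> by \<open>r\<^sub>1, r\<^sub>2\<close> and a scaling of \<open>p\<close>.\<close>

lemma cone_mat_projected:
  fixes r1 r2 r3 :: real
  assumes Y: "open Y" and c: "smooth_curve Y c" and cone: "\<And>y. y \<in> Y \<Longrightarrow> c y \<in> upper_cone"
    and x: "x \<in> Y" and reg: "normJ (xderiv c x) \<noteq> 0"
  defines "m \<equiv> \<lambda>y. Proj (c y)" and "e \<equiv> normJ (xderiv c x)"
  defines "p \<equiv> c x $ 3" and "p' \<equiv> xderiv c x $ 3"
    and "a \<equiv> xderiv m x" and "b \<equiv> xderiv (xderiv m) x"
  defines "\<pi> \<equiv> p * (r3 + p' / (p * e) * r1 + p\<^sup>2 / e ^ 3 * (a $ 1 * b $ 2 - a $ 2 * b $ 1) * r2)"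
  shows "p > 0" and "e > 0" and "e = p * norm a" and "e\<^sup>2 = p\<^sup>2 * ((a $ 1)\<^sup>2 + (a $ 2)\<^sup>2)"
    and "cone_mat c x *v vector [r1, r2, r3] = vector
      [\<pi> * m x $ 1 + p * ((a $ 1 * r1 - a $ 2 * r2) / e),
       \<pi> * m x $ 2 + p * ((a $ 2 * r1 + a $ 1 * r2) / e), \<pi>]"
proof -
  have lc: "c y \<in> light_cone" and c3: "c y $ 3 \<noteq> 0" if "y \<in> Y" for y
    using cone[OF that] by (auto simp: upper_cone_def)
  show p: "p > 0" using cone[OF x] by (simp add: upper_cone_def p_def)
  show eN: "e = p * norm a"
    using cone_curve_derivative(5)[OF Y c lc c3 x] p by (simp add: e_def p_def a_def m_def)
  then show e: "e > 0" using reg p by (simp add: e_def zero_less_mult_iff)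
  show e2: "e\<^sup>2 = p\<^sup>2 * ((a $ 1)\<^sup>2 + (a $ 2)\<^sup>2)"
    by (simp add: eN power_mult_distrib norm_real2)
  have m: "smooth_curve Y m" unfolding m_def by (rule smooth_curve_Proj[OF Y c c3])
  have u: "c x $ 1 = p * m x $ 1" "c x $ 2 = p * m x $ 2"
    using p by (simp_all add: m_def p_def)
  have v: "xderiv c x $ 1 = p' * m x $ 1 + p * a $ 1" "xderiv c x $ 2 = p' * m x $ 2 + p * a $ 2"
    using cone_curve_derivative(2,3)[OF Y c lc c3 x] by (simp_all add: m_def p_def p'_def a_def)
  \<comment> \<open>The second derivative, by differentiating the formula for the first one.\<close>
  define p'' where "p'' = xderiv (xderiv c) x $ 3"
  have hc: "((\<lambda>y. c y $ i) has_vector_derivative xderiv c x $ i) (at x)"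
    and hc': "((\<lambda>y. xderiv c y $ i) has_vector_derivative xderiv (xderiv c) x $ i) (at x)" for i
    by (rule bounded_linear.has_vector_derivative[OF bounded_linear_vec_nth]
        smooth_curve_has_derivative[OF c x]
        smooth_curve_has_derivative[OF smooth_curve_xderiv[OF c] x])+
  have hm: "((\<lambda>y. m y $ j) has_vector_derivative a $ j) (at x)"
    and hm': "((\<lambda>y. xderiv m y $ j) has_vector_derivative b $ j) (at x)" for j
    unfolding a_def b_def
    by (rule bounded_linear.has_vector_derivative[OF bounded_linear_vec_nth]
        smooth_curve_has_derivative[OF m x]
        smooth_curve_has_derivative[OF smooth_curve_xderiv[OF m] x])+
  have w: "xderiv (xderiv c) x $ i = p'' * m x $ j + 2 * p' * a $ j + p * b $ j"
    if eq: "\<And>y. y \<in> Y \<Longrightarrow> xderiv c y $ i = xderiv c y $ 3 * m y $ j + c y $ 3 * xderiv m y $ j" for i j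
  proof -
    have "((\<lambda>y. xderiv c y $ 3 * m y $ j + c y $ 3 * xderiv m y $ j) has_vector_derivative
      (p'' * m x $ j + xderiv c x $ 3 * a $ j) + (xderiv c x $ 3 * xderiv m x $ j + c x $ 3 * b $ j)) (at x)"
      unfolding p''_def by (intro has_vector_derivative_add has_vector_derivative_times hc hc' hm hm')
    then have "((\<lambda>y. xderiv c y $ i) has_vector_derivative
      (p'' * m x $ j + xderiv c x $ 3 * a $ j) + (xderiv c x $ 3 * xderiv m x $ j + c x $ 3 * b $ j)) (at x)"
      by (rule has_vector_derivative_transform_within_open[OF _ Y x]) (simp add: eq)
    from vector_derivative_unique_at[OF hc' this] show ?thesis
      by (simp add: p'_def p_def a_def algebra_simps)
  qed
  have w: "xderiv (xderiv c) x $ 1 = p'' * m x $ 1 + 2 * p' * a $ 1 + p * b $ 1"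
    "xderiv (xderiv c) x $ 2 = p'' * m x $ 2 + 2 * p' * a $ 2 + p * b $ 2"
    using w[of 1 1] w[of 2 2] cone_curve_derivative(2,3)[OF Y c lc c3] by (simp_all add: m_def)
  define q where "q = p / e"
  have A: "A_mat c x = vector [vector [q * a $ 1, q * a $ 2], vector [- (q * a $ 2), q * a $ 1]]"
    using p e unfolding A_mat_def Let_def u v p_def[symmetric] p'_def[symmetric] e_def[symmetric] q_def
    by (simp add: vec_eq_iff forall_2 field_simps)
  have "q * q * (a $ 1 * a $ 1 + a $ 2 * a $ 2) = e\<^sup>2 / (e * e)"
    unfolding e2 by (simp add: q_def power2_eq_square)
  then have "q * q * (a $ 1 * a $ 1 + a $ 2 * a $ 2) = 1"
    using e by (simp add: power2_eq_square)
  then have inv: "matrix_inv (A_mat c x) =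
      vector [vector [q * a $ 1, - (q * a $ 2)], vector [q * a $ 2, q * a $ 1]]"
    unfolding A by (intro matrix_inv_eqI)
      (simp add: vec_eq_iff forall_2 matrix_matrix_mult_def sum_2 mat_def algebra_simps)
  define d where "d = a $ 1 * b $ 2 - a $ 2 * b $ 1"
  have "det (vector [local_coords (c x), local_coords (xderiv c x),
      local_coords (xderiv (xderiv c) x)] :: real^3^3) = p ^ 3 * d"
    unfolding det_3 local_coords_def d_def
    by (simp add: u v w p_def[symmetric] p'_def[symmetric] p''_def[symmetric] algebra_simps
        power3_eq_cube)
  then have xi: "xi c x $ 1 = - (p' / (p * e))" "xi c x $ 2 = - (p\<^sup>2 / e ^ 3 * d)"
    using p unfolding xi_def Let_def p_def[symmetric] p'_def[symmetric] e_def[symmetric]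
    by (simp_all add: power2_eq_square power3_eq_cube)
  have \<pi>: "\<pi> = p * (r3 - (xi c x $ 1 * r1 + xi c x $ 2 * r2))"
    unfolding xi \<pi>_def d_def by (simp add: algebra_simps)
  show "cone_mat c x *v vector [r1, r2, r3] = vector
      [\<pi> * m x $ 1 + p * ((a $ 1 * r1 - a $ 2 * r2) / e),
       \<pi> * m x $ 2 + p * ((a $ 2 * r1 + a $ 1 * r2) / e), \<pi>]"
    unfolding \<pi> cone_mat_def Let_def inv hat_def u p_def[symmetric]
    by (simp add: vec_eq_iff forall_3 matrix_vector_mult_def sum_3 q_def diff_divide_distrib
        add_divide_distrib algebra_simps)
qed

section \<open>Transfer of differential invariants\<close>

text \<open>A quantity of curves that is determined by their jets becomes a function on lists by evaluating it on
  any curve with the given jet.\<close>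

lemma function_of_jet_exists:
  assumes "\<And>c x k z. P c x \<Longrightarrow> P k z \<Longrightarrow> jet n c x = jet n k z \<Longrightarrow> K c x = K k z"
  obtains F where "\<And>c x. P c x \<Longrightarrow> F (jet n c x) = K c x"
proof
  fix c x assume c: "P c x"
  define Q where "Q r \<longleftrightarrow> (\<exists>k z. P k z \<and> jet n k z = jet n c x \<and> r = K k z)" for r
  have "Q (Eps Q)"
    by (rule someI[of Q "K c x"]) (use c in \<open>auto simp: Q_def\<close>)
  then obtain k z where "P k z" "jet n k z = jet n c x" "Eps Q = K k z"
    by (auto simp: Q_def)
  then have "Eps Q = K c x" using assms c by metis
  then show "(\<lambda>l. SOME r. \<exists>k z. P k z \<and> jet n k z = l \<and> r = K k z) (jet n c x) = K c x"
    by (simp add: Q_def[abs_def])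
qed

definition regular_sphere_germ :: "(real \<Rightarrow> real^2) \<Rightarrow> real \<Rightarrow> bool" where
  "regular_sphere_germ m x \<longleftrightarrow>
     (\<exists>Y. open Y \<and> x \<in> Y \<and> smooth_curve Y m \<and> (\<forall>y\<in>Y. xderiv m y \<noteq> 0))"

definition regular_cone_germ :: "(real \<Rightarrow> real^4) \<Rightarrow> real \<Rightarrow> bool" where
  "regular_cone_germ c x \<longleftrightarrow>
     (\<exists>Y. open Y \<and> x \<in> Y \<and> smooth_curve Y c \<and> (\<forall>y\<in>Y. c y \<in> light_cone \<and> normJ (xderiv c y) \<noteq> 0))"

lemma smooth_curve_matrix:
  "open Y \<Longrightarrow> smooth_curve Y c \<Longrightarrow> smooth_curve Y (\<lambda>y. \<Theta> *v c y)" for \<Theta> :: "real^4^4"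
  by (rule smooth_curve_linear[OF matrix_vector_mul_bounded_linear])

lemma xderiv_matrix:
  "open Y \<Longrightarrow> smooth_curve Y c \<Longrightarrow> x \<in> Y \<Longrightarrow> xderiv (\<lambda>y. \<Theta> *v c y) x = \<Theta> *v xderiv c x"
  for \<Theta> :: "real^4^4"
  using xderiv_iter_linear[OF matrix_vector_mul_bounded_linear, of Y c x 1 \<Theta>] by simp

lemma matrix_scaleR: "\<Theta> *v (a *\<^sub>R v) = a *\<^sub>R (\<Theta> *v v)" for \<Theta> :: "real^4^4"
  by (simp add: vec_eq_iff matrix_vector_mult_def sum_distrib_left mult_ac)

lemma open_component_nonzero:
  fixes c :: "real \<Rightarrow> real^'n"
  assumes "open Y" "smooth_curve Y c"
  shows "open {y \<in> Y. c y $ i \<noteq> 0}"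
proof -
  have "open (Y \<inter> (\<lambda>y. c y $ i) -` (- {0}))"
    by (rule continuous_open_preimage[OF smooth_curve_continuous[OF smooth_curve_nth[OF assms]]
          assms(1)]) auto
  moreover have "{y \<in> Y. c y $ i \<noteq> 0} = Y \<inter> (\<lambda>y. c y $ i) -` (- {0})" by auto
  ultimately show ?thesis by simp
qed

text \<open>An isometry \<open>\<Theta>\<close> carries the unit speed lift of \<open>m\<close> to a unit speed curve over \<open>\<Theta> \<cdot> m\<close>. By
  uniqueness that curve is the lift of \<open>\<Theta> \<cdot> m\<close> up to a locally constant sign, and the sign can be
  absorbed in \<open>\<Theta>\<close> because \<open>- \<Theta>\<close> is an isometry as well. So an invariant of the lift, as a
  function of \<open>m\<close>, is an invariant; the order goes up by one because the lift involves \<open>m'\<close>.\<close>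

lemma cone_invariant_to_sphere:
  assumes inv: "cone_invariant n I"
  shows "\<exists>G. sphere_invariant (Suc n) G \<and>
    (\<forall>m x. regular_sphere_germ m x \<longrightarrow> G (jet (Suc n) m x) = I (jet n (cone_lift m) x))"
proof -
  obtain G where G: "\<And>m x. regular_sphere_germ m x \<Longrightarrow> G (jet (Suc n) m x) = I (jet n (cone_lift m) x)"
  proof (rule function_of_jet_exists[of regular_sphere_germ "Suc n" "\<lambda>m x. I (jet n (cone_lift m) x)"])
    fix m x k z
    assume "regular_sphere_germ m x" "regular_sphere_germ k z" "jet (Suc n) m x = jet (Suc n) k z"
    then show "I (jet n (cone_lift m) x) = I (jet n (cone_lift k) z)"
      unfolding regular_sphere_germ_def using jet_cone_lift by metis
  qed blast
  have "G (jet (Suc n) (\<lambda>y. sphere_act \<Theta> (c y)) x) = G (jet (Suc n) c x)"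
    if \<Theta>: "\<Theta> \<in> O31" and Y: "open Y" and c: "smooth_curve Y c"
      and reg: "\<And>y. y \<in> Y \<Longrightarrow> xderiv c y \<noteq> 0 \<and> (\<Theta> *v Lift0 (c y)) $ 3 \<noteq> 0" and x: "x \<in> Y"
    for \<Theta> Y c x
  proof -
    have c': "xderiv c y \<noteq> 0" if "y \<in> Y" for y using reg[OF that] by blast
    let ?k = "\<lambda>y. sphere_act \<Theta> (c y)"
    define w where "w = (\<lambda>y. \<Theta> *v cone_lift c y)"
    have u: "smooth_curve Y (cone_lift c)" by (rule smooth_curve_cone_lift[OF Y c c'])
    have w: "smooth_curve Y w" unfolding w_def by (rule smooth_curve_matrix[OF Y u])
    have w_eq: "w y = (1 / norm (xderiv c y)) *\<^sub>R (\<Theta> *v Lift0 (c y))" for y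
      by (simp add: w_def cone_lift_def matrix_scaleR)
    have w3: "w y $ 3 \<noteq> 0" if "y \<in> Y" for y
      using reg[OF that] by (simp add: w_eq)
    have wL: "w y \<in> light_cone" for y
      by (simp add: w_def light_cone_O31 \<Theta> cone_lift_light_cone)
    have unit: "normJ (xderiv w y) = 1" if "y \<in> Y" for y
      unfolding w_def xderiv_matrix[OF Y u that] normJ_O31[OF \<Theta>]
      by (rule normJ_cone_lift[OF Y c c' that])
    have k_eq: "(\<lambda>y. Proj (w y)) y = ?k y" if "y \<in> Y" for y
      using c'[OF that] by (simp add: w_eq sphere_act_def Proj_scaleR)
    have k: "smooth_curve Y ?k"
      by (rule smooth_curve_cong[OF Y, THEN iffD1, OF k_eq smooth_curve_Proj[OF Y w w3]])
    have kx: "xderiv (\<lambda>y. Proj (w y)) y = xderiv ?k y" if "y \<in> Y" for y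
      by (rule xderiv_cong[OF Y that k_eq])
    have k': "xderiv ?k y \<noteq> 0" if "y \<in> Y" for y
      using unit_speed_eq_cone_lift(1)[OF Y w wL w3 unit that] kx[OF that] by simp
    have wk: "w y = sgn (w y $ 3) *\<^sub>R cone_lift ?k y" if "y \<in> Y" for y
      using unit_speed_eq_cone_lift(2)[OF Y w wL w3 unit that] kx[OF that] k_eq[OF that]
      by (simp add: cone_lift_def)
    define \<epsilon> where "\<epsilon> = sgn (w x $ 3)"
    define \<Phi> where "\<Phi> = \<epsilon> *\<^sub>R \<Theta>"
    have \<epsilon>: "\<epsilon> = 1 \<or> \<epsilon> = - 1" using w3[OF x] by (auto simp: \<epsilon>_def sgn_if)
    then have \<Phi>: "\<Phi> \<in> O31" using \<Theta> uminus_O31[OF \<Theta>] by (auto simp: \<Phi>_def)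
    have Z: "open (Y \<inter> (\<lambda>y. \<epsilon> * w y $ 3) -` {0<..})"
      by (rule continuous_open_preimage[OF _ Y])
        (intro continuous_intros smooth_curve_continuous[OF smooth_curve_nth[OF Y w]], simp)
    have "jet n (cone_lift ?k) x = jet n (\<lambda>y. \<Phi> *v cone_lift c y) x"
    proof (rule jet_cong[OF Z])
      show "x \<in> Y \<inter> (\<lambda>y. \<epsilon> * w y $ 3) -` {0<..}"
        using x w3[OF x] by (auto simp: \<epsilon>_def sgn_if)
      fix y assume y: "y \<in> Y \<inter> (\<lambda>y. \<epsilon> * w y $ 3) -` {0<..}"
      then have "sgn (w y $ 3) = \<epsilon>" using \<epsilon> by (auto simp: sgn_if)
      then have "w y = \<epsilon> *\<^sub>R cone_lift ?k y" using wk[of y] y by simp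
      then have "\<epsilon> *\<^sub>R w y = cone_lift ?k y" using \<epsilon> by auto
      then show "cone_lift ?k y = \<Phi> *v cone_lift c y"
        by (simp add: w_def \<Phi>_def scaleR_matrix_vector_assoc)
    qed
    moreover have "I (jet n (\<lambda>y. \<Phi> *v cone_lift c y) x) = I (jet n (cone_lift c) x)"
      using inv \<Phi> Y u x cone_lift_light_cone normJ_cone_lift[OF Y c c']
      unfolding cone_invariant_def by (metis zero_neq_one)
    moreover have "regular_sphere_germ ?k x" "regular_sphere_germ c x"
      unfolding regular_sphere_germ_def using Y x k k' c c' by blast+
    ultimately show ?thesis by (simp add: G)
  qed
  then have "sphere_invariant (Suc n) G" unfolding sphere_invariant_def by blast
  then show ?thesis using G by (intro exI[of _ G]) simp
qed

text \<open>The chart of the sphere misses the null line \<open>u\<^sub>3 = 0\<close>, on which only \<open>u\<^sub>0\<close> does not vanish; exchanging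
  \<open>u\<^sub>0\<close> and \<open>u\<^sub>3\<close> brings that line into the chart.\<close>

definition swap03 :: "real^4^4" where
  "swap03 = (\<chi> i j. if (i = 0 \<and> j = 3) \<or> (i = 3 \<and> j = 0) \<or> (i = j \<and> (i = 1 \<or> i = 2)) then 1 else 0)"

lemma swap03_O31: "swap03 \<in> O31"
  by (simp add: O31_def vec_eq_iff forall_coords matrix_matrix_mult_def sum_coords transpose_def
      J_def swap03_def)

lemma swap03_involution: "swap03 ** swap03 = mat 1"
  by (simp add: vec_eq_iff forall_coords matrix_matrix_mult_def sum_coords mat_def swap03_def)

lemma swap03_3: "(swap03 *v v) $ 3 = v $ 0"
  by (simp add: matrix_vector_mult_def sum_coords swap03_def)

text \<open>At a zero of \<open>c\<close> the second derivative of \<open>\<langle>c, c\<rangle> = 0\<close> reads \<open>2 \<langle>c', c'\<rangle> = 0\<close>.\<close>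

lemma regular_cone_germ_nonzero:
  assumes "regular_cone_germ c x"
  shows "c x \<noteq> 0"
proof
  assume zero: "c x = 0"
  obtain Y where Y: "open Y" and x: "x \<in> Y" and c: "smooth_curve Y c"
    and cone: "\<And>y. y \<in> Y \<Longrightarrow> c y \<in> light_cone" and reg: "\<And>y. y \<in> Y \<Longrightarrow> normJ (xderiv c y) \<noteq> 0"
    using assms unfolding regular_cone_germ_def by blast
  let ?c = "\<lambda>i y. c y $ i" and ?d = "\<lambda>i y. xderiv c y $ i"
  have hc: "(?c i has_vector_derivative ?d i y) (at y)"
    and hd: "(?d i has_vector_derivative xderiv (xderiv c) y $ i) (at y)" if "y \<in> Y" for i y
    by (rule bounded_linear.has_vector_derivative[OF bounded_linear_vec_nth]
        smooth_curve_has_derivative[OF c that]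
        smooth_curve_has_derivative[OF smooth_curve_xderiv[OF c] that])+
  let ?e = "xderiv (xderiv c) x"
  have "innerJ (c y) (xderiv c y) = 0" if y: "y \<in> Y" for y
  proof -
    have "((\<lambda>y. ?c 1 y * ?c 1 y + ?c 2 y * ?c 2 y + (-2) * (?c 0 y * ?c 3 y)) has_vector_derivative
        (?d 1 y * ?c 1 y + ?c 1 y * ?d 1 y) + (?d 2 y * ?c 2 y + ?c 2 y * ?d 2 y)
        + (0 * (?c 0 y * ?c 3 y) + (-2) * (?d 0 y * ?c 3 y + ?c 0 y * ?d 3 y))) (at y)"
      by (intro has_vector_derivative_add has_vector_derivative_times has_vector_derivative_const hc y)
    moreover have "((\<lambda>y. ?c 1 y * ?c 1 y + ?c 2 y * ?c 2 y + (-2) * (?c 0 y * ?c 3 y))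
        has_vector_derivative 0) (at y)"
      by (rule has_vector_derivative_transform_within_open[OF has_vector_derivative_const[of 0] Y y])
        (use cone in \<open>simp add: light_cone_iff power2_eq_square\<close>)
    ultimately show ?thesis
      using vector_derivative_unique_at by (fastforce simp: innerJ_coords algebra_simps)
  qed
  then have eq: "0 = ?c 1 y * ?d 1 y + ?c 2 y * ?d 2 y + (-1) * (?c 0 y * ?d 3 y + ?c 3 y * ?d 0 y)"
    if "y \<in> Y" for y
    using that by (fastforce simp: innerJ_coords algebra_simps)
  have "((\<lambda>y. ?c 1 y * ?d 1 y + ?c 2 y * ?d 2 y + (-1) * (?c 0 y * ?d 3 y + ?c 3 y * ?d 0 y))
      has_vector_derivative (?d 1 x * ?d 1 x + ?c 1 x * ?e $ 1) + (?d 2 x * ?d 2 x + ?c 2 x * ?e $ 2)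
        + (0 * (?c 0 x * ?d 3 x + ?c 3 x * ?d 0 x) + (-1) * ((?d 0 x * ?d 3 x + ?c 0 x * ?e $ 3)
        + (?d 3 x * ?d 0 x + ?c 3 x * ?e $ 0)))) (at x)"
    by (intro has_vector_derivative_add has_vector_derivative_times has_vector_derivative_const hc hd x)
  moreover have "((\<lambda>y. ?c 1 y * ?d 1 y + ?c 2 y * ?d 2 y + (-1) * (?c 0 y * ?d 3 y + ?c 3 y * ?d 0 y))
      has_vector_derivative 0) (at x)"
    by (rule has_vector_derivative_transform_within_open[OF has_vector_derivative_const[of 0] Y x eq])
  ultimately have "innerJ (xderiv c x) (xderiv c x) = 0"
    using vector_derivative_unique_at zero by (fastforce simp: innerJ_coords algebra_simps)
  then show False using reg[OF x] by (simp add: normJ_def)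
qed

lemma regular_cone_germ_O31:
  assumes "\<Theta> \<in> O31" "regular_cone_germ c x"
  shows "regular_cone_germ (\<lambda>y. \<Theta> *v c y) x"
proof -
  obtain Y where Y: "open Y" and x: "x \<in> Y" and c: "smooth_curve Y c"
    and cone: "\<forall>y\<in>Y. c y \<in> light_cone \<and> normJ (xderiv c y) \<noteq> 0"
    using assms unfolding regular_cone_germ_def by blast
  then show ?thesis
    unfolding regular_cone_germ_def
    by (intro exI[of _ Y])
      (simp add: smooth_curve_matrix xderiv_matrix[OF Y c] light_cone_O31 normJ_O31 assms(1))
qed

text \<open>Up to scaling, \<open>c\<close> is \<open>Lift0\<close> of its projection; so applying \<open>\<Theta>\<close> to \<open>c\<close> amounts to the
  conformal action on the projection.\<close>

lemma sphere_invariant_of_projections: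
  assumes inv: "sphere_invariant n I" and germ: "regular_cone_germ c x" and \<Theta>: "\<Theta> \<in> O31"
    and c3: "c x $ 3 \<noteq> 0" and \<Theta>c3: "(\<Theta> *v c x) $ 3 \<noteq> 0"
  shows "I (jet n (\<lambda>y. Proj (\<Theta> *v c y)) x) = I (jet n (\<lambda>y. Proj (c y)) x)"
proof -
  obtain Y where Y: "open Y" and x: "x \<in> Y" and c: "smooth_curve Y c"
    and cone: "\<And>y. y \<in> Y \<Longrightarrow> c y \<in> light_cone" and reg: "\<And>y. y \<in> Y \<Longrightarrow> normJ (xderiv c y) \<noteq> 0"
    using germ unfolding regular_cone_germ_def by blast
  define Z where "Z = {y \<in> Y. c y $ 3 \<noteq> 0} \<inter> {y \<in> Y. (\<Theta> *v c y) $ 3 \<noteq> 0}"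
  have Z: "open Z"
    unfolding Z_def by (intro open_Int open_component_nonzero smooth_curve_matrix Y c)
  have xZ: "x \<in> Z" using x c3 \<Theta>c3 by (simp add: Z_def)
  have ZY: "Z \<subseteq> Y" by (auto simp: Z_def)
  have cZ: "smooth_curve Z c" by (rule smooth_curve_subset[OF c ZY])
  let ?m = "\<lambda>y. Proj (c y)"
  have Z3: "c y $ 3 \<noteq> 0" and cone': "c y \<in> light_cone" if "y \<in> Z" for y
    using that cone by (auto simp: Z_def)
  have m: "smooth_curve Z ?m" by (rule smooth_curve_Proj[OF Z cZ Z3])
  have m': "xderiv ?m y \<noteq> 0" if "y \<in> Z" for y
    using cone_curve_derivative(5)[OF Z cZ cone' Z3 that] reg[of y] that ZY by auto
  have \<Theta>eq: "\<Theta> *v c y = c y $ 3 *\<^sub>R (\<Theta> *v Lift0 (?m y))" if "y \<in> Z" for y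
    using arg_cong[OF light_cone_eq_scaled_Lift0[OF cone'[OF that] Z3[OF that]], of "(*v) \<Theta>"]
    by (simp add: matrix_scaleR)
  have act: "sphere_act \<Theta> (?m y) = Proj (\<Theta> *v c y)" if "y \<in> Z" for y
    unfolding \<Theta>eq[OF that] by (simp add: sphere_act_def Proj_scaleR Z3[OF that])
  have nz: "(\<Theta> *v Lift0 (?m y)) $ 3 \<noteq> 0" if "y \<in> Z" for y
    using that \<Theta>eq[OF that] by (auto simp: Z_def)
  have "I (jet n (\<lambda>y. sphere_act \<Theta> (?m y)) x) = I (jet n ?m x)"
    using inv \<Theta> Z m m' nz xZ unfolding sphere_invariant_def by blast
  moreover have "jet n (\<lambda>y. sphere_act \<Theta> (?m y)) x = jet n (\<lambda>y. Proj (\<Theta> *v c y)) x"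
    by (rule jet_cong[OF Z xZ act])
  ultimately show ?thesis by simp
qed

text \<open>Conversely an invariant of the projection is an invariant of the curve in the cone. Where \<open>u\<^sub>3 = 0\<close>
  the curve is first moved by the exchange of \<open>u\<^sub>0\<close> and \<open>u\<^sub>3\<close>; invariance on the sphere says that the result does not
  depend on which of the two charts is used.\<close>

lemma sphere_invariant_to_cone:
  assumes inv: "sphere_invariant n I"
  shows "\<exists>F. cone_invariant n F \<and> (\<forall>c x. regular_cone_germ c x \<longrightarrow> c x $ 3 \<noteq> 0 \<longrightarrow>
    F (jet n c x) = I (jet n (\<lambda>y. Proj (c y)) x))"
proof -
  define \<Phi> where "\<Phi> v = (if v $ 3 \<noteq> 0 then mat 1 else swap03)" for v :: "real^4"
  have \<Phi>: "\<Phi> v \<in> O31" "\<Phi> v ** \<Phi> v = mat 1" for v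
    by (simp_all add: \<Phi>_def mat_1_O31 swap03_O31 swap03_involution)
  have \<Phi>3: "(\<Phi> v *v v) $ 3 \<noteq> 0" if "v \<in> light_cone" "v \<noteq> 0" for v
  proof (cases "v $ 3 = 0")
    case True
    then have "v $ 1 = 0" "v $ 2 = 0"
      using that(1) sum_power2_eq_zero_iff[of "v $ 1" "v $ 2"] by (auto simp: light_cone_iff)
    then show ?thesis
      using True that(2) by (auto simp: \<Phi>_def swap03_3 vec_eq_iff forall_coords)
  qed (simp add: \<Phi>_def)
  define K where "K c x = I (jet n (\<lambda>y. Proj (\<Phi> (c x) *v c y)) x)" for c x
  have germ3: "(\<Phi> (c x) *v c x) $ 3 \<noteq> 0" if "regular_cone_germ c x" for c x
    using \<Phi>3 regular_cone_germ_nonzero[OF that] that unfolding regular_cone_germ_def by blast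
  obtain F where F: "\<And>c x. regular_cone_germ c x \<Longrightarrow> F (jet n c x) = K c x"
  proof (rule function_of_jet_exists[of regular_cone_germ n K])
    fix c x k z
    assume c: "regular_cone_germ c x" and k: "regular_cone_germ k z" and eq: "jet n c x = jet n k z"
    obtain Y where Y: "open Y" "x \<in> Y" and cY: "smooth_curve Y c"
      using c unfolding regular_cone_germ_def by blast
    obtain Z where Z: "open Z" "z \<in> Z" and kZ: "smooth_curve Z k"
      using k unfolding regular_cone_germ_def by blast
    have cx: "c x = k z" by (rule jet_eq_0[OF eq])
    let ?c = "\<lambda>y. \<Phi> (k z) *v c y" and ?k = "\<lambda>y. \<Phi> (k z) *v k y"
    have sm: "smooth_curve Y ?c" "smooth_curve Z ?k"
      by (intro smooth_curve_matrix Y Z cY kZ)+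
    have "jet n ?c x = jet n ?k z"
      by (rule jet_linear[OF matrix_vector_mul_bounded_linear Y(1) cY Y(2) Z(1) kZ Z(2) eq])
    moreover have "x \<in> {y \<in> Y. ?c y $ 3 \<noteq> 0}" "z \<in> {y \<in> Z. ?k y $ 3 \<noteq> 0}"
      using Y Z germ3[OF c] germ3[OF k] cx by auto
    moreover have "open {y \<in> Y. ?c y $ 3 \<noteq> 0}" "open {y \<in> Z. ?k y $ 3 \<noteq> 0}"
      by (intro open_component_nonzero Y Z sm)+
    moreover have "smooth_curve {y \<in> Y. ?c y $ 3 \<noteq> 0} ?c" "smooth_curve {y \<in> Z. ?k y $ 3 \<noteq> 0} ?k"
      by (rule smooth_curve_subset[OF sm(1)] smooth_curve_subset[OF sm(2)], blast)+
    ultimately have "jet n (\<lambda>y. Proj (?c y)) x = jet n (\<lambda>y. Proj (?k y)) z"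
      by (intro jet_Proj) auto
    then show "K c x = K k z" by (simp add: K_def cx)
  qed blast
  have inv_K: "K (\<lambda>y. \<Theta> *v c y) x = K c x" if \<Theta>: "\<Theta> \<in> O31" and c: "regular_cone_germ c x" for \<Theta> c x
  proof -
    let ?\<Psi> = "\<Phi> (\<Theta> *v c x)"
    let ?c = "\<lambda>y. \<Phi> (c x) *v c y"
    have \<Theta>c: "regular_cone_germ (\<lambda>y. \<Theta> *v c y) x" by (rule regular_cone_germ_O31[OF \<Theta> c])
    have eq: "(?\<Psi> ** \<Theta> ** \<Phi> (c x)) *v ?c y = ?\<Psi> *v (\<Theta> *v c y)" for y
    proof -
      have "(?\<Psi> ** \<Theta> ** \<Phi> (c x)) *v ?c y = ?\<Psi> *v (\<Theta> *v ((\<Phi> (c x) ** \<Phi> (c x)) *v c y))"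
        by (simp add: matrix_vector_mul_assoc matrix_mul_assoc)
      then show ?thesis by (simp add: \<Phi>(2))
    qed
    have "I (jet n (\<lambda>y. Proj ((?\<Psi> ** \<Theta> ** \<Phi> (c x)) *v ?c y)) x) = I (jet n (\<lambda>y. Proj (?c y)) x)"
    proof (rule sphere_invariant_of_projections[OF inv])
      show "regular_cone_germ ?c x" by (rule regular_cone_germ_O31[OF \<Phi>(1) c])
      show "?\<Psi> ** \<Theta> ** \<Phi> (c x) \<in> O31" by (intro O31_mult \<Phi>(1) \<Theta>)
      show "?c x $ 3 \<noteq> 0" by (rule germ3[OF c])
      show "((?\<Psi> ** \<Theta> ** \<Phi> (c x)) *v ?c x) $ 3 \<noteq> 0" unfolding eq by (rule germ3[OF \<Theta>c])
    qed
    then show ?thesis unfolding eq K_def .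
  qed
  have "cone_invariant n F"
    unfolding cone_invariant_def
  proof (intro ballI allI impI)
    fix \<Theta> Y c x
    assume \<Theta>: "\<Theta> \<in> O31" and x: "x \<in> Y"
      and c: "open Y \<and> smooth_curve Y c \<and> (\<forall>x\<in>Y. c x \<in> light_cone \<and> normJ (xderiv c x) \<noteq> 0)"
    then have "regular_cone_germ c x" unfolding regular_cone_germ_def by blast
    then show "F (jet n (\<lambda>y. \<Theta> *v c y) x) = F (jet n c x)"
      using inv_K[OF \<Theta>] F regular_cone_germ_O31[OF \<Theta>] by simp
  qed
  moreover have "F (jet n c x) = I (jet n (\<lambda>y. Proj (c y)) x)"
    if "regular_cone_germ c x" "c x $ 3 \<noteq> 0" for c x
    using F[OF that(1)] that(2) by (simp add: K_def \<Phi>_def)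
  ultimately show ?thesis by (intro exI[of _ F]) simp
qed

section \<open>Functions of differential invariants\<close>

text \<open>The function \<open>f\<close> is kept; each invariant is replaced by one that has the same values along the flow.\<close>

lemma function_of_invariants_transfer:
  assumes X: "open X" and r: "function_of_invariants Inv T X c r"
    and tr: "\<And>n I. Inv n I \<Longrightarrow>
      \<exists>n' I'. Inv' n' I' \<and> (\<forall>t\<in>T. \<forall>x\<in>X. I' (jet n' (c' t) x) = I (jet n (c t) x))"
  shows "function_of_invariants Inv' T X c' r"
proof -
  from r obtain d n p I D f where
    I: "\<forall>i<d. Inv (n i) (I i) \<and> (\<forall>t\<in>T. smooth_curve X (\<lambda>x. I i (jet (n i) (c t) x)))"
    and D: "open D" "smooth_vars d D f"
    and f: "\<forall>t\<in>T. \<forall>x\<in>X.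
           let y = (\<lambda>i. if i < d then (xderiv ^^ p i) (\<lambda>z. I i (jet (n i) (c t) z)) x else 0)
           in y \<in> D \<and> r t x = f y"
    unfolding function_of_invariants_def by blast
  have "\<forall>i. \<exists>q. i < d \<longrightarrow> Inv' (fst q) (snd q) \<and>
      (\<forall>t\<in>T. \<forall>x\<in>X. snd q (jet (fst q) (c' t) x) = I i (jet (n i) (c t) x))"
    using I tr by (metis fst_conv snd_conv)
  then obtain q where q: "\<And>i. i < d \<Longrightarrow> Inv' (fst (q i)) (snd (q i))"
    "\<And>i t x. i < d \<Longrightarrow> t \<in> T \<Longrightarrow> x \<in> X \<Longrightarrow>
      snd (q i) (jet (fst (q i)) (c' t) x) = I i (jet (n i) (c t) x)"
    by metis
  have sm: "smooth_curve X (\<lambda>x. snd (q i) (jet (fst (q i)) (c' t) x))" if "i < d" "t \<in> T" for i t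
    by (rule smooth_curve_cong[OF X, THEN iffD2, OF q(2)[OF that]]) (use I that in blast)+
  have eq: "(\<lambda>i. if i < d then (xderiv ^^ p i) (\<lambda>z. snd (q i) (jet (fst (q i)) (c' t) z)) x else 0)
      = (\<lambda>i. if i < d then (xderiv ^^ p i) (\<lambda>z. I i (jet (n i) (c t) z)) x else 0)"
    if "t \<in> T" "x \<in> X" for t x
  proof
    fix i
    show "(if i < d then (xderiv ^^ p i) (\<lambda>z. snd (q i) (jet (fst (q i)) (c' t) z)) x else 0)
      = (if i < d then (xderiv ^^ p i) (\<lambda>z. I i (jet (n i) (c t) z)) x else 0)"
      using xderiv_iter_cong[OF X that(2) q(2)[OF _ that(1)]] by simp
  qed
  show ?thesis
    unfolding function_of_invariants_def
    by (rule exI[of _ d], rule exI[of _ "\<lambda>i. fst (q i)"], rule exI[of _ p],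
        rule exI[of _ "\<lambda>i. snd (q i)"], rule exI[of _ D], rule exI[of _ f])
      (use q(1) sm D f eq in \<open>simp add: Let_def\<close>)
qed

text \<open>The chain rule for a \<open>C\<^sup>1\<close> function of finitely many variables along a curve: the coordinates are switched on
  one after the other.\<close>

lemma has_derivative_along_curve:
  fixes f :: "(nat \<Rightarrow> real) \<Rightarrow> real"
  assumes X: "open X" and D: "open D" and part: "has_partials d D f g"
    and g: "\<And>i. i < d \<Longrightarrow> continuous_on D (g i)"
    and y: "\<And>x i. x \<in> X \<Longrightarrow> i < d \<Longrightarrow> ((\<lambda>x. y x i) has_vector_derivative y' x i) (at x)"
    and y0: "\<And>x i. i \<ge> d \<Longrightarrow> y x i = 0"
    and yD: "\<And>x. x \<in> X \<Longrightarrow> y x \<in> D" and x0: "x0 \<in> X"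
  shows "((\<lambda>x. f (y x)) has_vector_derivative (\<Sum>i<d. g i (y x0) * y' x0 i)) (at x0)"
proof -
  define z where "z j x = (\<lambda>i. if i < j then y x i else y x0 i)" for j :: nat and x
  have zx0: "z j x0 = y x0" for j by (simp add: z_def)
  have "((\<lambda>x. f (z j x)) has_vector_derivative (\<Sum>i<j. g i (y x0) * y' x0 i)) (at x0)" if "j \<le> d" for j
    using that
  proof (induction j)
    case 0
    then show ?case by (simp add: z_def)
  next
    case (Suc j)
    then have j: "j < d" by simp
    define e where "e p = (z j (fst p))(j := snd p)" for p :: "real \<times> real"
    have e_cont: "continuous_on (X \<times> UNIV) e"
    proof (rule continuous_on_coordinatewise_then_product)
      fix i
      have "continuous_on X (\<lambda>x. y x i)"
        by (cases "i < d")
          (auto simp: y0 intro!: continuous_at_imp_continuous_on has_vector_derivative_continuous y)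
      then have "continuous_on (X \<times> UNIV) (\<lambda>p. y (fst p) i)"
        by (rule continuous_on_compose2) (auto intro: continuous_intros)
      then show "continuous_on (X \<times> UNIV) (\<lambda>p. e p i)"
        by (cases "i = j"; cases "i < j") (auto simp: e_def z_def intro: continuous_intros)
    qed
    have e0: "e (x0, y x0 j) = y x0" by (auto simp: e_def z_def)
    have "open ((X \<times> UNIV) \<inter> e -` D)"
      by (rule continuous_open_preimage[OF e_cont _ D]) (simp add: open_Times X)
    moreover have "(x0, y x0 j) \<in> (X \<times> UNIV) \<inter> e -` D"
      using e0 yD[OF x0] x0 by simp
    ultimately obtain A B where AB: "open A" "open B" "x0 \<in> A" "y x0 j \<in> B"
      "A \<times> B \<subseteq> (X \<times> UNIV) \<inter> e -` D"
      using open_prod_elim[of "(X \<times> UNIV) \<inter> e -` D" "(x0, y x0 j)"] by (metis mem_Sigma_iff)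
    then obtain \<delta> where \<delta>: "\<delta> > 0" "ball (y x0 j) \<delta> \<subseteq> B"
      by (meson open_contains_ball)
    let ?B = "ball (y x0 j) \<delta>"
    have eD: "e (s, \<tau>) \<in> D" "s \<in> X" if "s \<in> A" "\<tau> \<in> ?B" for s \<tau>
    proof -
      have "(s, \<tau>) \<in> A \<times> B" using that \<delta>(2) by blast
      then show "e (s, \<tau>) \<in> D" "s \<in> X" using AB(5) by auto
    qed
    have "((\<lambda>(s, \<tau>). f (e (s, \<tau>))) has_derivative
        (\<lambda>(ts, t\<tau>). ts *\<^sub>R (\<Sum>i<j. g i (y x0) * y' x0 i)
          + blinfun_scaleR_left (g j (e (x0, y x0 j))) t\<tau>)) (at (x0, y x0 j) within A \<times> ?B)"
    proof (rule has_derivative_partialsI[where f = "\<lambda>s \<tau>. f (e (s, \<tau>))" and x = x0 and y = "y x0 j"])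
      have "(\<lambda>s. f (e (s, y x0 j))) = (\<lambda>s. f (z j s))"
        by (rule ext, rule arg_cong[where f = f]) (auto simp: e_def z_def)
      then show "((\<lambda>s. f (e (s, y x0 j))) has_derivative (\<lambda>ts. ts *\<^sub>R (\<Sum>i<j. g i (y x0) * y' x0 i)))
          (at x0 within A)"
        using Suc by (auto simp: has_vector_derivative_def intro: has_derivative_at_withinI)
      show "((\<lambda>\<tau>. f (e (s, \<tau>))) has_derivative blinfun_apply (blinfun_scaleR_left (g j (e (s, \<tau>)))))
          (at \<tau> within ?B)" if "s \<in> A" "\<tau> \<in> ?B" for s \<tau>
      proof -
        have "((\<lambda>h. f ((e (s, \<tau>))(j := h))) has_vector_derivative g j (e (s, \<tau>)))
            (at ((e (s, \<tau>)) j) within {h. (e (s, \<tau>))(j := h) \<in> D})"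
          by (rule has_partialsD[OF part j eD(1)[OF that]])
        then have "((\<lambda>h. f (e (s, h))) has_vector_derivative g j (e (s, \<tau>)))
            (at \<tau> within {h. e (s, h) \<in> D})"
          by (simp add: e_def)
        then have "((\<lambda>h. f (e (s, h))) has_vector_derivative g j (e (s, \<tau>))) (at \<tau> within ?B)"
          by (rule has_vector_derivative_within_subset) (use eD that in auto)
        then show ?thesis
          by (simp add: has_vector_derivative_def blinfun_scaleR_left.rep_eq)
      qed
      have "continuous_on (A \<times> ?B) (\<lambda>p. g j (e p))"
        by (rule continuous_on_compose2[OF g[OF j] continuous_on_subset[OF e_cont]]) (use eD in auto)
      then have "continuous_on (A \<times> ?B) (\<lambda>p. blinfun_scaleR_left (g j (e p)))"
        by (rule bounded_linear.continuous_on[OF bounded_linear_blinfun_scaleR_left])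
      then show "continuous (at (x0, y x0 j) within A \<times> ?B)
          (\<lambda>(s, \<tau>). blinfun_scaleR_left (g j (e (s, \<tau>))))"
        using AB \<delta> unfolding continuous_on_eq_continuous_within case_prod_beta prod.collapse
        by (metis centre_in_ball mem_Sigma_iff)
    qed (use \<delta> in auto)
    moreover have "(\<lambda>(s, \<tau>). f (e (s, \<tau>))) = (\<lambda>p. f (e p))" by auto
    ultimately have H: "((\<lambda>p. f (e p)) has_derivative (\<lambda>(ts, t\<tau>). ts *\<^sub>R (\<Sum>i<j. g i (y x0) * y' x0 i)
        + t\<tau> *\<^sub>R g j (y x0))) (at (x0, y x0 j))"
      using AB \<delta> at_within_open[of "(x0, y x0 j)" "A \<times> ?B"] e0
      by (simp add: open_Times case_prod_beta blinfun_scaleR_left.rep_eq)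
    have "((\<lambda>x. (x, y x j)) has_derivative (\<lambda>h. (h, h *\<^sub>R y' x0 j))) (at x0)"
      using y[OF x0 j] by (auto intro!: derivative_eq_intros simp: has_vector_derivative_def)
    from has_derivative_compose[OF this H]
    have "((\<lambda>x. f (e (x, y x j))) has_derivative (\<lambda>h. h *\<^sub>R (\<Sum>i<j. g i (y x0) * y' x0 i)
        + (h *\<^sub>R y' x0 j) *\<^sub>R g j (y x0))) (at x0)"
      by simp
    moreover have "(\<lambda>x. f (e (x, y x j))) = (\<lambda>x. f (z (Suc j) x))"
      by (rule ext, rule arg_cong[where f = f]) (auto simp: e_def z_def)
    ultimately show ?case
      by (simp add: has_vector_derivative_def algebra_simps)
  qed
  from this[of d] have "((\<lambda>x. f (z d x)) has_vector_derivative (\<Sum>i<d. g i (y x0) * y' x0 i)) (at x0)"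
    by simp
  moreover have "z d = y"
    by (rule ext, rule ext) (simp add: z_def y0)
  ultimately show ?thesis by (simp only:)
qed

lemma at_within_slice_open:
  fixes y :: "nat \<Rightarrow> real"
  assumes "open D" "y \<in> D"
  shows "at (y i) within {h. y(i := h) \<in> D} \<noteq> bot"
proof -
  have "continuous_on UNIV (\<lambda>h. y(i := h))"
  proof (rule continuous_on_coordinatewise_then_product)
    show "continuous_on UNIV (\<lambda>h. (y(i := h)) k)" for k
      by (cases "k = i") (auto intro: continuous_intros)
  qed
  then have "open ((\<lambda>h. y(i := h)) -` D)"
    using continuous_on_open_vimage[OF open_UNIV] assms(1) by force
  then have "open {h. y(i := h) \<in> D}" by (simp add: vimage_def)
  with assms(2) have "at (y i) within {h. y(i := h) \<in> D} = at (y i)"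
    by (intro at_within_open) simp_all
  then show ?thesis by simp
qed

text \<open>Restores the default value 0 in all slots beyond the first \<open>d\<close>.\<close>

definition cut :: "nat \<Rightarrow> (nat \<Rightarrow> real) \<Rightarrow> nat \<Rightarrow> real" where
  "cut d y = (\<lambda>i. if i < d then y i else 0)"

lemma continuous_on_cut: "continuous_on S (cut d)"
proof (rule continuous_on_coordinatewise_then_product)
  fix i
  have "continuous_on S (\<lambda>y. y i)"
    by (intro continuous_on_product_coordinates continuous_on_subset[OF _ subset_UNIV])
  then show "continuous_on S (\<lambda>y. cut d y i)"
    by (cases "i < d") (auto simp: cut_def intro: continuous_intros)
qed

lemma Ck_on_cut: "Ck_on k d D f \<Longrightarrow> Ck_on k d' {y. cut d y \<in> D} (\<lambda>y. f (cut d y))"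
proof (induction k arbitrary: f)
  case 0
  then show ?case
    using continuous_on_compose2[OF _ continuous_on_cut, of D f] by force
next
  case (Suc k)
  obtain g where part: "has_partials d D f g" and g: "\<forall>i<d. Ck_on k d D (g i)"
    using Suc.prems unfolding Ck_on_Suc_iff by blast
  show ?case
  proof (rule Ck_on_SucI[where g = "\<lambda>i y. if i < d then g i (cut d y) else 0"])
    show "continuous_on {y. cut d y \<in> D} (\<lambda>y. f (cut d y))"
      using continuous_on_compose2[OF Ck_on_continuous[OF Suc.prems] continuous_on_cut] by force
    fix i assume "i < d'"
    show "Ck_on k d' {y. cut d y \<in> D} (\<lambda>y. if i < d then g i (cut d y) else 0)"
      using Suc.IH g Ck_on_const by (cases "i < d") simp_all
    fix y assume y: "y \<in> {y. cut d y \<in> D}"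
    show "((\<lambda>h. f (cut d (y(i := h)))) has_vector_derivative (if i < d then g i (cut d y) else 0))
      (at (y i) within {h. y(i := h) \<in> {y. cut d y \<in> D}})"
    proof (cases "i < d")
      case True
      then have "cut d (y(i := h)) = (cut d y)(i := h)" "cut d y i = y i" for h
        by (auto simp: cut_def)
      then show ?thesis using has_partialsD[OF part True, of "cut d y"] y True by simp
    next
      case False
      then have "cut d (y(i := h)) = cut d y" for h
        by (auto simp: cut_def)
      then show ?thesis using False by simp
    qed
  qed
qed

lemma Ck_on_sum:
  "finite A \<Longrightarrow> (\<And>i. i \<in> A \<Longrightarrow> Ck_on k d D (f i)) \<Longrightarrow> Ck_on k d D (\<lambda>y. \<Sum>i\<in>A. f i y)"
proof (induction A rule: finite_induct)
  case empty
  then show ?case by (simp add: Ck_on_const)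
next
  case (insert a A)
  have "Ck_on k d D (\<lambda>y. f a y + (\<Sum>i\<in>A. f i y))"
    by (rule Ck_on_add) (use insert in auto)
  then show ?case using insert.hyps by simp
qed

text \<open>The derivative of \<open>f\<close> applied to derivatives of invariants is, by the chain rule, a smooth function of
  the same quantities and their derivatives, which occupy a second block of \<open>d\<close> slots.\<close>

lemma function_of_invariants_uminus_xderiv:
  assumes X: "open X" and r: "function_of_invariants Inv T X c r"
  shows "function_of_invariants Inv T X c (\<lambda>t x. - xderiv (r t) x)"
proof -
  from r obtain d n p I D f where
    I: "\<forall>i<d. Inv (n i) (I i) \<and> (\<forall>t\<in>T. smooth_curve X (\<lambda>x. I i (jet (n i) (c t) x)))"
    and D: "open D" and f: "smooth_vars d D f"
    and rf: "\<forall>t\<in>T. \<forall>x\<in>X.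
           let y = (\<lambda>i. if i < d then (xderiv ^^ p i) (\<lambda>z. I i (jet (n i) (c t) z)) x else 0)
           in y \<in> D \<and> r t x = f y"
    unfolding function_of_invariants_def by blast
  define w where "w i t = (\<lambda>x. I i (jet (n i) (c t) x))" for i t
  define y where "y t x = (\<lambda>i. if i < d then (xderiv ^^ p i) (w i t) x else 0)" for t x
  have yD: "y t x \<in> D" and ry: "r t x = f (y t x)" if "t \<in> T" "x \<in> X" for t x
    using rf that unfolding Let_def y_def w_def by blast+
  from smooth_vars_partial[OF f at_within_slice_open[OF D]]
  obtain g where part: "has_partials d D f g" and g: "\<forall>i<d. smooth_vars d D (g i)"
    by blast
  have yd: "((\<lambda>x. y t x i) has_vector_derivative (xderiv ^^ Suc (p i)) (w i t) x) (at x)"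
    if "t \<in> T" "x \<in> X" "i < d" for t x i
  proof -
    have "smooth_curve X (w i t)" using I that by (simp add: w_def)
    then have "((xderiv ^^ p i) (w i t) has_vector_derivative (xderiv ^^ Suc (p i)) (w i t) x) (at x)"
      using that by (simp add: smooth_curve_def xderiv_has_derivative)
    then show ?thesis using that by (simp add: y_def)
  qed
  have r': "xderiv (r t) x = (\<Sum>i<d. g i (y t x) * (xderiv ^^ Suc (p i)) (w i t) x)"
    if "t \<in> T" "x \<in> X" for t x
  proof -
    have "((\<lambda>x. f (y t x)) has_vector_derivative
        (\<Sum>i<d. g i (y t x) * (xderiv ^^ Suc (p i)) (w i t) x)) (at x)"
    proof (rule has_derivative_along_curve[OF X D part])
      show "continuous_on D (g i)" if "i < d" for i
        using g that Ck_on_continuous unfolding smooth_vars_def by blast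
    qed (use yd yD that in \<open>auto simp: y_def\<close>)
    then have "(r t has_vector_derivative
        (\<Sum>i<d. g i (y t x) * (xderiv ^^ Suc (p i)) (w i t) x)) (at x)"
      by (rule has_vector_derivative_transform_within_open[OF _ X that(2)]) (simp add: ry that(1))
    then show ?thesis by (rule xderivI)
  qed
  define n' where "n' i = (if i < d then n i else n (i - d))" for i
  define I' where "I' i = (if i < d then I i else I (i - d))" for i
  define p' where "p' i = (if i < d then p i else Suc (p (i - d)))" for i
  define D' where "D' = {y. cut d y \<in> D}"
  define f' where "f' y = (\<Sum>i<d. (-1) * g i (cut d y) * y (d + i))" for y
  have "open D'"
    using continuous_on_cut[of UNIV d] D continuous_on_open_vimage[OF open_UNIV, of "cut d"]
    by (simp add: D'_def vimage_def)
  moreover have "smooth_vars (d + d) D' f'"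
    unfolding smooth_vars_def f'_def[abs_def] D'_def
    by (intro allI Ck_on_sum Ck_on_mult Ck_on_const Ck_on_coordinate Ck_on_cut)
      (use g in \<open>auto simp: smooth_vars_def\<close>)
  moreover have "\<forall>i<d + d. Inv (n' i) (I' i) \<and> (\<forall>t\<in>T. smooth_curve X (\<lambda>x. I' i (jet (n' i) (c t) x)))"
    using I by (auto simp: n'_def I'_def)
  moreover have "\<forall>t\<in>T. \<forall>x\<in>X.
           let y = (\<lambda>i. if i < d + d then (xderiv ^^ p' i) (\<lambda>z. I' i (jet (n' i) (c t) z)) x else 0)
           in y \<in> D' \<and> - xderiv (r t) x = f' y"
  proof (intro ballI)
    fix t x assume tx: "t \<in> T" "x \<in> X"
    let ?y = "\<lambda>i. if i < d + d then (xderiv ^^ p' i) (\<lambda>z. I' i (jet (n' i) (c t) z)) x else 0"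
    have "cut d ?y = y t x"
      unfolding cut_def y_def n'_def I'_def p'_def w_def by (rule ext) auto
    moreover have "?y (d + i) = (xderiv ^^ Suc (p i)) (w i t) x" if "i < d" for i
      using that by (simp add: n'_def I'_def p'_def w_def)
    ultimately show "let y = ?y in y \<in> D' \<and> - xderiv (r t) x = f' y"
      unfolding Let_def using yD[OF tx] r'[OF tx]
      by (simp add: D'_def f'_def sum_negf del: funpow.simps)
  qed
  ultimately show ?thesis
    unfolding function_of_invariants_def
    by - (rule exI[of _ "d + d"], rule exI[of _ n'], rule exI[of _ p'], rule exI[of _ I'],
        rule exI[of _ D'], rule exI[of _ f'], intro conjI; assumption)
qed

section \<open>Flows of curves in the cone\<close>

lemma bounded_linear_local_coords: "bounded_linear local_coords"
proof -
  have "linear local_coords"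
    by (rule linearI) (simp_all add: local_coords_def vec_eq_iff forall_3)
  then show ?thesis by (simp add: linear_conv_bounded_linear)
qed

locale regular_cone_flow = flow_domain T X for T X +
  fixes u :: "real \<Rightarrow> real \<Rightarrow> real^4"
  assumes cone_flow: "cone_flow T X u"
begin

abbreviation m :: "real \<Rightarrow> real \<Rightarrow> real^2" where "m t x \<equiv> Proj (u t x)"
abbreviation m' :: "real \<Rightarrow> real \<Rightarrow> real^2" where "m' t x \<equiv> xderiv (m t) x"
abbreviation m'' :: "real \<Rightarrow> real \<Rightarrow> real^2" where "m'' t x \<equiv> xderiv (xderiv (m t)) x"
abbreviation mt :: "real \<Rightarrow> real \<Rightarrow> real^2" where "mt t x \<equiv> tderiv T m t x"
abbreviation p :: "real \<Rightarrow> real \<Rightarrow> real" where "p t x \<equiv> u t x $ 3"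
abbreviation p' :: "real \<Rightarrow> real \<Rightarrow> real" where "p' t x \<equiv> xderiv (p t) x"
abbreviation e :: "real \<Rightarrow> real \<Rightarrow> real" where "e t x \<equiv> normJ (xderiv (u t) x)"
abbreviation N :: "real \<Rightarrow> real \<Rightarrow> real" where "N t x \<equiv> (m' t x $ 1)\<^sup>2 + (m' t x $ 2)\<^sup>2"

text \<open>The coordinates of \<open>m\<^sub>t\<close> in the frame that consists of \<open>m'\<close> and its rotation by a right angle.\<close>

definition \<rho>1 :: "real \<Rightarrow> real \<Rightarrow> real" where
  "\<rho>1 t x = (m' t x $ 1 * mt t x $ 1 + m' t x $ 2 * mt t x $ 2)
    / (m' t x $ 1 * m' t x $ 1 + m' t x $ 2 * m' t x $ 2)"

definition \<rho>2 :: "real \<Rightarrow> real \<Rightarrow> real" where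
  "\<rho>2 t x = (m' t x $ 1 * mt t x $ 2 + (-1) * (m' t x $ 2 * mt t x $ 1))
    / (m' t x $ 1 * m' t x $ 1 + m' t x $ 2 * m' t x $ 2)"

text \<open>The rate of \<open>p\<close> that the evolution matrix prescribes.\<close>

definition scaling_rate :: "real \<Rightarrow> real \<Rightarrow> real \<Rightarrow> real \<Rightarrow> real \<Rightarrow> real" where
  "scaling_rate r1 r2 r3 t x = p t x * (r3 + p' t x / (p t x * e t x) * r1
    + (p t x)\<^sup>2 / e t x ^ 3 * (m' t x $ 1 * m'' t x $ 2 - m' t x $ 2 * m'' t x $ 1) * r2)"

lemma smooth_u: "smooth_flow T X u"
  using cone_flow by (simp add: cone_flow_def)

lemma curve_u: "t \<in> T \<Longrightarrow> smooth_curve X (u t)"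
  by (rule smooth_flow_smooth_curve[OF smooth_u])

lemma u_cone:
  assumes "t \<in> T" "x \<in> X"
  shows "u t x \<in> upper_cone" "u t x \<in> light_cone" "p t x > 0" "p t x \<noteq> 0" "e t x \<noteq> 0"
  using cone_flow assms by (force simp: cone_flow_def upper_cone_def)+

lemma smooth_p: "smooth_flow T X p"
  by (rule smooth_flow_nth[OF smooth_u])

lemma smooth_m: "smooth_flow T X m"
proof (rule smooth_flow_vecI)
  fix i :: 2
  show "smooth_flow T X (\<lambda>t x. m t x $ i)"
    using exhaust_2[of i] smooth_flow_divide[OF smooth_flow_nth[OF smooth_u] smooth_p u_cone(4)]
    by auto
qed

lemmas smooth_m' = smooth_flow_xderiv[OF smooth_m]
lemmas smooth_mt = smooth_flow_tderiv[OF smooth_m]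

lemma p'_eq: "t \<in> T \<Longrightarrow> x \<in> X \<Longrightarrow> p' t x = xderiv (u t) x $ 3"
  by (rule xderiv_nth[OF curve_u])

lemma speed_eq:
  assumes "t \<in> T" "x \<in> X"
  shows "e t x = p t x * norm (m' t x)" "e t x > 0" "(e t x)\<^sup>2 = (p t x)\<^sup>2 * N t x"
    "m' t x \<noteq> 0" "N t x > 0"
proof -
  note cm = cone_mat_projected[OF X_open curve_u[OF assms(1)] u_cone(1)[OF assms(1)] assms(2) u_cone(5)[OF assms]]
  show e: "e t x = p t x * norm (m' t x)" and "e t x > 0" "(e t x)\<^sup>2 = (p t x)\<^sup>2 * N t x"
    using cm(2-4) by simp_all
  then show "m' t x \<noteq> 0" by auto
  then show "N t x > 0" using speed_sq_pos[of "m' t x"] by (simp add: power2_eq_square)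
qed

lemma smooth_e: "smooth_flow T X e"
proof (rule smooth_flow_cong)
  show "p t x * (m' t x $ 1 * m' t x $ 1 + m' t x $ 2 * m' t x $ 2) powr (1/2) = e t x"
    if "t \<in> T" "x \<in> X" for t x
    using speed_eq[OF that] by (simp add: norm_real2 power2_eq_square powr_half_sqrt)
  show "smooth_flow T X (\<lambda>t x. p t x * (m' t x $ 1 * m' t x $ 1 + m' t x $ 2 * m' t x $ 2) powr (1/2))"
    by (intro smooth_flow_mult smooth_flow_powr smooth_flow_add smooth_flow_nth smooth_p smooth_m' smooth_u
        speed_sq_pos speed_eq(4))
qed

lemma frame_nonzero: "t \<in> T \<Longrightarrow> x \<in> X \<Longrightarrow> m' t x $ 1 * m' t x $ 1 + m' t x $ 2 * m' t x $ 2 \<noteq> 0"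
  using speed_eq(5) by (fastforce simp: power2_eq_square)

lemma smooth_\<rho>: "smooth_flow T X \<rho>1" "smooth_flow T X \<rho>2"
  unfolding \<rho>1_def[abs_def] \<rho>2_def[abs_def]
  by (intro smooth_flow_divide smooth_flow_add smooth_flow_mult smooth_flow_nth smooth_flow_const
      smooth_m' smooth_mt frame_nonzero; assumption)+

text \<open>Complex division of \<open>m\<^sub>t\<close> by \<open>m'\<close>.\<close>

lemma frame_coords_iff:
  assumes "t \<in> T" "x \<in> X"
  shows "mt t x $ 1 = m' t x $ 1 * r1 - m' t x $ 2 * r2 \<and> mt t x $ 2 = m' t x $ 2 * r1 + m' t x $ 1 * r2
    \<longleftrightarrow> r1 = \<rho>1 t x \<and> r2 = \<rho>2 t x"
proof -
  have solve: "v1 = a * r1 - b * r2 \<and> v2 = b * r1 + a * r2 \<longleftrightarrow>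
      r1 = (a * v1 + b * v2) / n \<and> r2 = (a * v2 + (-1) * (b * v1)) / n"
    if n: "n = a * a + b * b" "n \<noteq> 0" for a b v1 v2 n :: real
  proof
    assume *: "v1 = a * r1 - b * r2 \<and> v2 = b * r1 + a * r2"
    have "a * v1 + b * v2 = n * r1" "a * v2 + (-1) * (b * v1) = n * r2"
      by (simp_all add: n(1) conjunct1[OF *] conjunct2[OF *] algebra_simps)
    then show "r1 = (a * v1 + b * v2) / n \<and> r2 = (a * v2 + (-1) * (b * v1)) / n"
      using n(2) by simp
  next
    assume *: "r1 = (a * v1 + b * v2) / n \<and> r2 = (a * v2 + (-1) * (b * v1)) / n"
    have "a * r1 - b * r2 = (a * (a * v1 + b * v2) - b * (a * v2 + (-1) * (b * v1))) / n"
      "b * r1 + a * r2 = (b * (a * v1 + b * v2) + a * (a * v2 + (-1) * (b * v1))) / n"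
      unfolding conjunct1[OF *] conjunct2[OF *] times_divide_eq_right diff_divide_distrib[symmetric]
        add_divide_distrib[symmetric] by (rule refl)+
    moreover have "a * (a * v1 + b * v2) - b * (a * v2 + (-1) * (b * v1)) = n * v1"
      "b * (a * v1 + b * v2) + a * (a * v2 + (-1) * (b * v1)) = n * v2"
      by (simp_all add: n(1) algebra_simps)
    ultimately show "v1 = a * r1 - b * r2 \<and> v2 = b * r1 + a * r2"
      using n(2) by simp
  qed
  show ?thesis unfolding \<rho>1_def \<rho>2_def by (rule solve[OF refl frame_nonzero[OF assms]])
qed

text \<open>The three components of the evolution equation, solved for the scaling of \<open>p\<close> and for the motion
  of \<open>m\<close> in its frame.\<close>

lemma cone_evolution_equation_iff:
  assumes t: "t \<in> T" and x: "x \<in> X"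
  shows "((\<lambda>\<tau>. local_coords (u \<tau> x)) has_vector_derivative cone_mat (u t) x *v vector [r1, r2, r3])
      (at t within T) \<longleftrightarrow>
    tderiv T p t x = scaling_rate r1 r2 r3 t x \<and> r1 = e t x * \<rho>1 t x \<and> r2 = e t x * \<rho>2 t x"
proof -
  let ?L = "local_coords (tderiv T u t x)" and ?V = "cone_mat (u t) x *v vector [r1, r2, r3]"
  have hu: "((\<lambda>\<tau>. u \<tau> x $ i) has_vector_derivative tderiv T u t x $ i) (at t within T)" for i
    by (rule bounded_linear.has_vector_derivative[OF bounded_linear_vec_nth
          smooth_flow_has_tderiv[OF smooth_u t x]])
  have hm: "((\<lambda>\<tau>. m \<tau> x $ i) has_vector_derivative mt t x $ i) (at t within T)" for i
    by (rule bounded_linear.has_vector_derivative[OF bounded_linear_vec_nth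
          smooth_flow_has_tderiv[OF smooth_m t x]])
  have u3: "tderiv T u t x $ 3 = tderiv T p t x"
    by (rule sym, rule tderivI[where c = p, OF t hu])
  have ui: "tderiv T u t x $ i = tderiv T p t x * m t x $ j + p t x * mt t x $ j"
    if "\<And>\<tau>. \<tau> \<in> T \<Longrightarrow> u \<tau> x $ i = p \<tau> x * m \<tau> x $ j" for i j
  proof -
    have "((\<lambda>\<tau>. p \<tau> x * m \<tau> x $ j) has_vector_derivative tderiv T u t x $ 3 * m t x $ j + p t x * mt t x $ j)
        (at t within T)"
      by (rule has_vector_derivative_times[OF hu hm])
    then have "((\<lambda>\<tau>. u \<tau> x $ i) has_vector_derivative tderiv T u t x $ 3 * m t x $ j + p t x * mt t x $ j)
        (at t within T)"
      by (rule has_vector_derivative_transform[OF t, rotated]) (rule that)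
    then show ?thesis
      using vector_derivative_unique_within[OF at_T[OF t] hu] u3 by metis
  qed
  have "u \<tau> x $ 1 = p \<tau> x * m \<tau> x $ 1" "u \<tau> x $ 2 = p \<tau> x * m \<tau> x $ 2" if "\<tau> \<in> T" for \<tau>
    using u_cone(4)[OF that x] by simp_all
  note u12 = ui[OF this(1)] ui[OF this(2)]
  have "((\<lambda>\<tau>. local_coords (u \<tau> x)) has_vector_derivative ?L) (at t within T)"
    by (rule bounded_linear.has_vector_derivative[OF bounded_linear_local_coords
          smooth_flow_has_tderiv[OF smooth_u t x]])
  then have "((\<lambda>\<tau>. local_coords (u \<tau> x)) has_vector_derivative ?V) (at t within T) \<longleftrightarrow> ?L = ?V"
    using vector_derivative_unique_within[OF at_T[OF t]] by metis
  also have "\<dots> \<longleftrightarrow> tderiv T p t x = scaling_rate r1 r2 r3 t x \<and>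
      mt t x $ 1 = m' t x $ 1 * (r1 / e t x) - m' t x $ 2 * (r2 / e t x) \<and>
      mt t x $ 2 = m' t x $ 2 * (r1 / e t x) + m' t x $ 1 * (r2 / e t x)"
  proof -
    note cm = cone_mat_projected(5)[OF X_open curve_u[OF t] u_cone(1)[OF t] x u_cone(5)[OF t x],
        of r1 r2 r3]
    have "?V = vector [scaling_rate r1 r2 r3 t x * m t x $ 1
        + p t x * ((m' t x $ 1 * r1 - m' t x $ 2 * r2) / e t x),
      scaling_rate r1 r2 r3 t x * m t x $ 2
        + p t x * ((m' t x $ 2 * r1 + m' t x $ 1 * r2) / e t x), scaling_rate r1 r2 r3 t x]"
      unfolding scaling_rate_def p'_eq[OF t x] by (rule cm)
    moreover have "?L = vector [tderiv T p t x * m t x $ 1 + p t x * mt t x $ 1,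
      tderiv T p t x * m t x $ 2 + p t x * mt t x $ 2, tderiv T p t x]"
      by (simp add: local_coords_def u12 u3 del: Proj_nth)
    ultimately show ?thesis
      using u_cone(4)[OF t x]
      by (auto simp: vec_eq_iff forall_3 diff_divide_distrib add_divide_distrib simp del: Proj_nth)
  qed
  also have "\<dots> \<longleftrightarrow> tderiv T p t x = scaling_rate r1 r2 r3 t x \<and> r1 / e t x = \<rho>1 t x \<and> r2 / e t x = \<rho>2 t x"
    by (simp only: frame_coords_iff[OF t x])
  also have "\<dots> \<longleftrightarrow> tderiv T p t x = scaling_rate r1 r2 r3 t x \<and> r1 = e t x * \<rho>1 t x \<and> r2 = e t x * \<rho>2 t x"
    using u_cone(5)[OF t x] by (auto simp: field_simps)
  finally show ?thesis .
qed

end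

text \<open>The algebra behind the evolution of the speed. The sum multiplying \<open>p\<^sup>2\<close> is
  \<open>Re (m' \<cdot> (m' (\<rho> + i \<sigma>))')\<close> with the first factor conjugated; its curvature term \<open>- d \<sigma>\<close> cancels against
  the one in the prescribed rate of \<open>p\<close>, and what multiplies \<open>\<rho>\<close> adds up to \<open>e e'\<close>.\<close>

lemma speed_identity:
  fixes a1 :: real
  assumes p: "p > 0" and e: "e > 0" and e2: "e\<^sup>2 = p\<^sup>2 * (a1\<^sup>2 + a2\<^sup>2)"
    and ex: "e * ex = p * p' * (a1\<^sup>2 + a2\<^sup>2) + p\<^sup>2 * (a1 * b1 + a2 * b2)"
  defines "d \<equiv> a1 * b2 - a2 * b1"
  shows "p * (p * (r3 + p' / (p * e) * (e * \<rho>) + p\<^sup>2 / e ^ 3 * d * (e * \<sigma>))) * (a1\<^sup>2 + a2\<^sup>2)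
    + p\<^sup>2 * (a1 * (b1 * \<rho> + a1 * \<rho>' - (b2 * \<sigma> + a2 * \<sigma>')) + a2 * (b2 * \<rho> + a2 * \<rho>' + (b1 * \<sigma> + a1 * \<sigma>')))
    = e * (e * r3 + (ex * \<rho> + e * \<rho>'))"
proof -
  let ?N = "a1\<^sup>2 + a2\<^sup>2"
  have "p * (p * (r3 + p' / (p * e) * (e * \<rho>) + p\<^sup>2 / e ^ 3 * d * (e * \<sigma>))) * ?N
      = p\<^sup>2 * ?N * r3 + p * p' * ?N * \<rho> + p\<^sup>2 * (p\<^sup>2 * ?N / e\<^sup>2) * d * \<sigma>"
    using p e by (simp add: field_simps power2_eq_square power3_eq_cube)
  also have "\<dots> = e\<^sup>2 * r3 + p * p' * ?N * \<rho> + p\<^sup>2 * d * \<sigma>"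
    using e by (simp add: e2[symmetric])
  finally have "p * (p * (r3 + p' / (p * e) * (e * \<rho>) + p\<^sup>2 / e ^ 3 * d * (e * \<sigma>))) * ?N
    + p\<^sup>2 * (a1 * (b1 * \<rho> + a1 * \<rho>' - (b2 * \<sigma> + a2 * \<sigma>')) + a2 * (b2 * \<rho> + a2 * \<rho>' + (b1 * \<sigma> + a1 * \<sigma>')))
    = e\<^sup>2 * r3 + (p * p' * ?N + p\<^sup>2 * (a1 * b1 + a2 * b2)) * \<rho> + p\<^sup>2 * ?N * \<rho>'"
    by (simp add: d_def algebra_simps power2_eq_square)
  also have "\<dots> = e * (e * r3 + (ex * \<rho> + e * \<rho>'))"
    unfolding ex[symmetric] e2[symmetric] by (simp add: algebra_simps power2_eq_square)
  finally show ?thesis .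
qed

context regular_cone_flow
begin

text \<open>For \<open>r\<^sub>3\<close> arbitrary, a relation between the growth of the speed and the deviation of \<open>p\<^sub>t\<close> from
  the prescribed rate: if the deviation vanishes, it determines \<open>e\<^sub>t\<close>; if \<open>e\<close> is constant, it determines
  \<open>p\<^sub>t\<close>.\<close>

lemma speed_evolution:
  assumes t: "t \<in> T" and x: "x \<in> X"
  shows "e t x * tderiv T e t x =
    p t x * N t x * (tderiv T p t x - scaling_rate (e t x * \<rho>1 t x) (e t x * \<rho>2 t x) r3 t x)
    + e t x * (e t x * r3 + xderiv (\<lambda>y. e t y * \<rho>1 t y) x)"
proof -
  have vx: "((\<lambda>y. c t y) has_vector_derivative xderiv (c t) x) (at x)"
    and vt: "((\<lambda>\<tau>. c \<tau> x) has_vector_derivative tderiv T c t x) (at t within T)"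
    if "smooth_flow T X c" for c :: "real \<Rightarrow> real \<Rightarrow> real"
    using smooth_flow_has_xderiv[OF that t x] smooth_flow_has_tderiv[OF that t x] by simp_all
  have ax: "((\<lambda>y. m' t y $ i) has_vector_derivative m'' t x $ i) (at x)"
    and at: "((\<lambda>\<tau>. m' \<tau> x $ i) has_vector_derivative xderiv (tderiv T m t) x $ i) (at t within T)" for i
    using bounded_linear.has_vector_derivative[OF bounded_linear_vec_nth smooth_flow_has_xderiv[OF smooth_m' t x]]
      bounded_linear.has_vector_derivative[OF bounded_linear_vec_nth smooth_flow_has_tderiv[OF smooth_m' t x]]
      mixed_partials[OF smooth_m t x] by simp_all
  have mtx: "((\<lambda>y. mt t y $ i) has_vector_derivative xderiv (tderiv T m t) x $ i) (at x)" for i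
    by (rule bounded_linear.has_vector_derivative[OF bounded_linear_vec_nth
          smooth_flow_has_xderiv[OF smooth_mt t x]])
  have mt_eq: "mt t y $ 1 = m' t y $ 1 * \<rho>1 t y - m' t y $ 2 * \<rho>2 t y"
    "mt t y $ 2 = m' t y $ 2 * \<rho>1 t y + m' t y $ 1 * \<rho>2 t y" if "y \<in> X" for y
    using frame_coords_iff[OF t that] by blast+
  let ?\<rho>' = "xderiv (\<rho>1 t) x" and ?\<sigma>' = "xderiv (\<rho>2 t) x"
  have "((\<lambda>y. m' t y $ 1 * \<rho>1 t y - m' t y $ 2 * \<rho>2 t y) has_vector_derivative
      (m'' t x $ 1 * \<rho>1 t x + m' t x $ 1 * ?\<rho>') - (m'' t x $ 2 * \<rho>2 t x + m' t x $ 2 * ?\<sigma>')) (at x)"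
    by (intro has_vector_derivative_diff has_vector_derivative_times ax vx smooth_\<rho>)
  then have "((\<lambda>y. mt t y $ 1) has_vector_derivative
      (m'' t x $ 1 * \<rho>1 t x + m' t x $ 1 * ?\<rho>') - (m'' t x $ 2 * \<rho>2 t x + m' t x $ 2 * ?\<sigma>')) (at x)"
    by (rule has_vector_derivative_transform_within_open[OF _ X_open x]) (simp add: mt_eq)
  then have vmt1: "xderiv (tderiv T m t) x $ 1 =
      (m'' t x $ 1 * \<rho>1 t x + m' t x $ 1 * ?\<rho>') - (m'' t x $ 2 * \<rho>2 t x + m' t x $ 2 * ?\<sigma>')"
    by (rule vector_derivative_unique_at[OF mtx])
  have "((\<lambda>y. m' t y $ 2 * \<rho>1 t y + m' t y $ 1 * \<rho>2 t y) has_vector_derivative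
      (m'' t x $ 2 * \<rho>1 t x + m' t x $ 2 * ?\<rho>') + (m'' t x $ 1 * \<rho>2 t x + m' t x $ 1 * ?\<sigma>')) (at x)"
    by (intro has_vector_derivative_add has_vector_derivative_times ax vx smooth_\<rho>)
  then have "((\<lambda>y. mt t y $ 2) has_vector_derivative
      (m'' t x $ 2 * \<rho>1 t x + m' t x $ 2 * ?\<rho>') + (m'' t x $ 1 * \<rho>2 t x + m' t x $ 1 * ?\<sigma>')) (at x)"
    by (rule has_vector_derivative_transform_within_open[OF _ X_open x]) (simp add: mt_eq)
  then have vmt2: "xderiv (tderiv T m t) x $ 2 =
      (m'' t x $ 2 * \<rho>1 t x + m' t x $ 2 * ?\<rho>') + (m'' t x $ 1 * \<rho>2 t x + m' t x $ 1 * ?\<sigma>')"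
    by (rule vector_derivative_unique_at[OF mtx])
  \<comment> \<open>Both partial derivatives of \<open>e\<^sup>2 = p\<^sup>2 |m'|\<^sup>2\<close>.\<close>
  have sq: "e s y * e s y = (p s y * p s y) * (m' s y $ 1 * m' s y $ 1 + m' s y $ 2 * m' s y $ 2)"
    if "s \<in> T" "y \<in> X" for s y
    using speed_eq(3)[OF that] by (simp add: power2_eq_square)
  let ?ex = "xderiv (e t) x" and ?et = "tderiv T e t x" and ?pt = "tderiv T p t x"
  have "((\<lambda>y. (p t y * p t y) * (m' t y $ 1 * m' t y $ 1 + m' t y $ 2 * m' t y $ 2)) has_vector_derivative
      (p' t x * p t x + p t x * p' t x) * (m' t x $ 1 * m' t x $ 1 + m' t x $ 2 * m' t x $ 2)
      + (p t x * p t x) * ((m'' t x $ 1 * m' t x $ 1 + m' t x $ 1 * m'' t x $ 1)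
        + (m'' t x $ 2 * m' t x $ 2 + m' t x $ 2 * m'' t x $ 2))) (at x)"
    by (intro has_vector_derivative_add has_vector_derivative_times ax vx smooth_p)
  then have "((\<lambda>y. e t y * e t y) has_vector_derivative
      (p' t x * p t x + p t x * p' t x) * (m' t x $ 1 * m' t x $ 1 + m' t x $ 2 * m' t x $ 2)
      + (p t x * p t x) * ((m'' t x $ 1 * m' t x $ 1 + m' t x $ 1 * m'' t x $ 1)
        + (m'' t x $ 2 * m' t x $ 2 + m' t x $ 2 * m'' t x $ 2))) (at x)"
    by (rule has_vector_derivative_transform_within_open[OF _ X_open x]) (simp add: sq t)
  moreover have "((\<lambda>y. e t y * e t y) has_vector_derivative ?ex * e t x + e t x * ?ex) (at x)"
    by (intro has_vector_derivative_times vx smooth_e)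
  ultimately have "?ex * e t x + e t x * ?ex =
      (p' t x * p t x + p t x * p' t x) * (m' t x $ 1 * m' t x $ 1 + m' t x $ 2 * m' t x $ 2)
      + (p t x * p t x) * ((m'' t x $ 1 * m' t x $ 1 + m' t x $ 1 * m'' t x $ 1)
        + (m'' t x $ 2 * m' t x $ 2 + m' t x $ 2 * m'' t x $ 2))"
    by (rule vector_derivative_unique_at[rotated])
  then have ex: "e t x * ?ex = p t x * p' t x * N t x
      + (p t x)\<^sup>2 * (m' t x $ 1 * m'' t x $ 1 + m' t x $ 2 * m'' t x $ 2)"
    by (simp add: power2_eq_square algebra_simps)
  let ?a1t = "xderiv (tderiv T m t) x $ 1" and ?a2t = "xderiv (tderiv T m t) x $ 2"
  have "((\<lambda>\<tau>. (p \<tau> x * p \<tau> x) * (m' \<tau> x $ 1 * m' \<tau> x $ 1 + m' \<tau> x $ 2 * m' \<tau> x $ 2)) has_vector_derivative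
      (?pt * p t x + p t x * ?pt) * (m' t x $ 1 * m' t x $ 1 + m' t x $ 2 * m' t x $ 2)
      + (p t x * p t x) * ((?a1t * m' t x $ 1 + m' t x $ 1 * ?a1t)
        + (?a2t * m' t x $ 2 + m' t x $ 2 * ?a2t))) (at t within T)"
    by (intro has_vector_derivative_add has_vector_derivative_times at vt smooth_p)
  then have "((\<lambda>\<tau>. e \<tau> x * e \<tau> x) has_vector_derivative
      (?pt * p t x + p t x * ?pt) * (m' t x $ 1 * m' t x $ 1 + m' t x $ 2 * m' t x $ 2)
      + (p t x * p t x) * ((?a1t * m' t x $ 1 + m' t x $ 1 * ?a1t)
        + (?a2t * m' t x $ 2 + m' t x $ 2 * ?a2t))) (at t within T)"
    by (rule has_vector_derivative_transform[OF t, rotated]) (rule sq[OF _ x])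
  moreover have "((\<lambda>\<tau>. e \<tau> x * e \<tau> x) has_vector_derivative ?et * e t x + e t x * ?et) (at t within T)"
    by (intro has_vector_derivative_times vt smooth_e)
  ultimately have "?et * e t x + e t x * ?et =
      (?pt * p t x + p t x * ?pt) * (m' t x $ 1 * m' t x $ 1 + m' t x $ 2 * m' t x $ 2)
      + (p t x * p t x) * ((?a1t * m' t x $ 1 + m' t x $ 1 * ?a1t)
        + (?a2t * m' t x $ 2 + m' t x $ 2 * ?a2t))"
    by (rule vector_derivative_unique_within[OF at_T[OF t], rotated])
  then have et: "e t x * ?et = p t x * ?pt * N t x
      + (p t x)\<^sup>2 * (m' t x $ 1 * ?a1t + m' t x $ 2 * ?a2t)"
    by (simp add: power2_eq_square algebra_simps)
  have "((\<lambda>y. e t y * \<rho>1 t y) has_vector_derivative ?ex * \<rho>1 t x + e t x * ?\<rho>') (at x)"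
    by (intro has_vector_derivative_times vx smooth_e smooth_\<rho>)
  then have r': "xderiv (\<lambda>y. e t y * \<rho>1 t y) x = ?ex * \<rho>1 t x + e t x * ?\<rho>'"
    by (rule xderivI)
  show ?thesis
    using speed_identity[OF u_cone(3)[OF t x] speed_eq(2,3)[OF t x] ex, of r3 "\<rho>1 t x" "\<rho>2 t x" ?\<rho>' ?\<sigma>']
    unfolding et vmt1 vmt2 r' scaling_rate_def by (simp add: algebra_simps)
qed

end

text \<open>Uniqueness for a homogeneous linear equation, by an integrating factor.\<close>

lemma linear_ode_zero:
  fixes f k :: "real \<Rightarrow> real"
  assumes T: "is_interval T" and t0: "t0 \<in> T" and t: "t \<in> T"
    and f: "\<And>s. s \<in> T \<Longrightarrow> (f has_vector_derivative k s * f s) (at s within T)"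
    and k: "continuous_on T k" and f0: "f t0 = 0"
  shows "f t = 0"
proof -
  define a b where "a = min t0 t" and "b = max t0 t"
  have ab: "{a..b} \<subseteq> T" "t0 \<in> {a..b}" "t \<in> {a..b}"
    using mem_is_interval_1_I[OF T t0 t] mem_is_interval_1_I[OF T t t0]
    by (auto simp: a_def b_def min_def max_def split: if_splits)
  define K where "K s = integral {a..s} k" for s
  have K: "(K has_vector_derivative k s) (at s within {a..b})" if "s \<in> {a..b}" for s
    unfolding K_def[abs_def]
    by (rule integral_has_vector_derivative[OF continuous_on_subset[OF k ab(1)] that])
  have "((\<lambda>s. f s * exp (- K s)) has_vector_derivative 0) (at s within {a..b})"
    if s: "s \<in> {a..b}" for s
  proof -
    have "(f has_vector_derivative k s * f s) (at s within {a..b})"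
      by (rule has_vector_derivative_within_subset[OF f ab(1)]) (use s ab in auto)
    moreover have "((\<lambda>s. exp (- K s)) has_vector_derivative - k s * exp (- K s)) (at s within {a..b})"
      using K[OF s]
      by (auto simp: has_real_derivative_iff_has_vector_derivative[symmetric] intro!: derivative_eq_intros)
    ultimately show ?thesis
      using has_vector_derivative_times by (fastforce simp: algebra_simps)
  qed
  then obtain C where C: "\<And>s. s \<in> {a..b} \<Longrightarrow> f s * exp (- K s) = C"
    using has_vector_derivative_zero_constant[of "{a..b}" "\<lambda>s. f s * exp (- K s)"] by auto
  have "f t * exp (- K t) = f t0 * exp (- K t0)" using C ab(2,3) by metis
  then show ?thesis using f0 by simp
qed

section \<open>The correspondence of the two evolutions\<close>

lemma sphere_mat_vector:
  "sphere_mat c x *v vector [r1, r2] =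
    vector [xderiv c x $ 1 * r1 - xderiv c x $ 2 * r2, xderiv c x $ 2 * r1 + xderiv c x $ 1 * r2]"
  by (simp add: sphere_mat_def Let_def vec_eq_iff forall_2 matrix_vector_mult_def sum_2)

context regular_cone_flow
begin

lemma sphere_evolution_equation_iff:
  assumes t: "t \<in> T" and x: "x \<in> X"
  shows "((\<lambda>\<tau>. m \<tau> x) has_vector_derivative sphere_mat (m t) x *v vector [r1, r2]) (at t within T)
    \<longleftrightarrow> r1 = \<rho>1 t x \<and> r2 = \<rho>2 t x"
proof -
  have "((\<lambda>\<tau>. m \<tau> x) has_vector_derivative sphere_mat (m t) x *v vector [r1, r2]) (at t within T)
      \<longleftrightarrow> mt t x = sphere_mat (m t) x *v vector [r1, r2]"
    using vector_derivative_unique_within[OF at_T[OF t]] smooth_flow_has_tderiv[OF smooth_m t x] by metis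
  then show ?thesis
    by (simp add: sphere_mat_vector vec_eq_iff forall_2 frame_coords_iff[OF t x] del: Proj_nth)
qed

lemma sphere_flow_m: "sphere_flow T X m"
  by (simp add: sphere_flow_def smooth_m speed_eq(4))

lemma unit_speed_lift:
  assumes unit: "\<And>x. x \<in> X \<Longrightarrow> e t x = 1" and t: "t \<in> T" and x: "x \<in> X"
  shows "u t x = cone_lift (m t) x"
proof -
  have "u t x = sgn (p t x) *\<^sub>R cone_lift (m t) x"
    by (rule unit_speed_eq_cone_lift(2)[OF X_open curve_u[OF t] u_cone(2)[OF t] u_cone(4)[OF t] unit x])
  also have "sgn (p t x) = 1" using u_cone(3)[OF t x] by simp
  finally show ?thesis by (simp only: scaleR_one)
qed

lemma regular_germs:
  assumes "t \<in> T" "x \<in> X"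
  shows "regular_sphere_germ (m t) x" "regular_cone_germ (u t) x"
proof -
  show "regular_sphere_germ (m t) x"
    unfolding regular_sphere_germ_def
    by (intro exI[of _ X] conjI ballI X_open assms smooth_flow_smooth_curve[OF smooth_m] speed_eq(4))
  show "regular_cone_germ (u t) x"
    unfolding regular_cone_germ_def
    by (intro exI[of _ X] conjI ballI X_open assms curve_u u_cone)
qed

text \<open>The speed \<open>e\<close> satisfies \<open>e\<^sub>t = r\<^sub>1' (1 - e)\<close>, so it stays equal to 1. Invariants may depend on the
  jet in a discontinuous way, so continuity of the coefficient \<open>r\<^sub>1'\<close> in \<open>t\<close> comes from the evolution equation,
  which expresses \<open>r\<^sub>1\<close> as \<open>e \<rho>1\<close>, a smooth function of the flow.\<close>

lemma speed_preserved:
  assumes ev: "\<And>t x. t \<in> T \<Longrightarrow> x \<in> X \<Longrightarrow>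
      tderiv T p t x = scaling_rate (r1 t x) (r2 t x) (- xderiv (r1 t) x) t x
      \<and> r1 t x = e t x * \<rho>1 t x \<and> r2 t x = e t x * \<rho>2 t x"
    and t0: "t0 \<in> T" and init: "\<And>x. x \<in> X \<Longrightarrow> e t0 x = 1" and t: "t \<in> T" and x: "x \<in> X"
  shows "e t x = 1"
proof -
  let ?r = "\<lambda>t x. e t x * \<rho>1 t x"
  have r: "smooth_flow T X ?r" by (rule smooth_flow_mult[OF smooth_e smooth_\<rho>(1)])
  have r': "xderiv (r1 s) x = xderiv (?r s) x" if "s \<in> T" for s
    by (rule xderiv_cong[OF X_open x]) (use ev that in blast)
  have et: "tderiv T e s x = - xderiv (?r s) x * (e s x - 1)" if s: "s \<in> T" for s
  proof -
    have "e s x * tderiv T e s x = e s x * (e s x * (- xderiv (?r s) x) + xderiv (?r s) x)"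
      using speed_evolution[OF s x, of "- xderiv (?r s) x"] ev[OF s x] r'[OF s] by simp
    then have "tderiv T e s x = e s x * (- xderiv (?r s) x) + xderiv (?r s) x"
      using u_cone(5)[OF s x] by simp
    then show ?thesis by (simp add: algebra_simps)
  qed
  have "e t x - 1 = 0"
  proof (rule linear_ode_zero[OF T_interval t0 t, where k = "\<lambda>s. - xderiv (?r s) x"])
    show "((\<lambda>s. e s x - 1) has_vector_derivative - xderiv (?r s) x * (e s x - 1)) (at s within T)"
      if s: "s \<in> T" for s
    proof -
      have "((\<lambda>s. e s x - 1) has_vector_derivative tderiv T e s x - 0) (at s within T)"
        by (intro has_vector_derivative_diff smooth_flow_has_tderiv[OF smooth_e s x]
            has_vector_derivative_const)
      then show ?thesis using et[OF s] by simp
    qed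
    show "continuous_on T (\<lambda>s. - xderiv (?r s) x)"
      by (intro continuous_on_minus smooth_flow_continuous_compose[OF smooth_flow_xderiv[OF r]])
        (use x in \<open>auto intro: continuous_intros\<close>)
    show "e t0 x - 1 = 0" using init[OF x] by simp
  qed
  then show ?thesis by simp
qed

lemma sphere_function_of_cone_function:
  assumes unit: "\<And>t x. t \<in> T \<Longrightarrow> x \<in> X \<Longrightarrow> e t x = 1"
    and r: "function_of_invariants cone_invariant T X u r"
  shows "function_of_invariants sphere_invariant T X m r"
proof (rule function_of_invariants_transfer[OF X_open r])
  fix n I assume "cone_invariant n I"
  from cone_invariant_to_sphere[OF this] obtain G where G: "sphere_invariant (Suc n) G"
    "\<forall>m x. regular_sphere_germ m x \<longrightarrow> G (jet (Suc n) m x) = I (jet n (cone_lift m) x)"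
    by (elim exE conjE)
  have A: "G (jet (Suc n) (m t) x) = I (jet n (u t) x)" if "t \<in> T" "x \<in> X" for t x
  proof -
    have "jet n (u t) x = jet n (cone_lift (m t)) x"
      by (rule jet_cong[OF X_open that(2)]) (rule unit_speed_lift[OF unit[OF that(1)] that(1)])
    then show ?thesis using G(2)[rule_format, OF regular_germs(1)[OF that]] by (simp only:)
  qed
  show "\<exists>n' I'. sphere_invariant n' I' \<and>
      (\<forall>t\<in>T. \<forall>x\<in>X. I' (jet n' (m t) x) = I (jet n (u t) x))"
    by (rule exI[of _ "Suc n"], rule exI[of _ G], rule conjI[OF G(1)], intro ballI, rule A)
qed

lemma cone_function_of_sphere_function:
  assumes c: "\<And>t x. t \<in> T \<Longrightarrow> x \<in> X \<Longrightarrow> c t x = m t x"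
    and r: "function_of_invariants sphere_invariant T X c r"
  shows "function_of_invariants cone_invariant T X u r"
proof (rule function_of_invariants_transfer[OF X_open r])
  fix n I assume "sphere_invariant n I"
  from sphere_invariant_to_cone[OF this] obtain F where F: "cone_invariant n F"
    "\<forall>c x. regular_cone_germ c x \<longrightarrow> c x $ 3 \<noteq> 0 \<longrightarrow>
      F (jet n c x) = I (jet n (\<lambda>y. Proj (c y)) x)"
    by (elim exE conjE)
  have A: "F (jet n (u t) x) = I (jet n (c t) x)" if "t \<in> T" "x \<in> X" for t x
  proof -
    have "jet n (c t) x = jet n (m t) x"
      by (rule jet_cong[OF X_open that(2)]) (rule c[OF that(1)])
    then show ?thesis
      using F(2)[rule_format, OF regular_germs(2)[OF that] u_cone(4)[OF that]] by (simp only:)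
  qed
  show "\<exists>n' I'. cone_invariant n' I' \<and>
      (\<forall>t\<in>T. \<forall>x\<in>X. I' (jet n' (u t) x) = I (jet n (c t) x))"
    by (rule exI[of _ n], rule exI[of _ F], rule conjI[OF F(1)], intro ballI, rule A)
qed

lemma cone_evolution_projects:
  assumes ev: "cone_evolution T X u r1 r2 r3"
    and r3: "\<And>t x. t \<in> T \<Longrightarrow> x \<in> X \<Longrightarrow> r3 t x = - xderiv (r1 t) x"
    and t0: "t0 \<in> T" and init: "\<And>x. x \<in> X \<Longrightarrow> e t0 x = 1"
  shows "\<forall>t\<in>T. \<forall>x\<in>X. e t x = 1" and "sphere_evolution T X m r1 r2"
proof -
  have eqs: "tderiv T p t x = scaling_rate (r1 t x) (r2 t x) (- xderiv (r1 t) x) t x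
      \<and> r1 t x = e t x * \<rho>1 t x \<and> r2 t x = e t x * \<rho>2 t x" if "t \<in> T" "x \<in> X" for t x
  proof -
    have "((\<lambda>\<tau>. local_coords (u \<tau> x)) has_vector_derivative
        cone_mat (u t) x *v vector [r1 t x, r2 t x, r3 t x]) (at t within T)"
      using ev that by (simp add: cone_evolution_def)
    then show ?thesis
      by (simp only: cone_evolution_equation_iff[OF that] r3[OF that])
  qed
  have unit: "e t x = 1" if "t \<in> T" "x \<in> X" for t x
    by (rule speed_preserved[OF eqs t0 init that])
  then show "\<forall>t\<in>T. \<forall>x\<in>X. e t x = 1" by blast
  show "sphere_evolution T X m r1 r2"
    unfolding sphere_evolution_def
  proof (intro conjI ballI)
    show "function_of_invariants sphere_invariant T X m r1"
      "function_of_invariants sphere_invariant T X m r2"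
      by (rule sphere_function_of_cone_function[OF unit];
          use ev in \<open>simp add: cone_evolution_def\<close>)+
    fix t x assume tx: "t \<in> T" "x \<in> X"
    show "((\<lambda>\<tau>. m \<tau> x) has_vector_derivative sphere_mat (m t) x *v vector [r1 t x, r2 t x])
        (at t within T)"
      using eqs[OF tx] unit[OF tx] by (simp add: sphere_evolution_equation_iff[OF tx])
  qed
qed

lemma sphere_evolution_lifts:
  assumes unit: "\<And>t x. t \<in> T \<Longrightarrow> x \<in> X \<Longrightarrow> e t x = 1"
    and c: "\<And>t x. t \<in> T \<Longrightarrow> x \<in> X \<Longrightarrow> c t x = m t x"
    and ev: "sphere_evolution T X c s1 s2"
  shows "cone_evolution T X u s1 s2 (\<lambda>t x. - xderiv (s1 t) x)"
proof -
  have s: "s1 t x = \<rho>1 t x \<and> s2 t x = \<rho>2 t x" if t: "t \<in> T" and x: "x \<in> X" for t x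
  proof -
    have "((\<lambda>\<tau>. c \<tau> x) has_vector_derivative sphere_mat (c t) x *v vector [s1 t x, s2 t x]) (at t within T)"
      using ev t x by (simp add: sphere_evolution_def)
    moreover have "sphere_mat (c t) x = sphere_mat (m t) x"
      using xderiv_cong[OF X_open x c[OF t]] by (simp add: sphere_mat_def)
    ultimately have "((\<lambda>\<tau>. c \<tau> x) has_vector_derivative sphere_mat (m t) x *v vector [s1 t x, s2 t x])
        (at t within T)" by simp
    then have "((\<lambda>\<tau>. m \<tau> x) has_vector_derivative sphere_mat (m t) x *v vector [s1 t x, s2 t x])
        (at t within T)"
      by (rule has_vector_derivative_transform[OF t, rotated]) (simp add: c x)
    then show ?thesis by (simp only: sphere_evolution_equation_iff[OF t x])
  qed
  show ?thesis
    unfolding cone_evolution_def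
  proof (intro conjI ballI)
    have fs: "function_of_invariants sphere_invariant T X c s1"
      "function_of_invariants sphere_invariant T X c s2"
      using ev by (simp_all add: sphere_evolution_def)
    show "function_of_invariants cone_invariant T X u s1"
      by (rule cone_function_of_sphere_function[OF c fs(1)])
    show "function_of_invariants cone_invariant T X u s2"
      by (rule cone_function_of_sphere_function[OF c fs(2)])
    show "function_of_invariants cone_invariant T X u (\<lambda>t x. - xderiv (s1 t) x)"
      by (rule cone_function_of_sphere_function[OF c function_of_invariants_uminus_xderiv[OF X_open fs(1)]])
    fix t x assume t: "t \<in> T" and x: "x \<in> X"
    have "xderiv (s1 t) x = xderiv (\<lambda>y. e t y * \<rho>1 t y) x"
      by (rule xderiv_cong[OF X_open x]) (simp add: s unit t)
    moreover have "((\<lambda>\<tau>. e \<tau> x) has_vector_derivative 0) (at t within T)"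
      by (rule has_vector_derivative_transform[OF t _ has_vector_derivative_const[of 1]]) (rule unit[OF _ x])
    then have "tderiv T e t x = 0" by (rule tderivI[where c = e, OF t])
    ultimately have "p t x * N t x *
        (tderiv T p t x - scaling_rate (s1 t x) (s2 t x) (- xderiv (s1 t) x) t x) = 0"
      using speed_evolution[OF t x, of "- xderiv (s1 t) x"] by (simp add: unit s t x)
    then have "tderiv T p t x = scaling_rate (s1 t x) (s2 t x) (- xderiv (s1 t) x) t x"
      using u_cone(4)[OF t x] speed_eq(5)[OF t x] by auto
    then show "((\<lambda>\<tau>. local_coords (u \<tau> x)) has_vector_derivative
        cone_mat (u t) x *v vector [s1 t x, s2 t x, - xderiv (s1 t) x]) (at t within T)"
      using cone_evolution_equation_iff[OF t x] by (simp add: s unit t x)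
  qed
qed

end

context flow_domain
begin

lemma arclength_lift_cone_lift:
  assumes m: "sphere_flow T X m"
  shows "arclength_lift T X m (\<lambda>t. cone_lift (m t))"
proof -
  have sm: "smooth_flow T X m" and m': "\<And>t x. t \<in> T \<Longrightarrow> x \<in> X \<Longrightarrow> xderiv (m t) x \<noteq> 0"
    using m by (auto simp: sphere_flow_def)
  note curve = smooth_flow_smooth_curve[OF sm]
  have N: "smooth_flow T X (\<lambda>t x. speed_sq (m t) x powr (-1/2))"
    by (intro smooth_flow_powr smooth_flow_add smooth_flow_mult smooth_flow_nth
        smooth_flow_xderiv[OF sm] speed_sq_pos m')
  have "smooth_flow T X (\<lambda>t x. cone_lift (m t) x $ i)" for i
  proof -
    have q: "smooth_flow T X (\<lambda>t x. speed_sq (m t) x powr (-1/2) * ((m t x $ 1 * m t x $ 1 + m t x $ 2 * m t x $ 2) * (1/2)))"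
      "smooth_flow T X (\<lambda>t x. speed_sq (m t) x powr (-1/2) * m t x $ j)" for j
      by (intro N smooth_flow_add smooth_flow_mult smooth_flow_const smooth_flow_nth sm)+
    have l: "smooth_flow T X (\<lambda>t x. cone_lift (m t) x $ i)"
      if "\<And>t x. t \<in> T \<Longrightarrow> x \<in> X \<Longrightarrow> g t x = cone_lift (m t) x $ i" "smooth_flow T X g" for g i
      by (rule smooth_flow_cong[OF that])
    have "smooth_flow T X (\<lambda>t x. cone_lift (m t) x $ 0)" "smooth_flow T X (\<lambda>t x. cone_lift (m t) x $ 1)"
      "smooth_flow T X (\<lambda>t x. cone_lift (m t) x $ 2)" "smooth_flow T X (\<lambda>t x. cone_lift (m t) x $ 3)"
      by (rule l[OF cone_lift_nth(1)[OF m', symmetric] q(1)] l[OF cone_lift_nth(2)[OF m', symmetric] q(2)]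
          l[OF cone_lift_nth(3)[OF m', symmetric] q(2)] l[OF cone_lift_nth(4)[OF m', symmetric] N]; assumption)+
    then show ?thesis using exhaust_coords[of i] by (elim disjE) simp_all
  qed
  then have "smooth_flow T X (\<lambda>t. cone_lift (m t))"
    by (rule smooth_flow_vecI)
  moreover have "normJ (xderiv (cone_lift (m t)) x) = 1" if "t \<in> T" "x \<in> X" for t x
    by (rule normJ_cone_lift[OF X_open curve[OF that(1)] m'[OF that(1)] that(2)])
  ultimately show ?thesis
    using m' by (simp add: arclength_lift_def cone_flow_def upper_cone_def cone_lift_light_cone
        cone_lift_3_pos Proj_cone_lift)
qed

lemma arclength_lift_unique:
  assumes v: "arclength_lift T X m v" and t: "t \<in> T" and x: "x \<in> X"
  shows "v t x = cone_lift (m t) x"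
proof -
  interpret v: regular_cone_flow T X v
    by unfold_locales (use v in \<open>simp add: arclength_lift_def\<close>)
  have "v t x = cone_lift (v.m t) x"
    by (rule v.unit_speed_lift[OF _ t x]) (use v t in \<open>simp add: arclength_lift_def\<close>)
  moreover have "v.m t y = m t y" if "y \<in> X" for y
    using v t that by (simp add: arclength_lift_def)
  ultimately show ?thesis
    using xderiv_cong[OF X_open x, of "v.m t" "m t"] x by (simp add: cone_lift_def)
qed

end

theorem theorem5p1:
  fixes T X :: "real set" and t0 :: real
  assumes "is_interval T" and "t0 \<in> T" and "\<exists>t\<in>T. t \<noteq> t0"
    and "is_interval X" and "open X"
  shows
    "(\<forall>u r1 r2 r3.
        cone_flow T X u \<and> cone_evolution T X u r1 r2 r3 \<and>
        (\<forall>t\<in>T. \<forall>x\<in>X. r3 t x = - xderiv (r1 t) x) \<and>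
        (\<forall>x\<in>X. normJ (xderiv (u t0) x) = 1)
      \<longrightarrow>
        (\<forall>t\<in>T. \<forall>x\<in>X. normJ (xderiv (u t) x) = 1) \<and>
        sphere_flow T X (\<lambda>t x. Proj (u t x)) \<and>
        sphere_evolution T X (\<lambda>t x. Proj (u t x)) r1 r2)
     \<and>
     (\<forall>m s1 s2.
        sphere_flow T X m \<and> sphere_evolution T X m s1 s2
      \<longrightarrow>
        (\<exists>u. arclength_lift T X m u \<and>
             (\<forall>v. arclength_lift T X m v \<longrightarrow> (\<forall>t\<in>T. \<forall>x\<in>X. v t x = u t x)) \<and>
             cone_evolution T X u s1 s2 (\<lambda>t x. - xderiv (s1 t) x)))"
proof -
  interpret flow_domain T X
    using assms by unfold_locales blast+
  show ?thesis
  proof (intro conjI allI impI; elim conjE)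
    fix u r1 r2 r3
    assume u: "cone_flow T X u" and ev: "cone_evolution T X u r1 r2 r3"
      and r3: "\<forall>t\<in>T. \<forall>x\<in>X. r3 t x = - xderiv (r1 t) x"
      and init: "\<forall>x\<in>X. normJ (xderiv (u t0) x) = 1"
    interpret regular_cone_flow T X u
      by unfold_locales (rule u)
    note proj = cone_evolution_projects[OF ev r3[rule_format] assms(2) init[rule_format]]
    show "\<forall>t\<in>T. \<forall>x\<in>X. normJ (xderiv (u t) x) = 1"
      and "sphere_flow T X (\<lambda>t x. Proj (u t x))"
      and "sphere_evolution T X (\<lambda>t x. Proj (u t x)) r1 r2"
      using proj sphere_flow_m by simp_all
  next
    fix m s1 s2
    assume m: "sphere_flow T X m" and ev: "sphere_evolution T X m s1 s2"
    let ?u = "\<lambda>t. cone_lift (m t)"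
    have lift: "arclength_lift T X m ?u" by (rule arclength_lift_cone_lift[OF m])
    interpret regular_cone_flow T X ?u
      by unfold_locales (use lift in \<open>simp add: arclength_lift_def\<close>)
    have "cone_evolution T X ?u s1 s2 (\<lambda>t x. - xderiv (s1 t) x)"
      by (rule sphere_evolution_lifts[OF _ _ ev]) (use lift in \<open>simp_all add: arclength_lift_def\<close>)
    then show "\<exists>u. arclength_lift T X m u \<and>
             (\<forall>v. arclength_lift T X m v \<longrightarrow> (\<forall>t\<in>T. \<forall>x\<in>X. v t x = u t x)) \<and>
             cone_evolution T X u s1 s2 (\<lambda>t x. - xderiv (s1 t) x)"
      using lift arclength_lift_unique by blast
  qed
qed

end
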